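(* Let $\mathscr C$ be a non-empty set of finite-dimensional vector spaces over a field $\mathbb F$, let $\mathcal L=\mathcal L(\mathscr C)$ be the linear category over $\mathscr C$ (all linear maps between members of $\mathscr C$), let $\xi$ be the least cardinal strictly greater than $\dim(V)$ for every $V\in\mathscr C$, and let $I_r=\{\alpha\in\mathcal L:\operatorname{rank}(\alpha)\le r\}$ for $0\le r<\xi$, with $I_\omega=\mathcal L$ if $\xi=\omega$. Then for any $r\ge0$ (i.e. $0\le r<\xi$, and also $r=\omega$ if $\xi=\omega$), the congruences on $I_r$ are precisely the universal congruence $\widetilde\nabla_{I_r}$ and those of the form $$R^{I_r}_{I_q,\mathbf N}\qquad\text{for some }0\le q<r\text{ and some }\mathbf N=(N_{q+1}^\natural,\mathcal Z_{q+2}(H_{q+2})^\natural,\mathcal Z_{q+3}(H_{q+3})^\natural,\ldots)$$ (indices running over all finite $p$ with $q+1\le p\le r$), where $$N_{q+1}\unlhd\operatorname{GL}_{q+1},\qquad \mathbb F^\times\ge H_{q+2}\ge H_{q+3}\ge\cdots,\qquad \mathcal Z_{q+1}(H_{q+2})\le N_{q+1}\ \text{ if }q\le r-2.$$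
   Context: **Linear category.** Morphisms are triples $(U,\alpha,V)$ with $U,V\in\mathscr C$ and $\alpha:U\to V$ linear; $\mathbf d(U,\alpha,V)=U$, $\mathbf r(U,\alpha,V)=V$, $(U,\alpha,V)(V,\beta,W)=(U,\alpha\beta,W)$ (first $\alpha$, then $\beta$). $\operatorname{rank}(\alpha)=\dim(\operatorname{im}\alpha)$. The $\mathscr J=\mathscr D$-classes of $\mathcal L$ are $D_q=\{\alpha:\operatorname{rank}(\alpha)=q\}$, $0\le q<\xi$, all stable and regular. $\operatorname{GL}_q=\operatorname{GL}_q(\mathbb F)$, $\mathbb F^\times=\mathbb F\setminus\{0\}$, and for a subgroup $H\le\mathbb F^\times$, $\mathcal Z_q(H)=\{cE_q:c\in H\}$, where $E_q$ is the $q\times q$ identity matrix. **Groups.** For each $0\le q<\xi$ fix $V_q\in\mathscr C$ with $n_q=\dim V_q\ge q$ and a basis $\mathscr B_q$ of $V_q$. For $A\in\operatorname{GL}_q$, $A^\natural:V_q\to V_q$ is the linear map whose matrix with respect to $\mathscr B_q$ is the $n_q\times n_q$ block matrix $\begin{bmatrix}A&O\\O&O\end{bmatrix}$. For $N\subseteq\operatorname{GL}_q$, $N^\natural=\{A^\natural:A\in N\}$; $\operatorname{GL}_q^\natural$ is a group $\mathscr H$-class in $D_q$. **Congruences.** For a partial semigroup (category without necessarily having identities) $S$ with domain/range maps $\mathbf d,\mathbf r$, write $x\sim y$ if $\mathbf d(x)=\mathbf d(y)$ and $\mathbf r(x)=\mathbf r(y)$. A congruence on $S$ is an equivalence contained in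 $\sim$ and compatible with all defined left and right multiplications by elements of $S$. $\Delta_S$ is equality, $\widetilde\nabla_S=\{(x,y)\in S\times S:x\sim y\}$; for an ideal $I$ of $S$, $R_I^S=\widetilde\nabla_I\cup\Delta_S$. For $N$ a normal subgroup of a group $\mathscr H$-class contained in $D_p$, $\nu_N=\{(axb,ayb):x,y\in N,\ a,b\in\mathcal L,\ axb,ayb\in D_p\}$. For $\mathbf N=(N_{q+1}^\natural,N_{q+2}^\natural,\ldots)$ with $N_p\unlhd\operatorname{GL}_p$, $R^{I_r}_{I_q,\mathbf N}=R^{I_r}_{I_q}\cup\bigcup_{p}\nu_{N_p^\natural}$. *)

theory Defs
  imports
    "Jordan_Normal_Form.VS_Connect"
    "HOL-Algebra.Multiplicative_Group"
    "HOL-Library.Extended_Nat"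
begin

subsection \<open>The linear category\<close>

text \<open>A vector space is a module record \<open>V\<close> with \<open>vectorspace class_ring V\<close>; the ring
  multiplication and unit that such a record inherits play no role. A morphism is a triple
  \<open>(U, f, W)\<close>, where \<open>f\<close> is undefined outside the carrier of \<open>U\<close>, so that equality of triples
  is equality of linear maps.\<close>

type_synonym ('a, 'v) morphism = "('a, 'v) module \<times> ('v \<Rightarrow> 'v) \<times> ('a, 'v) module"

abbreviation vdim :: "('a::field, 'v) module \<Rightarrow> nat" where
  "vdim V \<equiv> vectorspace.dim class_ring V"

definition lin_cat :: "('a::field, 'v) module set \<Rightarrow> ('a, 'v) morphism set" where
  "lin_cat C = {(U, f, W). U \<in> C \<and> W \<in> C \<and> linear_map class_ring U W f \<and> f \<in> extensional (carrier U)}"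

definition mdom :: "('a, 'v) morphism \<Rightarrow> ('a, 'v) module" where
  "mdom x = fst x"

definition mran :: "('a, 'v) morphism \<Rightarrow> ('a, 'v) module" where
  "mran x = snd (snd x)"

text \<open>Composition is written from left to right. It is a total function, but it is meaningful only
  when \<open>mran x = mdom y\<close>; every use below is guarded accordingly.\<close>

definition mcomp :: "('a, 'v) morphism \<Rightarrow> ('a, 'v) morphism \<Rightarrow> ('a, 'v) morphism" (infixl "\<cdot>\<^sub>L" 70) where
  "x \<cdot>\<^sub>L y = (mdom x, compose (carrier (mdom x)) (fst (snd y)) (fst (snd x)), mran y)"

definition mrank :: "('a::field, 'v) morphism \<Rightarrow> nat" where
  "mrank x = vdim ((mran x)\<lparr>carrier := fst (snd x) ` carrier (mdom x)\<rparr>)"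

text \<open>All dimensions are finite, so the least cardinal above them is at most \<open>\<omega>\<close>, which is
  \<open>\<infinity>\<close> in \<open>enat\<close>.\<close>

definition xi :: "('a::field, 'v) module set \<Rightarrow> enat" where
  "xi C = (LEAST k. \<forall>V\<in>C. enat (vdim V) < k)"

definition Dclass :: "('a::field, 'v) module set \<Rightarrow> nat \<Rightarrow> ('a, 'v) morphism set" where
  "Dclass C q = {x \<in> lin_cat C. mrank x = q}"

definition rank_ideal :: "('a::field, 'v) module set \<Rightarrow> enat \<Rightarrow> ('a, 'v) morphism set" where
  "rank_ideal C r = {x \<in> lin_cat C. enat (mrank x) \<le> r}"


subsection \<open>Congruences on subsemigroups of the linear category\<close>

definition nabla :: "('a, 'v) morphism set \<Rightarrow> ('a, 'v) morphism rel" where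
  "nabla S = {(x, y). x \<in> S \<and> y \<in> S \<and> mdom x = mdom y \<and> mran x = mran y}"

definition congruence :: "('a, 'v) morphism set \<Rightarrow> ('a, 'v) morphism rel \<Rightarrow> bool" where
  "congruence S \<sigma> \<longleftrightarrow> equiv S \<sigma> \<and> \<sigma> \<subseteq> nabla S \<and>
     (\<forall>(x, y) \<in> \<sigma>. \<forall>a \<in> S.
        (mran a = mdom x \<longrightarrow> (a \<cdot>\<^sub>L x, a \<cdot>\<^sub>L y) \<in> \<sigma>) \<and>
        (mran x = mdom a \<longrightarrow> (x \<cdot>\<^sub>L a, y \<cdot>\<^sub>L a) \<in> \<sigma>))"

definition rees :: "('a, 'v) morphism set \<Rightarrow> ('a, 'v) morphism set \<Rightarrow> ('a, 'v) morphism rel" where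
  "rees S I = nabla I \<union> Id_on S"

definition nu :: "('a::field, 'v) module set \<Rightarrow> nat \<Rightarrow> ('a, 'v) morphism set \<Rightarrow> ('a, 'v) morphism rel" where
  "nu C p N = {(a \<cdot>\<^sub>L x \<cdot>\<^sub>L b, a \<cdot>\<^sub>L y \<cdot>\<^sub>L b) | x y a b.
     x \<in> N \<and> y \<in> N \<and> a \<in> lin_cat C \<and> b \<in> lin_cat C \<and>
     mran a = mdom x \<and> mran x = mdom b \<and> mran a = mdom y \<and> mran y = mdom b \<and>
     a \<cdot>\<^sub>L x \<cdot>\<^sub>L b \<in> Dclass C p \<and> a \<cdot>\<^sub>L y \<cdot>\<^sub>L b \<in> Dclass C p}"


subsection \<open>Matrix groups\<close>

definition GL :: "nat \<Rightarrow> 'a::field mat monoid" where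
  "GL q = units_of (ring_mat TYPE('a) q ())"

abbreviation field_units :: "'a::field monoid" where
  "field_units \<equiv> mult_of class_ring"

definition scalar_mats :: "nat \<Rightarrow> 'a::field set \<Rightarrow> 'a mat set" where
  "scalar_mats q H = {c \<cdot>\<^sub>m 1\<^sub>m q | c. c \<in> H}"

definition ordered_basis :: "('a::field, 'v) module \<Rightarrow> 'v list \<Rightarrow> bool" where
  "ordered_basis V bs \<longleftrightarrow> distinct bs \<and> vectorspace.basis class_ring V (set bs)"

text \<open>As maps are composed from left to right, the rows of the matrix of a map hold the coordinates
  of the images of the basis vectors; with this convention products of maps correspond to products
  of matrices in the same order.\<close>

definition has_matrix :: "('a::field, 'v) module \<Rightarrow> 'v list \<Rightarrow> ('v \<Rightarrow> 'v) \<Rightarrow> 'a mat \<Rightarrow> bool" where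
  "has_matrix V bs f M \<longleftrightarrow> M \<in> carrier_mat (length bs) (length bs) \<and>
     (\<forall>i < length bs. f (bs ! i) = (\<Oplus>\<^bsub>V\<^esub> j \<in> {..<length bs}. M $$ (i, j) \<odot>\<^bsub>V\<^esub> bs ! j))"

definition corner_mat :: "nat \<Rightarrow> 'a::zero mat \<Rightarrow> 'a mat" where
  "corner_mat n A = (let q = dim_row A in
     four_block_mat A (0\<^sub>m q (n - q)) (0\<^sub>m (n - q) q) (0\<^sub>m (n - q) (n - q)))"

definition natural_map :: "('a::field, 'v) module \<Rightarrow> 'v list \<Rightarrow> 'a mat \<Rightarrow> ('a, 'v) morphism" where
  "natural_map V bs A = (V, (THE f. linear_map class_ring V V f \<and> f \<in> extensional (carrier V) \<and>
     has_matrix V bs f (corner_mat (vdim V) A)), V)"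

text \<open>Here \<open>N p\<close> is a set of \<open>p \<times> p\<close> matrices for each finite \<open>p\<close> with \<open>q + 1 \<le> p \<le> r\<close>, and it is
  transported to \<open>V p\<close> along the ordered basis \<open>B p\<close>.\<close>

definition rees_N :: "('a::field, 'v) module set \<Rightarrow> (nat \<Rightarrow> ('a, 'v) module) \<Rightarrow> (nat \<Rightarrow> 'v list) \<Rightarrow>
    enat \<Rightarrow> nat \<Rightarrow> (nat \<Rightarrow> 'a mat set) \<Rightarrow> ('a, 'v) morphism rel" where
  "rees_N C V B r q N = rees (rank_ideal C r) (rank_ideal C (enat q)) \<union>
     (\<Union>p \<in> {p. q + 1 \<le> p \<and> enat p \<le> r}. nu C p (natural_map (V p) (B p) ` N p))"

end

theory Submission
  imports Defs
begin

text \<open>In coordinates, every \<open>x\<close> of rank \<open>p\<close> factors as \<open>\<alpha> \<beta>\<close> through \<open>F\<^sup>p\<close>, uniquely up to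
  \<open>GL\<^sub>p\<close>, and the elements \<open>\<nu>\<close>-related to it are the \<open>\<alpha> G \<beta>\<close> with \<open>G\<close> in the normal subgroup.
  Given a congruence, the elements related to zero form an ideal: either everything, or the maps of
  rank at most some \<open>q < r\<close>. In the latter case let \<open>(x, y)\<close> be a related pair of higher rank. If a
  row vector \<open>u\<close> had \<open>u x = 0 \<noteq> u y\<close>, it could be completed to a matrix \<open>a\<close> of rank \<open>q + 1\<close> with
  \<open>rank (a y) = q + 1\<close>; but \<open>rank (a x) \<le> q\<close>, so \<open>a y\<close> would be related to zero. Hence \<open>x\<close> and \<open>y\<close>
  have the same kernel and, dually, the same image, that is, \<open>y = \<alpha> G \<beta>\<close> with \<open>G\<close> invertible. If
  \<open>p \<ge> q + 2\<close>, the same argument applied to \<open>(a \<beta>, a G \<beta>)\<close> for \<open>a\<close> of rank \<open>q + 1 < p\<close> shows that \<open>G\<close>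
  preserves every \<open>(q + 1)\<close>-dimensional subspace, so \<open>G\<close> is a scalar. Scalars survive restriction
  to lower rank, which makes the groups \<open>H\<^sub>p\<close> decrease.\<close>

text \<open>The multipliers of a congruence on \<open>I_r\<close> must themselves have rank at most
  r, and \<open>I_r\<close> need not contain any identity, so each multiplication is routed through
  some \<open>F^k\<close> with k <= r. Rank factorizations supply the multipliers: if
  \<open>M = \<alpha> * \<beta>\<close> has rank k, with one-sided inverses \<alpha>' and \<beta>',
  then all products with \<alpha>' or \<beta>' as a factor have rank at most k. The same device
  absorbs the unrestricted multipliers in \<open>nu\<close>. The completed matrix has rank q + 1
  because this is the least rank outside the zero class, and it is still at most r. For the
  converse, multiply a pair \<open>\<alpha> * \<beta>\<close>, \<open>\<alpha> * G * \<beta>\<close>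
  of rank p. If the rank stays p, the same G works. If it drops from p = q + 1, both products have
  rank at most q and are identified. If it drops from p > q + 1 to some k > q, then G is a scalar,
  commutes with everything, and has to lie in the group at rank k: this is what the inclusions
  between the groups express. At p = q + 1 nothing is demanded of lower ranks, so any normal
  subgroup is allowed there.\<close>

hide_const (open) up_ring.monom up_ring.coeff

subsection \<open>Matrices as endomorphisms of the polynomial space\<close>

text \<open>Matrices of all sizes live in a single ring, the endomorphisms of the space of polynomials with
  its basis of monomials, acting on row vectors. The \<open>n \<times> m\<close> matrices are the \<open>M\<close> with
  \<open>trunc n * M = M = M * trunc m\<close>, so that ring identities need no side conditions on dimensions.\<close>

typedef (overloaded) 'a linop = "{f::'a::field poly \<Rightarrow> 'a poly.
    (\<forall>p q. f (p + q) = f p + f q) \<and> (\<forall>c p. f (Polynomial.smult c p) = Polynomial.smult c (f p))}"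
  morphisms app Linop
  by (rule exI[of _ "\<lambda>p. p"]) auto

setup_lifting type_definition_linop

instantiation linop :: (field) ring_1
begin
lift_definition zero_linop :: "'a linop" is "\<lambda>p. 0" by auto
lift_definition one_linop :: "'a linop" is "\<lambda>p. p" by auto
lift_definition plus_linop :: "'a linop \<Rightarrow> 'a linop \<Rightarrow> 'a linop" is "\<lambda>f g p. f p + g p"
  by (auto simp: algebra_simps smult_add_right)
lift_definition minus_linop :: "'a linop \<Rightarrow> 'a linop \<Rightarrow> 'a linop" is "\<lambda>f g p. f p - g p"
  by (auto simp: algebra_simps smult_diff_right)
lift_definition uminus_linop :: "'a linop \<Rightarrow> 'a linop" is "\<lambda>f p. - f p" by auto
text \<open>The left factor acts first, so products follow \<open>mcomp\<close> and the row
  convention of \<open>has_matrix\<close>.\<close>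

lift_definition times_linop :: "'a linop \<Rightarrow> 'a linop \<Rightarrow> 'a linop" is "\<lambda>f g p. g (f p)" by auto
instance
proof
  show "(0::'a linop) \<noteq> 1" by transfer (auto simp: fun_eq_iff intro!: exI[of _ "1 :: 'a poly"])
qed (transfer; auto simp: algebra_simps fun_eq_iff)+
end

lemma app_add [simp]: "app M (p + q) = app M p + app M q"
  and app_smult [simp]: "app M (Polynomial.smult c p) = Polynomial.smult c (app M p)"
  using app[of M] by auto

lemma app_0 [simp]: "app M 0 = 0"
  using app_smult[of M 0 0] by simp

lemma app_sum: "app M (sum f S) = (\<Sum>x\<in>S. app M (f x))"
  by (induct S rule: infinite_finite_induct) auto

definition entry :: "'a::field linop \<Rightarrow> nat \<Rightarrow> nat \<Rightarrow> 'a" where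
  "entry M i j = coeff (app M (monom 1 i)) j"

lemma app_monom: "app M (monom c i) = Polynomial.smult c (app M (monom 1 i))"
  by (metis app_smult mult.right_neutral smult_monom)

lemma linop_eqI:
  assumes "\<And>i j. entry M i j = entry N i j" shows "M = N"
proof -
  have m: "app M (monom 1 i) = app N (monom 1 i)" for i
    using assms unfolding entry_def by (auto simp: poly_eq_iff)
  have "app M p = app N p" for p
  proof -
    have "app M (\<Sum>i\<le>degree p. monom (coeff p i) i) = app N (\<Sum>i\<le>degree p. monom (coeff p i) i)"
      unfolding app_sum by (rule sum.cong) (auto simp: app_monom[of _ "coeff p _"] m)
    then show ?thesis by (simp add: poly_as_sum_of_monoms)
  qed
  then show ?thesis by (simp add: app_inject[symmetric] fun_eq_iff)
qed

text \<open>\<open>trunc n\<close> serves as the identity of \<open>F^n\<close>, and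
  \<open>munit i j\<close> is the matrix unit with its 1 in row i and column j.\<close>

lift_definition trunc :: "nat \<Rightarrow> 'a::field linop" is "\<lambda>n p. poly_cutoff n p"
  by (auto simp: poly_eq_iff coeff_poly_cutoff)

lift_definition munit :: "nat \<Rightarrow> nat \<Rightarrow> 'a::field linop" is "\<lambda>i j p. monom (coeff p i) j"
  by (auto simp: poly_eq_iff)

lift_definition scale :: "'a::field \<Rightarrow> 'a linop \<Rightarrow> 'a linop" is "\<lambda>c f p. Polynomial.smult c (f p)"
  by (auto simp: smult_add_right mult.commute)

text \<open>The shifts move coordinates past a block of length k and serve to juxtapose blocks:
  \<open>shift_down k * trunc j * shift_up k\<close> projects onto the coordinates k to k + j -
  1.\<close>

lift_definition shift_up :: "nat \<Rightarrow> 'a::field linop" is "\<lambda>k p. monom 1 k * p"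
  by (auto simp: algebra_simps)

lift_definition shift_down :: "nat \<Rightarrow> 'a::field linop" is "\<lambda>k p. poly_shift k p"
  by (auto simp: poly_eq_iff coeff_poly_shift)

lemma trunc_mult_trunc [simp]: "trunc n * trunc m = trunc (min n m)"
  by transfer (auto simp: poly_eq_iff coeff_poly_cutoff fun_eq_iff)

lemma trunc_mult_trunc_left: "trunc n * (trunc m * M) = trunc (min n m) * M"
  by (simp flip: mult.assoc)

lemma munit_mult_munit: "munit i j * munit k l = (if j = k then munit i l else 0)"
  by transfer (auto simp: poly_eq_iff fun_eq_iff)

lemma trunc_mult_munit: "trunc n * munit i j = (if i < n then munit i j else 0)"
  by transfer (auto simp: poly_eq_iff fun_eq_iff coeff_poly_cutoff)

lemma munit_mult_trunc: "munit i j * trunc n = (if j < n then munit i j else 0)"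
  by transfer (auto simp: poly_eq_iff fun_eq_iff coeff_poly_cutoff)

lemma trunc_mult_munit_left: "trunc n * (munit i j * X) = (if i < n then munit i j * X else 0)"
  by (simp add: trunc_mult_munit flip: mult.assoc)

lemma trunc_Suc: "trunc (Suc n) = trunc n + munit n n"
  by transfer (auto simp: poly_eq_iff fun_eq_iff coeff_poly_cutoff)

lemma trunc_0 [simp]: "trunc 0 = 0"
  by transfer (auto simp: poly_eq_iff fun_eq_iff coeff_poly_cutoff)

lemma scale_mult_left [simp]: "scale c M * N = scale c (M * N)"
  and scale_mult_right [simp]: "M * scale c N = scale c (M * N)"
  and scale_scale [simp]: "scale c (scale d M) = scale (c * d) M"
  and scale_1 [simp]: "scale 1 M = M"
  and scale_0 [simp]: "scale 0 M = 0"
  and scale_0_right [simp]: "scale c 0 = 0"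
  and scale_add_right: "scale c (M + N) = scale c M + scale c N"
  and scale_diff_right: "scale c (M - N) = scale c M - scale c N"
  by (transfer; simp add: fun_eq_iff smult_add_right smult_diff_right)+

text \<open>In the pivot computation, an occurrence of M between two matrix units collapses to the
  pivot entry.\<close>

lemma munit_sandwich: "munit i i' * M * munit j' j = scale (entry M i' j') (munit i j)"
proof (rule linop_eqI)
  fix k l
  show "entry (munit i i' * M * munit j' j) k l = entry (scale (entry M i' j') (munit i j)) k l"
    unfolding entry_def
    by (cases "k = i") (simp_all add: times_linop.rep_eq munit.rep_eq scale.rep_eq)
qed

lemma entry_simps [simp]:
  "entry 0 i j = 0" "entry (M + N) i j = entry M i j + entry N i j" "entry (M - N) i j = entry M i j - entry N i j"
  "entry (scale c M) i j = c * entry M i j"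
  unfolding entry_def by (transfer; simp)+

lemma entry_trunc: "entry (trunc n) i j = (if i = j \<and> i < n then 1 else 0)"
  unfolding entry_def by (simp add: trunc.rep_eq coeff_poly_cutoff)

lemma entry_munit: "entry (munit i j) k l = (if i = k \<and> j = l then 1 else 0)"
  unfolding entry_def by (simp add: munit.rep_eq)

lemma entry_trunc_mult: "entry (trunc n * M) i j = (if i < n then entry M i j else 0)"
proof -
  have "poly_cutoff n (monom 1 i) = (if i < n then monom 1 i else (0::'a poly))"
    by (auto simp: poly_eq_iff coeff_poly_cutoff)
  then show ?thesis unfolding entry_def by (simp add: times_linop.rep_eq trunc.rep_eq)
qed

lemma entry_mult_trunc: "entry (M * trunc n) i j = (if j < n then entry M i j else 0)"
  unfolding entry_def by (simp add: times_linop.rep_eq trunc.rep_eq coeff_poly_cutoff)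

lemma shift_up_shift_down [simp]: "shift_up k * shift_down k = 1"
  by transfer (auto simp: poly_eq_iff fun_eq_iff coeff_poly_shift coeff_monom_mult)

lemma shift_down_trunc_shift_up: "shift_down k * trunc j * shift_up k = trunc (k + j) - trunc k"
  by transfer (auto simp: poly_eq_iff fun_eq_iff coeff_poly_shift coeff_monom_mult coeff_poly_cutoff)

lemma trunc_shift_down [simp]: "trunc k * shift_down k = 0"
  by transfer (auto simp: poly_eq_iff fun_eq_iff coeff_poly_shift coeff_monom_mult coeff_poly_cutoff)

lemma shift_up_trunc [simp]: "shift_up k * trunc k = 0"
  by transfer (auto simp: poly_eq_iff fun_eq_iff coeff_poly_shift coeff_monom_mult coeff_poly_cutoff)

definition Hom :: "nat \<Rightarrow> nat \<Rightarrow> 'a::field linop set" where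
  "Hom n m = {M. trunc n * M = M \<and> M * trunc m = M}"

lemma HomD: assumes "M \<in> Hom n m" shows "trunc n * M = M" "M * trunc m = M"
  using assms by (auto simp: Hom_def)

lemma HomD_left_commute: assumes "M \<in> Hom n m" shows "trunc n * (M * X) = M * X" "M * (trunc m * X) = M * X"
  using assms by (auto simp: Hom_def simp flip: mult.assoc)

lemma Hom_mult [intro]: "M \<in> Hom n k \<Longrightarrow> N \<in> Hom k' m \<Longrightarrow> M * N \<in> Hom n m"
  by (auto simp: Hom_def mult.assoc) (simp flip: mult.assoc)

lemma Hom_add [intro]: "M \<in> Hom n k \<Longrightarrow> N \<in> Hom n k \<Longrightarrow> M + N \<in> Hom n k"
  and Hom_diff [intro]: "M \<in> Hom n k \<Longrightarrow> N \<in> Hom n k \<Longrightarrow> M - N \<in> Hom n k"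
  by (auto simp: Hom_def algebra_simps)

lemma Hom_0 [simp, intro]: "0 \<in> Hom n m" by (auto simp: Hom_def)

lemma Hom_scale [intro]: "M \<in> Hom n m \<Longrightarrow> scale c M \<in> Hom n m"
  by (auto simp: Hom_def)

lemma Hom_mono: "M \<in> Hom n m \<Longrightarrow> n \<le> n' \<Longrightarrow> m \<le> m' \<Longrightarrow> M \<in> Hom n' m'"
proof -
  assume a: "M \<in> Hom n m" "n \<le> n'" "m \<le> m'"
  have "trunc n' * (trunc n * M) = trunc n * M" "M * trunc m * trunc m' = M * trunc m"
    using a by (simp_all add: trunc_mult_trunc_left mult.assoc min_def)
  then show ?thesis using a by (auto simp: Hom_def)
qed

lemma trunc_in_Hom: "k \<le> n \<Longrightarrow> k \<le> m \<Longrightarrow> trunc k \<in> Hom n m"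
  by (auto simp: Hom_def min_def)

lemma munit_in_Hom: "i < n \<Longrightarrow> j < m \<Longrightarrow> munit i j \<in> Hom n m"
  by (auto simp: Hom_def trunc_mult_munit munit_mult_trunc)

lemma Hom_entry_0: "M \<in> Hom n m \<Longrightarrow> \<not> (i < n \<and> j < m) \<Longrightarrow> entry M i j = 0"
  by (metis entry_trunc_mult entry_mult_trunc HomD)

lemma Hom_eqI:
  assumes "M \<in> Hom n m" "N \<in> Hom n m" "\<And>i j. i < n \<Longrightarrow> j < m \<Longrightarrow> entry M i j = entry N i j"
  shows "M = N"
  by (rule linop_eqI) (metis assms Hom_entry_0)

lemma Hom_iff_entry: "M \<in> Hom n m \<longleftrightarrow> (\<forall>i j. \<not> (i < n \<and> j < m) \<longrightarrow> entry M i j = 0)"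
proof
  assume "\<forall>i j. \<not> (i < n \<and> j < m) \<longrightarrow> entry M i j = 0"
  then show "M \<in> Hom n m" unfolding Hom_def
    by (auto intro!: linop_eqI simp: entry_trunc_mult entry_mult_trunc)
qed (use Hom_entry_0 in blast)

text \<open>The hypothesis cuts the rows of M to degree below k and so makes the sum finite; N may
  be arbitrary.\<close>

lemma entry_mult:
  assumes "M * trunc k = M"
  shows "entry (M * N) i j = (\<Sum>l<k. entry M i l * entry N l j)"
proof -
  let ?q = "app M (monom 1 i)"
  have "app (M * trunc k) (monom 1 i) = ?q" using assms by simp
  then have q: "poly_cutoff k ?q = ?q" by (simp add: times_linop.rep_eq trunc.rep_eq)
  have "?q = (\<Sum>l<k. monom (coeff ?q l) l)"
    by (subst q[symmetric]) (auto simp: poly_eq_iff coeff_sum coeff_poly_cutoff)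
  then have "app (M * N) (monom 1 i) = app N (\<Sum>l<k. monom (coeff ?q l) l)"
    by (simp add: times_linop.rep_eq)
  also have "\<dots> = (\<Sum>l<k. Polynomial.smult (coeff ?q l) (app N (monom 1 l)))"
    unfolding app_sum by (rule sum.cong) (auto simp: app_monom[of _ "coeff _ _"])
  finally show ?thesis unfolding entry_def by (simp add: coeff_sum)
qed

subsection \<open>Rank factorizations\<close>

text \<open>Wedderburn's rank reduction: subtracting \<open>(1/c) M e\<^sub>j e\<^sub>i\<^sup>T M\<close> clears row \<open>i\<close> and column \<open>j\<close>.\<close>

lemma rank_factorization_pivot:
  assumes M: "M \<in> Hom n m" and c: "entry M i j = c" "c \<noteq> 0"
    and M': "M - scale (1/c) (M * munit j i * M) = \<alpha> * \<beta>"
    and h: "\<alpha> \<in> Hom n k" "\<beta> \<in> Hom k m" "\<alpha>' \<in> Hom k n" "\<beta>' \<in> Hom m k"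
    and inv: "\<alpha>' * \<alpha> = trunc k" "\<beta> * \<beta>' = trunc k"
  shows "\<exists>\<alpha>\<in>Hom n (Suc k). \<exists>\<beta>\<in>Hom (Suc k) m. \<exists>\<alpha>'\<in>Hom (Suc k) n. \<exists>\<beta>'\<in>Hom m (Suc k).
    M = \<alpha> * \<beta> \<and> \<alpha>' * \<alpha> = trunc (Suc k) \<and> \<beta> * \<beta>' = trunc (Suc k)"
proof -
  have ij: "i < n" "j < m" using M c Hom_entry_0 by metis+
  have s: "munit a i * (M * (munit j b * X)) = scale c (munit a b * X)" for a b X
    using munit_sandwich[of a i M j b] c by (simp flip: mult.assoc)
  have s0: "munit a i * (M * munit j b) = scale c (munit a b)" for a b
    using munit_sandwich[of a i M j b] c by (simp flip: mult.assoc)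
  have ccM: "scale (1/c) (scale c X) = X" "scale c (scale (1/c) X) = X" for X
    using c by simp_all
  have M'2: "\<alpha> * \<beta> = M - scale (1/c) (M * (munit j i * M))" using M' by (simp add: mult.assoc)
  \<comment> \<open>Row i of \<open>\<alpha> * \<beta>\<close> is zero, and cancelling \<beta> by
    its right inverse leaves row i of \<alpha> zero. Dually column j of \<beta> is zero. The mixed
    terms below vanish for this reason.\<close>
  have "munit a i * (\<alpha> * \<beta>) = 0" for a
    unfolding M'2 using c by (simp add: right_diff_distrib s)
  then have "munit a i * (\<alpha> * \<beta>) * \<beta>' = 0" for a by simp
  then have r0: "munit a i * \<alpha> = 0" for a
    using inv h by (simp add: mult.assoc HomD)
  then have r: "munit a i * (\<alpha> * X) = 0" for a X by (simp flip: mult.assoc)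
  have "\<alpha> * \<beta> * munit j b = 0" for b
    unfolding M'2 using c by (simp add: left_diff_distrib mult.assoc s0)
  then have "\<alpha>' * (\<alpha> * \<beta> * munit j b) = 0" for b by simp
  then have l0: "\<beta> * munit j b = 0" for b
    using inv h by (simp add: HomD HomD_left_commute flip: mult.assoc)
  then have l: "\<beta> * (munit j b * X) = 0" for b X by (simp flip: mult.assoc)
  have k1: "\<alpha> * (munit k b * X) = 0" for b X
  proof -
    have "\<alpha> * trunc k * (munit k b * X) = 0" by (simp add: mult.assoc trunc_mult_munit_left)
    then show ?thesis using h by (simp add: HomD)
  qed
  have k2: "munit a k * \<beta> = 0" for a
  proof -
    have "munit a k * (trunc k * \<beta>) = 0" by (simp add: munit_mult_trunc flip: mult.assoc)
    then show ?thesis using h by (simp add: HomD)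
  qed
  \<comment> \<open>The new column of the left factor is column j of M, the new row of the right
    factor is row i of M divided by c. The corrections in \<open>a2\<close> and \<open>b2\<close>
    cancel the products of \<alpha>' with that column and of that row with \<beta>'.\<close>
  define a1 b1 a2 b2 where "a1 = \<alpha> + M * munit j k" and "b1 = \<beta> + scale (1/c) (munit k i * M)"
    and "a2 = \<alpha>' - scale (1/c) (\<alpha>' * (M * munit j i)) + scale (1/c) (munit k i)"
    and "b2 = \<beta>' - scale (1/c) (munit j i * (M * \<beta>')) + munit j k"
  note d = a1_def b1_def a2_def b2_def
  have UU: "munit p k * (munit k q * X) = munit p q * X" for p q and X :: "'a linop"
    by (simp add: munit_mult_munit flip: mult.assoc)
  have "a1 * b1 = \<alpha> * \<beta> + scale (1/c) (M * (munit j i * M))"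
    unfolding d by (simp add: distrib_left distrib_right mult.assoc k1 k2 UU)
  also have "\<dots> = M" unfolding M'2 by simp
  finally have 1: "M = a1 * b1" by simp
  have 2: "a2 * a1 = trunc (Suc k)"
    unfolding d using c(2) by (simp add: distrib_left distrib_right left_diff_distrib right_diff_distrib
      mult.assoc r0 s0 inv ccM trunc_Suc scale_add_right scale_diff_right)
  have 3: "b1 * b2 = trunc (Suc k)"
    unfolding d using c(2) by (simp add: distrib_left distrib_right left_diff_distrib right_diff_distrib
      mult.assoc l0 l s s0 inv ccM trunc_Suc scale_add_right scale_diff_right)
  have u: "munit j k \<in> Hom m (Suc k)" "munit k i \<in> Hom (Suc k) n" "munit j i \<in> Hom m n"
    using ij by (auto intro: munit_in_Hom)
  have h': "\<alpha> \<in> Hom n (Suc k)" "\<beta> \<in> Hom (Suc k) m" "\<alpha>' \<in> Hom (Suc k) n" "\<beta>' \<in> Hom m (Suc k)"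
    using h by (auto intro: Hom_mono)
  have "a1 \<in> Hom n (Suc k)" "b1 \<in> Hom (Suc k) m" "a2 \<in> Hom (Suc k) n" "b2 \<in> Hom m (Suc k)"
    unfolding d using M u h' by (auto intro!: Hom_add Hom_diff Hom_scale Hom_mult[OF M] Hom_mult[OF u(2) M]
      Hom_mult[OF h'(3)] Hom_mult[OF u(3)] Hom_mult[OF M h'(4)])
  then show ?thesis using 1 2 3 by blast
qed

text \<open>The one-sided inverses certify that k is the rank; without them k could be too
  large.\<close>

theorem rank_factorization:
  assumes "M \<in> Hom n m"
  shows "\<exists>k. \<exists>\<alpha>\<in>Hom n k. \<exists>\<beta>\<in>Hom k m. \<exists>\<alpha>'\<in>Hom k n. \<exists>\<beta>'\<in>Hom m k.
    M = \<alpha> * \<beta> \<and> \<alpha>' * \<alpha> = trunc k \<and> \<beta> * \<beta>' = trunc k"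
  using assms
proof (induction "card {i. i < n \<and> munit i i * M \<noteq> 0}" arbitrary: M rule: less_induct)
  case less
  note M = less.prems
  show ?case
  proof (cases "M = 0")
    case True
    then show ?thesis by (intro exI[of _ 0] bexI[of _ 0]) auto
  next
    case False
    then obtain i j where ij: "entry M i j \<noteq> 0" by (metis linop_eqI entry_simps(1))
    then have lt: "i < n" "j < m" using M Hom_entry_0 by metis+
    define c where "c = entry M i j"
    have c: "c \<noteq> 0" "entry M i j = c" using ij by (auto simp: c_def)
    define M' where "M' = M - scale (1/c) (M * munit j i * M)"
    have Uji: "munit j i \<in> Hom m n" using lt by (intro munit_in_Hom)
    have M': "M' \<in> Hom n m" unfolding M'_def by (intro Hom_diff Hom_scale M Hom_mult[OF Hom_mult[OF M Uji] M])
    have z: "munit l l * M' = 0" if "munit l l * M = 0" for l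
      unfolding M'_def using that by (simp add: right_diff_distrib flip: mult.assoc)
    have s: "munit i i * (M * (munit j i * M)) = scale c (munit i i * M)"
      using munit_sandwich[of i i M j i] c by (simp flip: mult.assoc)
    have zi: "munit i i * M' = 0"
      unfolding M'_def using c by (simp add: right_diff_distrib mult.assoc s)
    have "munit i i * M * munit j j \<noteq> 0"
    proof
      assume "munit i i * M * munit j j = 0"
      then have "entry (scale c (munit i j)) i j = 0" using munit_sandwich[of i i M j j] c by simp
      then show False using c by (simp add: entry_munit)
    qed
    then have nz: "munit i i * M \<noteq> 0" by auto
    \<comment> \<open>The reduction subtracts multiples of row i: zero rows stay zero and row i
      becomes zero, so the number of nonzero rows drops.\<close>
    have "{i. i < n \<and> munit i i * M' \<noteq> 0} \<subset> {i. i < n \<and> munit i i * M \<noteq> 0}"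
      using z zi nz lt by blast
    then have "card {i. i < n \<and> munit i i * M' \<noteq> 0} < card {i. i < n \<and> munit i i * M \<noteq> 0}"
      by (intro psubset_card_mono) auto
    from less.hyps[OF this M'] obtain k \<alpha> \<beta> \<alpha>' \<beta>' where
      "\<alpha>\<in>Hom n k" "\<beta>\<in>Hom k m" "\<alpha>'\<in>Hom k n" "\<beta>'\<in>Hom m k" "M' = \<alpha> * \<beta>" "\<alpha>' * \<alpha> = trunc k" "\<beta> * \<beta>' = trunc k"
      by blast
    from rank_factorization_pivot[OF M c(2,1) this(5)[unfolded M'_def] this(1-4,6,7)] show ?thesis by blast
  qed
qed

section \<open>One-sided inverses, rank and invertibility\<close>

definition mat_of_op :: "nat \<Rightarrow> nat \<Rightarrow> 'a::field linop \<Rightarrow> 'a mat" where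
  "mat_of_op n m M = mat n m (\<lambda>(i, j). entry M i j)"

lemma mat_of_op_carrier [simp]: "mat_of_op n m M \<in> carrier_mat n m" by (simp add: mat_of_op_def)

lemma mat_of_op_mult:
  assumes "M \<in> Hom n k"
  shows "mat_of_op n m (M * N) = mat_of_op n k M * mat_of_op k m N"
  by (rule eq_matI) (auto simp: mat_of_op_def scalar_prod_def entry_mult[OF HomD(2)[OF assms]] lessThan_atLeast0)

lemma mat_of_op_inject: "M \<in> Hom n m \<Longrightarrow> N \<in> Hom n m \<Longrightarrow> mat_of_op n m M = mat_of_op n m N \<longleftrightarrow> M = N"
  by (auto simp: mat_of_op_def mat_eq_iff intro: Hom_eqI)

lemma mat_of_op_trunc: "mat_of_op k k (trunc k) = 1\<^sub>m k"
  by (rule eq_matI) (auto simp: mat_of_op_def entry_trunc)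

text \<open>Inherited from finite square matrices. The ambient ring does not have this property:
  \<open>shift_up k * shift_down k = 1\<close>, but for k > 0 the product in the other order is not
  1.\<close>

lemma Hom_one_sided_inverse:
  assumes "A \<in> Hom k k" "B \<in> Hom k k" "A * B = trunc k" shows "B * A = trunc k"
proof -
  have "mat_of_op k k A * mat_of_op k k B = 1\<^sub>m k" using assms mat_of_op_mult[OF assms(1), of k B] by (simp add: mat_of_op_trunc)
  then have "mat_of_op k k B * mat_of_op k k A = 1\<^sub>m k" by (rule mat_mult_left_right_inverse[OF mat_of_op_carrier mat_of_op_carrier])
  then have "mat_of_op k k (B * A) = mat_of_op k k (trunc k)" using mat_of_op_mult[OF assms(2), of k A] by (simp add: mat_of_op_trunc)
  then show ?thesis using mat_of_op_inject[of "B * A" k k "trunc k"] assms by (auto simp: trunc_in_Hom)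
qed

lemma trunc_inject: "trunc k = trunc l \<Longrightarrow> k = (l::nat)"
proof (rule ccontr)
  assume a: "(trunc k :: 'a linop) = trunc l" "k \<noteq> l"
  let ?m = "min k l"
  have "entry (trunc k :: 'a linop) ?m ?m = entry (trunc l) ?m ?m" using a by simp
  then show False using a(2) by (auto simp: entry_trunc min_def split: if_splits)
qed

text \<open>After padding, \<open>A' * B'\<close> is the identity of size k, hence so is
  \<open>B' * A'\<close>. But for l < k the last column of \<open>A'\<close> vanishes, a
  contradiction.\<close>

lemma trunc_factor_le:
  assumes "trunc k = A * trunc l * (B :: 'a::field linop)" shows "k \<le> l"
proof (rule ccontr)
  assume "\<not> k \<le> l"
  then have lk: "l < k" by simp
  define A' B' where "A' = trunc k * A * trunc l" and "B' = trunc l * B * trunc k"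
  have h: "A' \<in> Hom k k" "B' \<in> Hom k k"
    using lk by (auto simp: A'_def B'_def Hom_def mult.assoc trunc_mult_trunc_left min_def)
  have "A' * B' = trunc k * (A * trunc l * B) * trunc k"
    by (simp add: A'_def B'_def mult.assoc trunc_mult_trunc_left)
  also have "\<dots> = trunc k" by (simp flip: assms)
  finally have "B' * A' = trunc k" using h Hom_one_sided_inverse by blast
  moreover have "B' * A' * trunc l = B' * A'" by (simp add: A'_def mult.assoc)
  ultimately have "trunc k * trunc l = (trunc k :: 'a linop)" by simp
  then have "(trunc l :: 'a linop) = trunc k" using lk by simp
  then show False using trunc_inject lk by blast
qed

text \<open>Rank as the least dimension of a space through which M factors. With
  \<open>trunc k\<close> between arbitrary A and B, no sizes are mentioned and bounds for products
  follow by regrouping. \<open>mrank_coord_mor\<close> identifies it with the dimension of the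
  image.\<close>

definition rk :: "'a::field linop \<Rightarrow> nat" where
  "rk M = (LEAST k. \<exists>A B. M = A * trunc k * B)"

lemma rk_le: "M = A * trunc k * B \<Longrightarrow> rk M \<le> k"
  unfolding rk_def by (rule Least_le) blast

lemma rk_eqI:
  assumes "M = A * trunc k * B" "trunc k = A' * M * B'" shows "rk M = k"
  unfolding rk_def
proof (rule Least_equality)
  show "\<exists>A B. M = A * trunc k * B" using assms by blast
next
  fix l assume "\<exists>A B. M = A * trunc l * B"
  then obtain C D where "M = C * trunc l * D" by blast
  then have "trunc k = (A' * C) * trunc l * (D * B')" using assms(2) by (simp add: mult.assoc)
  then show "k \<le> l" by (rule trunc_factor_le)
qed

lemma rk_factorE:
  assumes "M \<in> Hom n m"
  obtains \<alpha> \<beta> \<alpha>' \<beta>' where "\<alpha> \<in> Hom n (rk M)" "\<beta> \<in> Hom (rk M) m" "\<alpha>' \<in> Hom (rk M) n" "\<beta>' \<in> Hom m (rk M)"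
    "M = \<alpha> * \<beta>" "\<alpha>' * \<alpha> = trunc (rk M)" "\<beta> * \<beta>' = trunc (rk M)"
proof -
  obtain k \<alpha> \<beta> \<alpha>' \<beta>' where *: "\<alpha>\<in>Hom n k" "\<beta>\<in>Hom k m" "\<alpha>'\<in>Hom k n" "\<beta>'\<in>Hom m k"
    "M = \<alpha> * \<beta>" "\<alpha>' * \<alpha> = trunc k" "\<beta> * \<beta>' = trunc k"
    using rank_factorization[OF assms] by blast
  have "\<alpha>' * M * \<beta>' = trunc k" using * by (simp add: mult.assoc HomD)
  then have "rk M = k" using * by (intro rk_eqI[of _ \<alpha> _ \<beta> \<alpha>' \<beta>']) (simp_all add: HomD)
  then show ?thesis using that * by blast
qed

lemma rk_Hom_le:
  assumes "M \<in> Hom n m" shows "rk M \<le> n" "rk M \<le> m"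
proof -
  have "M = 1 * trunc n * M" "M = M * trunc m * 1" using assms by (auto simp: HomD)
  then show "rk M \<le> n" "rk M \<le> m" using rk_le by blast+
qed

lemma rk_mult_le:
  assumes "M \<in> Hom n m" shows "rk (A * M) \<le> rk M" "rk (M * B) \<le> rk M"
proof -
  obtain \<alpha> \<beta> where "\<alpha> \<in> Hom n (rk M)" "\<beta> \<in> Hom (rk M) m" "M = \<alpha> * \<beta>" using rk_factorE[OF assms] by metis
  then have "A * M = (A * \<alpha>) * trunc (rk M) * \<beta>" "M * B = \<alpha> * trunc (rk M) * (\<beta> * B)"
    by (auto simp: HomD HomD_left_commute mult.assoc)
  then show "rk (A * M) \<le> rk M" "rk (M * B) \<le> rk M" using rk_le by blast+
qed

lemma rk_mult_Hom_le:
  assumes "A \<in> Hom n p" shows "rk (A * B) \<le> p" "rk (B * A) \<le> n"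
proof -
  have "A * B = A * trunc p * B" "B * A = B * trunc n * A" using assms by (simp_all add: HomD mult.assoc)
  then show "rk (A * B) \<le> p" "rk (B * A) \<le> n" using rk_le by blast+
qed

lemma rk_0_iff: "M \<in> Hom n m \<Longrightarrow> rk M = 0 \<longleftrightarrow> M = 0"
proof
  assume "M \<in> Hom n m" "rk M = 0"
  then obtain \<alpha> \<beta> where "\<alpha> \<in> Hom n 0" "M = \<alpha> * \<beta>" using rk_factorE[of M n m] by metis
  then show "M = 0" using HomD(2)[of \<alpha> n 0] by simp
next
  assume "M = 0" then show "rk M = 0" using rk_le[of M 0 0 0] by simp
qed

lemma rk_trunc [simp]: "rk (trunc k) = k"
  by (rule rk_eqI[of _ 1 _ 1 1 1]) auto

definition invops :: "nat \<Rightarrow> 'a::field linop set" where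
  "invops k = {G \<in> Hom k k. \<exists>G'\<in>Hom k k. G * G' = trunc k \<and> G' * G = trunc k}"

lemma invopsI: "A \<in> Hom k k \<Longrightarrow> B \<in> Hom k k \<Longrightarrow> A * B = trunc k \<Longrightarrow> A \<in> invops k"
  using Hom_one_sided_inverse unfolding invops_def by blast

lemma invopsE:
  assumes "G \<in> invops k"
  obtains G' where "G \<in> Hom k k" "G' \<in> Hom k k" "G * G' = trunc k" "G' * G = trunc k"
  using assms unfolding invops_def by blast

lemma invops_iff_rk: "G \<in> Hom k k \<Longrightarrow> G \<in> invops k \<longleftrightarrow> rk G = k"
proof
  assume G: "G \<in> Hom k k" "rk G = k"
  then obtain \<alpha> \<beta> \<alpha>' \<beta>' where *: "\<alpha> \<in> Hom k k" "\<beta> \<in> Hom k k" "\<alpha>' \<in> Hom k k" "\<beta>' \<in> Hom k k"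
    "G = \<alpha> * \<beta>" "\<alpha>' * \<alpha> = trunc k" "\<beta> * \<beta>' = trunc k" using rk_factorE[OF G(1)] by metis
  have "\<alpha> * \<alpha>' = trunc k" using * Hom_one_sided_inverse by blast
  then have "G * (\<beta>' * \<alpha>') = trunc k"
    using * by (metis HomD_left_commute(2) mult.assoc)
  then show "G \<in> invops k" using G * invopsI by blast
next
  assume "G \<in> Hom k k" "G \<in> invops k"
  then obtain G' where "G * G' = trunc k" "G \<in> Hom k k" by (auto elim: invopsE)
  then show "rk G = k" by (intro rk_eqI[of G 1 k G 1 G']) (auto simp: HomD)
qed

text \<open>Comparison with a factorization \<open>\<gamma> * \<delta>\<close> that has one-sided
  inverses makes \<open>\<gamma>' * \<alpha>\<close> and \<open>\<beta> * \<delta>'\<close> mutually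
  inverse k by k matrices; the inverses of \<alpha> and \<beta> are assembled from these.\<close>

lemma factor_inverses:
  assumes "\<alpha> \<in> Hom n k" "\<beta> \<in> Hom k m" "rk (\<alpha> * \<beta>) = k"
  obtains \<alpha>' \<beta>' where "\<alpha>' \<in> Hom k n" "\<beta>' \<in> Hom m k" "\<alpha>' * \<alpha> = trunc k" "\<beta> * \<beta>' = trunc k"
proof -
  have "\<alpha> * \<beta> \<in> Hom n m" using assms by blast
  then obtain \<gamma> \<delta> \<gamma>' \<delta>' where *: "\<gamma> \<in> Hom n k" "\<delta> \<in> Hom k m" "\<gamma>' \<in> Hom k n" "\<delta>' \<in> Hom m k"
    "\<alpha> * \<beta> = \<gamma> * \<delta>" "\<gamma>' * \<gamma> = trunc k" "\<delta> * \<delta>' = trunc k" using rk_factorE assms(3) by metis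
  have "(\<gamma>' * \<alpha>) * (\<beta> * \<delta>') = \<gamma>' * (\<gamma> * \<delta>) * \<delta>'" by (simp add: mult.assoc flip: *(5))
  also have "\<dots> = (\<gamma>' * \<gamma>) * (\<delta> * \<delta>')" by (simp only: mult.assoc)
  also have "\<dots> = trunc k" using * by simp
  finally have 1: "(\<gamma>' * \<alpha>) * (\<beta> * \<delta>') = trunc k" .
  have h: "\<gamma>' * \<alpha> \<in> Hom k k" "\<beta> * \<delta>' \<in> Hom k k" using * assms by auto
  have 2: "(\<beta> * \<delta>') * (\<gamma>' * \<alpha>) = trunc k" using Hom_one_sided_inverse[OF h 1] .
  show ?thesis
  proof (rule that)
    show "\<beta> * \<delta>' * \<gamma>' \<in> Hom k n" "\<delta>' * (\<gamma>' * \<alpha>) \<in> Hom m k" using h * by blast+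
    show "\<beta> * \<delta>' * \<gamma>' * \<alpha> = trunc k" "\<beta> * (\<delta>' * (\<gamma>' * \<alpha>)) = trunc k" using 2 by (simp_all add: mult.assoc)
  qed
qed

text \<open>The change of intermediate coordinates is \<open>\<beta> * \<delta>'\<close>, with
  inverse \<open>\<gamma>' * \<alpha>\<close>. Hence the G in \<open>\<alpha> * G * \<beta>\<close>
  is determined by the pair of maps up to conjugation, which is why normal subgroups appear.\<close>

lemma factor_unique:
  assumes "\<alpha> \<in> Hom n k" "\<beta> \<in> Hom k m" "\<gamma> \<in> Hom n k" "\<delta> \<in> Hom k m"
    "\<alpha> * \<beta> = \<gamma> * \<delta>" "rk (\<alpha> * \<beta>) = k"
  obtains P P' where "P \<in> Hom k k" "P' \<in> Hom k k" "P * P' = trunc k" "P' * P = trunc k" "\<gamma> = \<alpha> * P" "\<delta> = P' * \<beta>"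
proof -
  obtain \<alpha>' \<beta>' where a: "\<alpha>' \<in> Hom k n" "\<beta>' \<in> Hom m k" "\<alpha>' * \<alpha> = trunc k" "\<beta> * \<beta>' = trunc k"
    using factor_inverses assms(1,2,6) by metis
  obtain \<gamma>' \<delta>' where c: "\<gamma>' \<in> Hom k n" "\<delta>' \<in> Hom m k" "\<gamma>' * \<gamma> = trunc k" "\<delta> * \<delta>' = trunc k"
    using factor_inverses assms(3-6) by metis
  define P P' where "P = \<beta> * \<delta>'" and "P' = \<gamma>' * \<alpha>"
  have h: "P \<in> Hom k k" "P' \<in> Hom k k" using a c assms unfolding P_def P'_def by blast+
  have g: "\<gamma> = \<alpha> * P"
    unfolding P_def by (metis assms(3,5) c(4) HomD(2) mult.assoc)
  have d: "\<delta> = P' * \<beta>"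
    unfolding P'_def by (metis assms(4,5) c(3) HomD(1) mult.assoc)
  have "P' * P = \<gamma>' * \<gamma>" using g by (simp add: P'_def mult.assoc)
  then have 1: "P' * P = trunc k" using c by simp
  have "P * P' = trunc k" using Hom_one_sided_inverse[OF h(2,1) 1] .
  then show ?thesis using that h 1 g d by blast
qed

text \<open>The missing columns of \<open>P\<close> come from a rank factorization of the idempotent \<open>1 - \<alpha> \<alpha>'\<close>; the
  shifts move them to the right of \<open>\<alpha>\<close>.\<close>

lemma complete_left_inverse:
  assumes "\<alpha> \<in> Hom n k" "\<alpha>' \<in> Hom k n" "\<alpha>' * \<alpha> = trunc k"
  obtains P P' where "P \<in> Hom n n" "P' \<in> Hom n n" "P * P' = trunc n" "P' * P = trunc n" "P * trunc k = \<alpha>" "trunc k * P' = \<alpha>'"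
proof -
  define M where "M = trunc n - \<alpha> * \<alpha>'"
  have M: "M \<in> Hom n n" unfolding M_def using assms by (auto simp: trunc_in_Hom)
  obtain \<rho> \<tau> \<rho>' \<tau>' where *: "\<rho> \<in> Hom n (rk M)" "\<tau> \<in> Hom (rk M) n" "\<rho>' \<in> Hom (rk M) n" "\<tau>' \<in> Hom n (rk M)"
    "M = \<rho> * \<tau>" "\<rho>' * \<rho> = trunc (rk M)" "\<tau> * \<tau>' = trunc (rk M)" using rk_factorE[OF M] by metis
  define j where "j = rk M"
  have aM: "\<alpha>' * M = 0" "M * \<alpha> = 0" unfolding M_def using assms
    by (simp_all add: right_diff_distrib left_diff_distrib HomD flip: mult.assoc)
      (simp_all add: mult.assoc HomD)
  have "\<alpha>' * \<rho> = \<alpha>' * M * \<tau>'" using * by (simp add: mult.assoc HomD)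
  then have ar: "\<alpha>' * \<rho> = 0" using aM by simp
  have "\<tau> * \<alpha> = \<rho>' * (M * \<alpha>)" using * by (simp add: HomD_left_commute flip: mult.assoc)(simp add: HomD)
  then have ta: "\<tau> * \<alpha> = 0" using aM by simp
  have MM: "M * M = M"
  proof -
    have "M * M = M * trunc n - M * \<alpha> * \<alpha>'" by (subst (2) M_def) (simp add: right_diff_distrib mult.assoc)
    then show ?thesis using aM M by (simp add: HomD)
  qed
  have "\<tau> * \<rho> = \<rho>' * (M * M) * \<tau>'" 
  proof -
    have "\<rho>' * (M * M) * \<tau>' = (\<rho>' * \<rho>) * (\<tau> * \<rho>) * (\<tau> * \<tau>')" using *(5) by (simp add: mult.assoc)
    then show ?thesis using * by (simp add: HomD HomD_left_commute mult.assoc)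
  qed
  also have "\<dots> = (\<rho>' * \<rho>) * (\<tau> * \<tau>')" using MM *(5) by (simp add: mult.assoc)
  finally have tr: "\<tau> * \<rho> = trunc j" using * by (simp add: j_def)
  \<comment> \<open>\<open>P\<close> is the block row of \<alpha> and \<rho>, \<open>P'\<close> the
    block column of \<alpha>' and \<tau>.\<close>
  define P P' where "P = \<alpha> + \<rho> * shift_up k" and "P' = \<alpha>' + shift_down k * \<tau>"
  have tj: "\<tau> = trunc j * \<tau>" "\<rho> = \<rho> * trunc j" using * by (simp_all add: j_def HomD)
  have aS: "\<alpha> * (shift_down k * X) = 0" for X
  proof -
    have "\<alpha> * (trunc k * shift_down k) * X = 0" by simp
    then have "\<alpha> * trunc k * (shift_down k * X) = 0" by (simp only: mult.assoc)
    then show ?thesis using assms by (simp add: HomD)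
  qed
  have Sa: "shift_up k * \<alpha>' = 0"
  proof -
    have "shift_up k * (trunc k * \<alpha>') = 0" by (simp flip: mult.assoc)
    then show ?thesis using assms by (simp add: HomD)
  qed
  have PP': "P * P' = trunc n"
  proof -
    have "shift_up k * (shift_down k * \<tau>) = \<tau>" by (simp flip: mult.assoc)
    then have "P * P' = \<alpha> * \<alpha>' + \<rho> * \<tau>" unfolding P_def P'_def
      by (simp add: distrib_left distrib_right mult.assoc aS Sa)
    then show ?thesis using *(5) by (simp add: M_def eq_commute[of _ "\<rho> * \<tau>"])
  qed
  have a0: "\<alpha>' * (\<rho> * X) = 0" "\<tau> * (\<rho> * X) = trunc j * X" for X using ar tr by (simp_all flip: mult.assoc)
  have P'P: "P' * P = trunc (k + j)" unfolding P_def P'_def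
    using assms(3) by (simp add: distrib_left distrib_right mult.assoc a0 ta shift_down_trunc_shift_up[unfolded mult.assoc])
  \<comment> \<open>Each of the two identities factors through the other, which gives k + j = n
    without counting dimensions.\<close>
  have "trunc (k + j) * (trunc (k+j)) = P' * (P * P') * P" using P'P by (metis mult.assoc)
  then have 1: "trunc (k + j) = P' * trunc n * P" using PP' by simp
  have "trunc n * trunc n = P * (P' * P) * P'" using PP' by (metis mult.assoc)
  then have 2: "trunc n = P * trunc (k+j) * P'" using P'P by simp
  have kn: "k + j = n" using trunc_factor_le[OF 1] trunc_factor_le[OF 2] by simp
  show ?thesis
  proof (rule that)
    show "P * P' = trunc n" "P' * P = trunc n" using PP' P'P kn by auto
    show "P * trunc k = \<alpha>" "trunc k * P' = \<alpha>'" unfolding P_def P'_def using assms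
      by (simp_all add: distrib_left distrib_right mult.assoc HomD) (simp_all flip: mult.assoc)
    have P1: "\<rho> * shift_up k = \<rho> * (shift_up k * trunc n)"
    proof -
      have "trunc j * shift_up k * trunc n = (trunc j * shift_up k :: 'a linop)" unfolding kn[symmetric]
        by transfer (auto simp: poly_eq_iff fun_eq_iff coeff_monom_mult coeff_poly_cutoff)
      then have "\<rho> * (trunc j * shift_up k * trunc n) = \<rho> * (trunc j * shift_up k)" by simp
      then show ?thesis using tj(2) by (simp flip: mult.assoc)
    qed
    have P2: "shift_down k * \<tau> = trunc n * (shift_down k * \<tau>)"
    proof -
      have "trunc n * shift_down k * trunc j = (shift_down k * trunc j :: 'a linop)" unfolding kn[symmetric]
        by transfer (auto simp: poly_eq_iff fun_eq_iff coeff_poly_shift coeff_poly_cutoff)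
      then have "trunc n * shift_down k * (trunc j * \<tau>) = shift_down k * (trunc j * \<tau>)" by (simp flip: mult.assoc)
      then show ?thesis using tj(1) by (simp add: mult.assoc)
    qed
    have "\<alpha> \<in> Hom n n" "\<alpha>' \<in> Hom n n" using assms kn by (auto intro: Hom_mono)
    moreover have "\<rho> * shift_up k \<in> Hom n n" unfolding Hom_def using P1 *(1) by (simp add: HomD_left_commute mult.assoc)
    moreover have "shift_down k * \<tau> \<in> Hom n n" unfolding Hom_def using P2 *(2) by (simp add: HomD mult.assoc)
    ultimately show "P \<in> Hom n n" "P' \<in> Hom n n" unfolding P_def P'_def by auto
  qed
qed

text \<open>A nonzero row has rank 1, so the left factor of its rank factorization is an invertible
  1 by 1 matrix and can be undone.\<close>

lemma row_right_inverse:
  assumes "v \<in> Hom 1 k" "v \<noteq> 0" obtains w where "w \<in> Hom k 1" "v * w = trunc 1"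
proof -
  have "rk v = 1" using rk_Hom_le(1)[OF assms(1)] rk_0_iff[OF assms(1)] assms(2) by linarith
  then obtain \<alpha> \<beta> \<alpha>' \<beta>' where *: "\<alpha> \<in> Hom 1 1" "\<beta> \<in> Hom 1 k" "\<alpha>' \<in> Hom 1 1" "\<beta>' \<in> Hom k 1"
    "v = \<alpha> * \<beta>" "\<alpha>' * \<alpha> = trunc 1" "\<beta> * \<beta>' = trunc 1" using rk_factorE[OF assms(1)] by metis
  have "\<alpha> * \<alpha>' = trunc 1" using * Hom_one_sided_inverse by blast
  then have "v * (\<beta>' * \<alpha>') = trunc 1" using * by (metis HomD_left_commute(2) mult.assoc)
  then show ?thesis using that * by blast
qed

lemma column_left_inverse:
  assumes "v \<in> Hom k 1" "v \<noteq> 0" obtains w where "w \<in> Hom 1 k" "w * v = trunc 1"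
proof -
  have "rk v = 1" using rk_Hom_le(2)[OF assms(1)] rk_0_iff[OF assms(1)] assms(2) by linarith
  then obtain \<alpha> \<beta> \<alpha>' \<beta>' where *: "\<alpha> \<in> Hom k 1" "\<beta> \<in> Hom 1 1" "\<alpha>' \<in> Hom 1 k" "\<beta>' \<in> Hom 1 1"
    "v = \<alpha> * \<beta>" "\<alpha>' * \<alpha> = trunc 1" "\<beta> * \<beta>' = trunc 1" using rk_factorE[OF assms(1)] by metis
  have "\<beta>' * \<beta> = trunc 1" using * Hom_one_sided_inverse by blast
  then have "(\<beta>' * \<alpha>') * v = trunc 1" using * by (metis HomD_left_commute(2) mult.assoc)
  then show ?thesis using that * by blast
qed

subsection \<open>Coordinates\<close>

lemma linear_mapI:
  assumes "vectorspace K V" "vectorspace K W" "f \<in> carrier V \<rightarrow> carrier W"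
    "\<And>v w. v \<in> carrier V \<Longrightarrow> w \<in> carrier V \<Longrightarrow> f (v \<oplus>\<^bsub>V\<^esub> w) = f v \<oplus>\<^bsub>W\<^esub> f w"
    "\<And>c v. c \<in> carrier K \<Longrightarrow> v \<in> carrier V \<Longrightarrow> f (c \<odot>\<^bsub>V\<^esub> v) = c \<odot>\<^bsub>W\<^esub> f v"
  shows "linear_map K V W f"
proof -
  interpret V: vectorspace K V by fact
  interpret W: vectorspace K W by fact
  have "f \<in> LinearCombinations.module_hom K V W" unfolding LinearCombinations.module_hom_def using assms(3-5) by blast
  then show ?thesis
    by (intro linear_map.intro mod_hom.intro mod_hom_axioms.intro assms V.module_axioms W.module_axioms)
qed

lemma linear_mapD:
  assumes "linear_map K V W f"
  shows "f \<in> carrier V \<rightarrow> carrier W"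
    "\<And>v w. v \<in> carrier V \<Longrightarrow> w \<in> carrier V \<Longrightarrow> f (v \<oplus>\<^bsub>V\<^esub> w) = f v \<oplus>\<^bsub>W\<^esub> f w"
    "\<And>c v. c \<in> carrier K \<Longrightarrow> v \<in> carrier V \<Longrightarrow> f (c \<odot>\<^bsub>V\<^esub> v) = c \<odot>\<^bsub>W\<^esub> f v"
proof -
  interpret linear_map K V W f by fact
  show "f \<in> carrier V \<rightarrow> carrier W" by auto
  show "\<And>v w. v \<in> carrier V \<Longrightarrow> w \<in> carrier V \<Longrightarrow> f (v \<oplus>\<^bsub>V\<^esub> w) = f v \<oplus>\<^bsub>W\<^esub> f w"
    "\<And>c v. c \<in> carrier K \<Longrightarrow> v \<in> carrier V \<Longrightarrow> f (c \<odot>\<^bsub>V\<^esub> v) = c \<odot>\<^bsub>W\<^esub> f v" by auto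
qed

definition dec :: "('a::field, 'v) module \<Rightarrow> 'v list \<Rightarrow> 'a poly \<Rightarrow> 'v" where
  "dec U bs p = (\<Oplus>\<^bsub>U\<^esub> i \<in> {..<length bs}. coeff p i \<odot>\<^bsub>U\<^esub> bs ! i)"

text \<open>The truncation condition bounds the degree by the dimension, which makes the chosen
  polynomial unique when \<open>bs\<close> is a basis.\<close>

definition enc :: "('a::field, 'v) module \<Rightarrow> 'v list \<Rightarrow> 'v \<Rightarrow> 'a poly" where
  "enc U bs v = (SOME p. app (trunc (length bs)) p = p \<and> dec U bs p = v)"

definition coord_mor :: "('a::field, 'v) module \<Rightarrow> 'v list \<Rightarrow> 'a linop \<Rightarrow> ('a, 'v) module \<Rightarrow> 'v list \<Rightarrow>
    ('a, 'v) morphism" where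
  "coord_mor U bs M W cs = (U, restrict (\<lambda>v. dec W cs (app M (enc U bs v))) (carrier U), W)"

locale based_space = vectorspace class_ring U
  for U :: "('a::field, 'v) module" +
  fixes bs :: "'v list"
  assumes bs: "ordered_basis U bs"
begin

lemma bs_carrier: "i < length bs \<Longrightarrow> bs ! i \<in> carrier U"
  using bs unfolding ordered_basis_def basis_def by auto

lemma scalar_simps:
  assumes "v \<in> carrier U"
  shows "(a + b) \<odot>\<^bsub>U\<^esub> v = a \<odot>\<^bsub>U\<^esub> v \<oplus>\<^bsub>U\<^esub> b \<odot>\<^bsub>U\<^esub> v" "(a * b) \<odot>\<^bsub>U\<^esub> v = a \<odot>\<^bsub>U\<^esub> (b \<odot>\<^bsub>U\<^esub> v)"
    "1 \<odot>\<^bsub>U\<^esub> v = v" "0 \<odot>\<^bsub>U\<^esub> v = \<zero>\<^bsub>U\<^esub>"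
  using smult_l_distr[of a b v] smult_assoc1[of a b v] smult_one[of v] lmult_0[of v] assms by auto

lemma terms_closed: "(\<lambda>i. f i \<odot>\<^bsub>U\<^esub> bs ! i) \<in> {..<length bs} \<rightarrow> carrier U"
  using bs_carrier by auto

lemma dec_closed [simp, intro]: "dec U bs p \<in> carrier U"
  unfolding dec_def by (rule finsum_closed[OF terms_closed])

lemma dec_cong:
  assumes "\<And>i. i < length bs \<Longrightarrow> coeff p i = coeff q i" shows "dec U bs p = dec U bs q"
  unfolding dec_def by (rule finsum_cong') (use assms bs_carrier in auto)

lemma dec_add: "dec U bs (p + q) = dec U bs p \<oplus>\<^bsub>U\<^esub> dec U bs q"
  unfolding dec_def
  by (subst finsum_addf[symmetric, OF terms_closed terms_closed], rule finsum_cong')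
    (use bs_carrier in \<open>auto simp: scalar_simps\<close>)

lemma dec_smult: "dec U bs (Polynomial.smult c p) = c \<odot>\<^bsub>U\<^esub> dec U bs p"
  unfolding dec_def
  by (subst finsum_smult[OF _ terms_closed], simp, rule finsum_cong')
    (use bs_carrier in \<open>auto simp: scalar_simps\<close>)

lemma dec_trunc [simp]: "dec U bs (app (trunc (length bs)) p) = dec U bs p"
  by (rule dec_cong) (simp add: trunc.rep_eq coeff_poly_cutoff)

lemma dec_lincomb: "dec U bs p = lincomb (\<lambda>b. coeff p (inv_into {..<length bs} ((!) bs) b)) (set bs)"
proof -
  have inj: "inj_on ((!) bs) {..<length bs}"
    using bs unfolding ordered_basis_def by (auto simp: inj_on_def nth_eq_iff_index_eq)
  have im: "(!) bs ` {..<length bs} = set bs" by (auto simp: set_conv_nth)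
  have "lincomb (\<lambda>b. coeff p (inv_into {..<length bs} ((!) bs) b)) ((!) bs ` {..<length bs}) =
    (\<Oplus>\<^bsub>U\<^esub>i\<in>{..<length bs}. coeff p (inv_into {..<length bs} ((!) bs) (bs ! i)) \<odot>\<^bsub>U\<^esub> bs ! i)"
    unfolding lincomb_def
    by (rule finsum_reindex[OF _ inj]) (use bs_carrier in auto)
  also have "\<dots> = dec U bs p" unfolding dec_def
    by (rule finsum_cong') (use bs_carrier inj in \<open>auto simp: inv_into_f_f\<close>)
  finally show ?thesis unfolding im by simp
qed

lemma dec_surj:
  assumes "v \<in> carrier U" shows "\<exists>p. app (trunc (length bs)) p = p \<and> dec U bs p = v"
proof -
  have b: "span (set bs) = carrier U" "set bs \<subseteq> carrier U"
    using bs unfolding ordered_basis_def basis_def by auto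
  then have "v \<in> {lincomb a (set bs) |a. a \<in> set bs \<rightarrow> carrier class_ring}"
    using finite_span[of "set bs"] assms by blast
  then obtain a where a: "v = lincomb a (set bs)" by blast
  define p where "p = (\<Sum>i<length bs. monom (a (bs ! i)) i)"
  have co: "coeff p i = (if i < length bs then a (bs ! i) else 0)" for i
    unfolding p_def by (simp add: coeff_sum)
  have "dec U bs p = lincomb a (set bs)" unfolding dec_lincomb
  proof (rule lincomb_cong)
    fix b assume "b \<in> set bs"
    then have "b \<in> (!) bs ` {..<length bs}" by (auto simp: set_conv_nth)
    then show "coeff p (inv_into {..<length bs} ((!) bs) b) = a b"
      using inv_into_into[of b "(!) bs" "{..<length bs}"] f_inv_into_f[of b "(!) bs" "{..<length bs}"]
      by (auto simp: co)
  qed (use b in auto)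
  moreover have "app (trunc (length bs)) p = p"
    by (auto simp: trunc.rep_eq poly_eq_iff coeff_poly_cutoff co)
  ultimately show ?thesis using a by blast
qed

lemma dec_zero:
  assumes "dec U bs p = \<zero>\<^bsub>U\<^esub>" shows "app (trunc (length bs)) p = 0"
proof -
  have inj: "inj_on ((!) bs) {..<length bs}"
    using bs unfolding ordered_basis_def by (auto simp: inj_on_def nth_eq_iff_index_eq)
  have "coeff p i = 0" if i: "i < length bs" for i
  proof (rule ccontr)
    assume nz: "coeff p i \<noteq> 0"
    have "lin_dep (set bs)"
      by (rule lin_dep_crit[of "set bs" _ "\<lambda>b. coeff p (inv_into {..<length bs} ((!) bs) b)" "bs ! i"])
        (use i nz assms inj in \<open>auto simp: dec_lincomb inv_into_f_f\<close>)
    then show False using bs unfolding ordered_basis_def basis_def by auto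
  qed
  then show ?thesis by (auto simp: trunc.rep_eq poly_eq_iff coeff_poly_cutoff)
qed

lemma dec_eq_iff: "dec U bs p = dec U bs q \<longleftrightarrow> app (trunc (length bs)) p = app (trunc (length bs)) q"
proof
  assume "dec U bs p = dec U bs q"
  moreover have "dec U bs (p + Polynomial.smult (-1) q) \<oplus>\<^bsub>U\<^esub> dec U bs q = dec U bs p"
    by (simp add: dec_add[symmetric])
  ultimately have "dec U bs (p + Polynomial.smult (-1) q) = \<zero>\<^bsub>U\<^esub>"
    by (metis dec_closed l_zero zero_closed add.right_cancel)
  from dec_zero[OF this] show "app (trunc (length bs)) p = app (trunc (length bs)) q"
    by (simp only: app_add app_smult) simp
next
  assume "app (trunc (length bs)) p = app (trunc (length bs)) q"
  then show "dec U bs p = dec U bs q" by (metis dec_trunc)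
qed

lemma enc:
  assumes "v \<in> carrier U"
  shows "app (trunc (length bs)) (enc U bs v) = enc U bs v" "dec U bs (enc U bs v) = v"
  using someI_ex[OF dec_surj[OF assms]] unfolding enc_def by auto

lemma enc_dec [simp]: "enc U bs (dec U bs p) = app (trunc (length bs)) p"
  using enc[of "dec U bs p"] dec_eq_iff by force

lemma enc_add: "v \<in> carrier U \<Longrightarrow> w \<in> carrier U \<Longrightarrow> enc U bs (v \<oplus>\<^bsub>U\<^esub> w) = enc U bs v + enc U bs w"
  using enc_dec[of "enc U bs v + enc U bs w"] by (simp add: dec_add enc)

lemma enc_smult: "v \<in> carrier U \<Longrightarrow> enc U bs (c \<odot>\<^bsub>U\<^esub> v) = Polynomial.smult c (enc U bs v)"
  using enc_dec[of "Polynomial.smult c (enc U bs v)"] by (simp add: dec_smult enc)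

lemma dim_length: "dim = length bs"
  using dim_basis[of "set bs"] bs unfolding ordered_basis_def by (auto simp: distinct_card)

end

lemma mcomp_simps [simp]: "mdom (U, f, W) = U" "mran (U, f, W) = W"
  by (auto simp: mdom_def mran_def)

lemma coord_mor_dom_ran [simp]: "mdom (coord_mor U bs M W cs) = U" "mran (coord_mor U bs M W cs) = W"
  by (auto simp: coord_mor_def)

lemma mcomp_dom_ran [simp]: "mdom (x \<cdot>\<^sub>L y) = mdom x" "mran (x \<cdot>\<^sub>L y) = mran y"
  by (auto simp: mcomp_def)

locale two_spaces = U: based_space U bs + W: based_space W cs
  for U W :: "('a::field, 'v) module" and bs cs
begin

lemma coord_mor_linear: "linear_map class_ring U W (\<lambda>v\<in>carrier U. dec W cs (app M (enc U bs v)))"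
  by (rule linear_mapI[OF U.vectorspace_axioms W.vectorspace_axioms])
    (auto simp: U.enc_add U.enc_smult W.dec_add W.dec_smult)

lemma coord_mor_exists:
  assumes "linear_map class_ring U W f" "f \<in> extensional (carrier U)"
  shows "\<exists>M\<in>Hom (length bs) (length cs). (U, f, W) = coord_mor U bs M W cs"
proof -
  note f = linear_mapD[OF assms(1)]
  have fc: "f (dec U bs p) \<in> carrier W" for p using f(1) by auto
  \<comment> \<open>\<open>dec\<close> ignores high coefficients and \<open>enc\<close> returns
    none, so this operator has the right size at both ends.\<close>
  define M where "M = Linop (\<lambda>p. enc W cs (f (dec U bs p)))"
  have M: "app M p = enc W cs (f (dec U bs p))" for p
    unfolding M_def
    by (subst Linop_inverse) (auto simp: U.dec_add U.dec_smult f(2) f(3) fc W.enc_add W.enc_smult)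
  have "M \<in> Hom (length bs) (length cs)" unfolding Hom_def
    by (auto simp: app_inject[symmetric] times_linop.rep_eq M fun_eq_iff W.enc(1)[OF fc])
  moreover have "(U, f, W) = coord_mor U bs M W cs"
    using f(1) assms(2) by (auto simp: coord_mor_def M fun_eq_iff extensional_def restrict_def U.enc W.enc Pi_def)
  ultimately show ?thesis by blast
qed

lemma coord_mor_inject:
  assumes "M \<in> Hom (length bs) (length cs)" "N \<in> Hom (length bs) (length cs)"
  shows "coord_mor U bs M W cs = coord_mor U bs N W cs \<longleftrightarrow> M = N"
proof
  assume eq: "coord_mor U bs M W cs = coord_mor U bs N W cs"
  have "app M p = app N p" for p
  proof -
    have "(\<lambda>v\<in>carrier U. dec W cs (app M (enc U bs v))) (dec U bs p) =
        (\<lambda>v\<in>carrier U. dec W cs (app N (enc U bs v))) (dec U bs p)"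
      using eq by (simp add: coord_mor_def)
    then have "app (trunc (length bs) * M * trunc (length cs)) p = app (trunc (length bs) * N * trunc (length cs)) p"
      by (simp add: W.dec_eq_iff times_linop.rep_eq)
    then show ?thesis using assms by (simp add: HomD)
  qed
  then show "M = N" by (simp add: app_inject[symmetric] fun_eq_iff)
qed simp

text \<open>The right factor \<beta> carries \<open>F^k\<close> isomorphically onto the image of M:
  \<beta>' makes it injective, \<alpha>' puts its values into the image, and
  \<open>M = \<alpha> * \<beta>\<close> makes it onto.\<close>

lemma mrank_coord_mor:
  assumes M: "M \<in> Hom (length bs) (length cs)"
  shows "mrank (coord_mor U bs M W cs) = rk M"
proof -
  define k where "k = rk M"
  obtain \<alpha> \<beta> \<alpha>' \<beta>' where *: "\<alpha> \<in> Hom (length bs) k" "\<beta> \<in> Hom k (length cs)"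
    "\<alpha>' \<in> Hom k (length bs)" "\<beta>' \<in> Hom (length cs) k"
    "M = \<alpha> * \<beta>" "\<alpha>' * \<alpha> = trunc k" "\<beta> * \<beta>' = trunc k" using rk_factorE[OF M] unfolding k_def by metis
  let ?g = "\<lambda>v\<in>carrier U. dec W cs (app M (enc U bs v))"
  interpret g: linear_map class_ring U W ?g by (rule coord_mor_linear)
  let ?I = "?g ` carrier U"
  have "VectorSpace.subspace class_ring ?I W" using g.imT_is_subspace unfolding g.im_def .
  then have I: "vectorspace class_ring (W\<lparr>carrier := ?I\<rparr>)" by (rule W.subspace_is_vs)
  define pv where "pv v = (\<Sum>i<k. monom (v $ i) i :: 'a poly)" for v
  have cp: "coeff (pv v) i = (if i < k then v $ i else 0)" for v i
    by (simp add: pv_def coeff_sum)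
  interpret F: vec_space "TYPE('a)" k .
  let ?T = "\<lambda>v. dec W cs (app \<beta> (pv v))"
  have mem: "dec W cs (app \<beta> q) \<in> ?I" for q
  proof -
    have "app \<beta> q = app (trunc k * \<beta>) q" using * by (simp add: HomD)
    also have "\<dots> = app (\<alpha>' * \<alpha> * \<beta>) q" using * by simp
    also have "\<dots> = app (\<alpha>' * M) q" using *(5) by (simp only: mult.assoc)
    also have "\<dots> = app (\<alpha>' * (trunc (length bs) * M)) q" using M by (simp add: HomD)
    finally have "dec W cs (app \<beta> q) = ?g (dec U bs (app \<alpha>' q))" by (simp add: times_linop.rep_eq)
    then show ?thesis by blast
  qed
  have lin: "linear_map class_ring (module_vec TYPE('a) k) (W\<lparr>carrier := ?I\<rparr>) ?T"
  proof (rule linear_mapI[OF vec_vs I])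
    show "?T \<in> carrier (module_vec TYPE('a) k) \<rightarrow> carrier (W\<lparr>carrier := ?I\<rparr>)" using mem by auto
  next
    fix v w assume vw: "v \<in> carrier (module_vec TYPE('a) k)" "w \<in> carrier (module_vec TYPE('a) k)"
    then have "pv (v + w) = pv v + pv w" by (auto simp: module_vec_simps cp intro!: poly_eqI)
    then show "?T (v \<oplus>\<^bsub>module_vec TYPE('a) k\<^esub> w) = ?T v \<oplus>\<^bsub>W\<lparr>carrier := ?I\<rparr>\<^esub> ?T w"
      by (simp add: module_vec_simps W.dec_add)
  next
    fix c :: 'a and v assume v: "v \<in> carrier (module_vec TYPE('a) k)"
    then have "pv (c \<cdot>\<^sub>v v) = Polynomial.smult c (pv v)" by (auto simp: module_vec_simps cp intro!: poly_eqI)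
    then show "?T (c \<odot>\<^bsub>module_vec TYPE('a) k\<^esub> v) = c \<odot>\<^bsub>W\<lparr>carrier := ?I\<rparr>\<^esub> ?T v"
      by (simp add: module_vec_simps W.dec_smult)
  qed
  interpret T: linear_map class_ring "module_vec TYPE('a) k" "W\<lparr>carrier := ?I\<rparr>" ?T by (rule lin)
  have inj: "inj_on ?T (carrier_vec k)"
  proof (rule inj_onI)
    fix v w assume vw: "v \<in> carrier_vec k" "w \<in> carrier_vec k" "?T v = ?T w"
    then have "app (\<beta> * trunc (length cs)) (pv v) = app (\<beta> * trunc (length cs)) (pv w)"
      by (simp add: W.dec_eq_iff times_linop.rep_eq)
    then have "app \<beta>' (app \<beta> (pv v)) = app \<beta>' (app \<beta> (pv w))" using * by (simp add: HomD)
    then have "app (\<beta> * \<beta>') (pv v) = app (\<beta> * \<beta>') (pv w)" by (simp add: times_linop.rep_eq)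
    then have "coeff (app (trunc k) (pv v)) i = coeff (app (trunc k) (pv w)) i" for i using * by simp
    then have "v $ i = w $ i" if "i < k" for i
      using that by (metis trunc.rep_eq coeff_poly_cutoff cp)
    then show "v = w" using vw by (intro eq_vecI) auto
  qed
  have surj: "?T ` carrier_vec k = ?I"
  proof
    show "?T ` carrier_vec k \<subseteq> ?I" using mem by auto
    show "?I \<subseteq> ?T ` carrier_vec k"
    proof
      fix y assume "y \<in> ?I"
      then obtain u where u: "u \<in> carrier U" "y = dec W cs (app M (enc U bs u))" by auto
      define q where "q = app \<alpha> (enc U bs u)"
      have "q = app (trunc k) q" unfolding q_def
        by (metis *(1) HomD(2) times_linop.rep_eq)
      then have "q = pv (vec k (coeff q))"
        by (intro poly_eqI) (metis cp trunc.rep_eq coeff_poly_cutoff index_vec)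
      then have "y = ?T (vec k (coeff q))" using u *(5) by (simp add: q_def times_linop.rep_eq)
      then show "y \<in> ?T ` carrier_vec k" by (rule image_eqI) simp
    qed
  qed
  have "F.dim = vectorspace.dim class_ring (W\<lparr>carrier := ?I\<rparr>)"
    by (rule T.dim_eq) (use inj surj F.fin_dim in \<open>auto simp: module_vec_simps\<close>)
  then have "vectorspace.dim class_ring (W\<lparr>carrier := ?I\<rparr>) = k" using F.dim_is_n by simp
  then show ?thesis unfolding mrank_def by (simp add: coord_mor_def k_def)
qed

end

lemma coord_mor_comp:
  assumes "based_space U bs" "based_space W cs" "based_space X ds" "M \<in> Hom (length bs) (length cs)"
  shows "coord_mor U bs M W cs \<cdot>\<^sub>L coord_mor W cs N X ds = coord_mor U bs (M * N) X ds"
proof -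
  interpret U: based_space U bs by fact
  interpret W: based_space W cs by fact
  have "app (trunc (length cs)) (app M q) = app M q" for q
    by (metis assms(4) HomD(2) times_linop.rep_eq)
  then show ?thesis unfolding coord_mor_def mcomp_def
    by (auto simp: compose_def times_linop.rep_eq fun_eq_iff)
qed

text \<open>\<open>P\<close> and \<open>P'\<close> are the coordinates of the identity map between
  the two bases. The lemma is needed because \<open>natural_map\<close> refers to
  \<open>B p\<close>, whereas \<open>mor\<close> below uses one basis fixed for each space.\<close>

lemma change_of_basis:
  assumes "based_space U bs" "based_space U cs"
  obtains P P' where "P \<in> Hom (length cs) (length cs)" "P' \<in> Hom (length cs) (length cs)"
    "P * P' = trunc (length cs)" "length bs = length cs"
    "\<And>M. M \<in> Hom (length cs) (length cs) \<Longrightarrow> coord_mor U bs M U bs = coord_mor U cs (P * M * P') U cs"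
proof -
  interpret b: based_space U bs by fact
  interpret c: based_space U cs by fact
  interpret bc: two_spaces U U bs cs ..
  interpret cb: two_spaces U U cs bs ..
  interpret cc: two_spaces U U cs cs ..
  have len: "length bs = length cs" using b.dim_length c.dim_length by simp
  let ?id = "\<lambda>v\<in>carrier U. v"
  have id: "linear_map class_ring U U ?id"
    by (rule linear_mapI[OF b.vectorspace_axioms b.vectorspace_axioms]) auto
  obtain P' where P': "P' \<in> Hom (length bs) (length cs)" "(U, ?id, U) = coord_mor U bs P' U cs"
    using bc.coord_mor_exists[OF id] by auto
  obtain P where P: "P \<in> Hom (length cs) (length bs)" "(U, ?id, U) = coord_mor U cs P U bs"
    using cb.coord_mor_exists[OF id] by auto
  have e: "(U, ?id, U) = coord_mor U cs (trunc (length cs)) U cs"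
    by (auto simp: coord_mor_def fun_eq_iff c.enc)
  have idm: "(U, ?id, U) \<cdot>\<^sub>L (U, ?id, U) = (U, ?id, U)"
    by (auto simp: mcomp_def compose_def fun_eq_iff)
  then have "coord_mor U cs P U bs \<cdot>\<^sub>L coord_mor U bs P' U cs = coord_mor U cs (trunc (length cs)) U cs"
    using P(2) P'(2) e by simp
  then have "coord_mor U cs (P * P') U cs = coord_mor U cs (trunc (length cs)) U cs"
    using coord_mor_comp[OF assms(2,1,2) P(1)] by simp
  moreover have "P * P' \<in> Hom (length cs) (length cs)" using P P' by blast
  ultimately have PP: "P * P' = trunc (length cs)" using cc.coord_mor_inject by (simp add: trunc_in_Hom)
  have "coord_mor U bs M U bs = coord_mor U cs (P * M * P') U cs" if M: "M \<in> Hom (length cs) (length cs)" for M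
  proof -
    have "(U, ?id, U) \<cdot>\<^sub>L coord_mor U bs M U bs \<cdot>\<^sub>L (U, ?id, U) = coord_mor U bs M U bs"
      by (auto simp: mcomp_def compose_def fun_eq_iff coord_mor_def)
    then have "coord_mor U bs M U bs = coord_mor U cs P U bs \<cdot>\<^sub>L coord_mor U bs M U bs \<cdot>\<^sub>L coord_mor U bs P' U cs"
      using P P' by simp
    also have "\<dots> = coord_mor U cs (P * M) U bs \<cdot>\<^sub>L coord_mor U bs P' U cs"
      by (subst coord_mor_comp[OF assms(2,1,1) P(1)]) simp
    also have "\<dots> = coord_mor U cs (P * M * P') U cs"
      by (rule coord_mor_comp[OF assms(2,1,2)]) (use P M len in auto)
    finally show ?thesis .
  qed
  then show ?thesis using that P P' PP len by metis
qed

section \<open>Matrices as operators and the maps \<open>natural_map\<close>\<close>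

definition op_of_mat :: "'a::field mat \<Rightarrow> 'a linop" where
  "op_of_mat A = (\<Sum>i<dim_row A. \<Sum>j<dim_col A. scale (A $$ (i, j)) (munit i j))"

lemma entry_sum: "entry (sum f S) i j = (\<Sum>x\<in>S. entry (f x) i j)"
  by (induct S rule: infinite_finite_induct) auto

lemma entry_op_of_mat: "entry (op_of_mat A) i j = (if i < dim_row A \<and> j < dim_col A then A $$ (i, j) else 0)"
proof -
  have "entry (op_of_mat A) i j = (\<Sum>k<dim_row A. \<Sum>l<dim_col A. if k = i then (if l = j then A $$ (i, j) else 0) else 0)"
    unfolding op_of_mat_def by (auto simp: entry_sum entry_munit intro!: sum.cong)
  also have "\<dots> = (\<Sum>k<dim_row A. if k = i then (if j < dim_col A then A $$ (i, j) else 0) else 0)"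
    by (rule sum.cong) auto
  also have "\<dots> = (if i < dim_row A \<and> j < dim_col A then A $$ (i, j) else 0)" by simp
  finally show ?thesis .
qed

lemma op_of_mat_in_Hom: "A \<in> carrier_mat n m \<Longrightarrow> op_of_mat A \<in> Hom n m"
  by (auto simp: Hom_iff_entry entry_op_of_mat)

lemma op_of_mat_of_op: "M \<in> Hom n m \<Longrightarrow> op_of_mat (mat_of_op n m M) = M"
  by (rule Hom_eqI[of _ n m]) (auto simp: op_of_mat_in_Hom entry_op_of_mat, simp_all add: mat_of_op_def)

lemma mat_of_op_of_mat: "A \<in> carrier_mat n m \<Longrightarrow> mat_of_op n m (op_of_mat A) = A"
  by (auto simp: mat_of_op_def entry_op_of_mat)

text \<open>An operator of size k has its zero padding built in, so the corner embedding becomes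
  invisible in coordinates.\<close>

lemma natural_map_coord_mor:
  assumes "based_space V bs" "A \<in> carrier_mat k k" "k \<le> length bs"
  shows "natural_map V bs A = coord_mor V bs (op_of_mat A) V bs"
proof -
  interpret b: based_space V bs by fact
  interpret bb: two_spaces V V bs bs ..
  let ?n = "length bs" and ?C = "corner_mat (length bs) A"
  have tA: "op_of_mat A \<in> Hom ?n ?n" using op_of_mat_in_Hom[OF assms(2)] assms(3) by (rule Hom_mono) fact
  have C: "?C \<in> carrier_mat ?n ?n" using assms by (auto simp: corner_mat_def Let_def)
  have Ce: "?C $$ (i, j) = entry (op_of_mat A) i j" if "i < ?n" "j < ?n" for i j
    using that assms by (auto simp: corner_mat_def Let_def entry_op_of_mat)
  have encb: "enc V bs (bs ! i) = monom 1 i" if i: "i < ?n" for i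
  proof -
    have "dec V bs (monom 1 i) = (\<Oplus>\<^bsub>V\<^esub>j\<in>{..<?n}. if i = j then bs ! j else \<zero>\<^bsub>V\<^esub>)"
        unfolding dec_def by (rule b.finsum_cong') (use b.bs_carrier in \<open>auto simp: b.scalar_simps\<close>)
    also have "\<dots> = bs ! i" using i b.bs_carrier by (intro b.finsum_singleton) auto
    finally have "enc V bs (bs ! i) = app (trunc ?n) (monom 1 i)" by (metis b.enc_dec)
    then show ?thesis using i by (auto simp: trunc.rep_eq poly_eq_iff coeff_poly_cutoff)
  qed
  have row: "(\<Oplus>\<^bsub>V\<^esub> j \<in> {..<?n}. ?C $$ (i, j) \<odot>\<^bsub>V\<^esub> bs ! j) = dec V bs (app (op_of_mat A) (monom 1 i))" if "i < ?n" for i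
    unfolding dec_def by (rule b.finsum_cong') (use that b.bs_carrier Ce in \<open>auto simp: entry_def\<close>)
  let ?P = "\<lambda>f. linear_map class_ring V V f \<and> f \<in> extensional (carrier V) \<and> has_matrix V bs f ?C"
  let ?f = "\<lambda>v\<in>carrier V. dec V bs (app (op_of_mat A) (enc V bs v))"
  have "(THE f. ?P f) = ?f"
  proof (rule the_equality)
    show "?P ?f" using bb.coord_mor_linear C b.bs_carrier
      by (auto simp: has_matrix_def row encb)
  next
    fix f assume f: "?P f"
    then obtain M where M: "M \<in> Hom ?n ?n" "(V, f, V) = coord_mor V bs M V bs" using bb.coord_mor_exists by blast
    then have fM: "f = (\<lambda>v\<in>carrier V. dec V bs (app M (enc V bs v)))" by (simp add: coord_mor_def)
    \<comment> \<open>The values on the basis vectors are the rows of M; this gives the uniqueness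
      required by the definite description.\<close>
    have "M = op_of_mat A"
    proof (rule Hom_eqI[OF M(1) tA])
      fix i j assume ij: "i < ?n" "j < ?n"
      have "f (bs ! i) = dec V bs (app (op_of_mat A) (monom 1 i))"
        using f ij row unfolding has_matrix_def by auto
      then have "dec V bs (app M (monom 1 i)) = dec V bs (app (op_of_mat A) (monom 1 i))"
        using ij b.bs_carrier by (simp add: fM encb)
      then have "coeff (app (trunc ?n) (app M (monom 1 i))) j = coeff (app (trunc ?n) (app (op_of_mat A) (monom 1 i))) j"
        by (simp add: b.dec_eq_iff)
      then show "entry M i j = entry (op_of_mat A) i j" using ij by (simp add: trunc.rep_eq coeff_poly_cutoff entry_def)
    qed
    then show "f = ?f" using fM by simp
  qed
  then show ?thesis unfolding natural_map_def coord_mor_def b.dim_length by simp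
qed

lemma entry_munit_mult: "entry (munit i k * M) a b = (if a = i then entry M k b else 0)"
  by (simp add: entry_def times_linop.rep_eq munit.rep_eq)

lemma entry_mult_munit: "entry (M * munit k j) a b = (if b = j then entry M a k else 0)"
  by (simp add: entry_def times_linop.rep_eq munit.rep_eq)

subsection \<open>Scalar matrices\<close>

definition permop :: "nat \<Rightarrow> (nat \<Rightarrow> nat) \<Rightarrow> 'a::field linop" where
  "permop p \<pi> = op_of_mat (mat p p (\<lambda>(i, j). if j = \<pi> i then 1 else 0))"

lemma permop_in_Hom: "permop p \<pi> \<in> Hom p p"
  unfolding permop_def by (rule op_of_mat_in_Hom) simp

lemma entry_permop_mult:
  assumes "\<pi> permutes {..<p}" "i < p" shows "entry (permop p \<pi> * M) i j = entry M (\<pi> i) j"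
proof -
  have pi: "\<pi> i < p" using permutes_in_image[OF assms(1), of i] assms(2) by simp
  have "entry (permop p \<pi> * M) i j = (\<Sum>l<p. entry (permop p \<pi>) i l * entry M l j)"
    by (rule entry_mult[OF HomD(2)[OF permop_in_Hom]])
  also have "\<dots> = (\<Sum>l<p. if l = \<pi> i then entry M l j else 0)"
    by (rule sum.cong) (use assms(2) in \<open>auto simp: permop_def entry_op_of_mat\<close>)
  finally show ?thesis using pi by simp
qed

lemma entry_mult_permop:
  assumes "\<pi> permutes {..<p}" "M * trunc p = M" "j < p"
  shows "entry (M * permop p (Hilbert_Choice.inv \<pi>)) i j = entry M i (\<pi> j)"
proof -
  have pj: "\<pi> j < p" using permutes_in_image[OF assms(1), of j] assms(3) by simp
  have "entry (M * permop p (Hilbert_Choice.inv \<pi>)) i j =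
      (\<Sum>l<p. entry M i l * entry (permop p (Hilbert_Choice.inv \<pi>)) l j)"
    by (rule entry_mult[OF assms(2)])
  also have "\<dots> = (\<Sum>l<p. if l = \<pi> j then entry M i l else 0)"
    by (rule sum.cong) (use assms(3) permutes_inverses[OF assms(1)] in \<open>auto simp: permop_def entry_op_of_mat\<close>)
  finally show ?thesis using pj by simp
qed

lemma permop_inverse:
  assumes "\<pi> permutes {..<p}"
  shows "permop p \<pi> * permop p (Hilbert_Choice.inv \<pi>) = trunc p"
proof (rule Hom_eqI[of _ p p])
  fix i j assume ij: "i < p" "j < p"
  have "entry (permop p \<pi> * permop p (Hilbert_Choice.inv \<pi>)) i j = entry (permop p \<pi>) i (\<pi> j)"
    by (rule entry_mult_permop[OF assms HomD(2)[OF permop_in_Hom] ij(2)])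
  also have "\<dots> = entry (trunc p) i j"
    using ij permutes_in_image[OF assms, of j] permutes_inj[OF assms]
    by (auto simp: permop_def entry_op_of_mat entry_trunc inj_eq)
  finally show "entry (permop p \<pi> * permop p (Hilbert_Choice.inv \<pi>)) i j = entry (trunc p) i j" .
qed (auto intro: Hom_mult permop_in_Hom trunc_in_Hom)

text \<open>Conjugation by permutation matrices moves any off-diagonal entry to position \<open>(0, p - 1)\<close>;
  an additional transvection compares two diagonal entries.\<close>

lemma scalar_if_conjugate_entries_0:
  fixes G :: "'a::field linop"
  assumes G: "G \<in> Hom p p" and p: "2 \<le> p"
    and inv: "\<And>P P'. P \<in> Hom p p \<Longrightarrow> P' \<in> Hom p p \<Longrightarrow> P * P' = trunc p \<Longrightarrow> entry (P * G * P') 0 (p - 1) = 0"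
  shows "\<exists>c. G = scale c (trunc p)"
proof -
  have off: "entry G i j = 0 \<and> entry G i j + entry G j j - entry G i i - entry G j i = 0" if ij: "i < p" "j < p" "i \<noteq> j" for i j
  proof -
    \<comment> \<open>\<open>j1\<close> is where the first transposition puts j. It differs from 0
      because j differs from i, so the composite below can send 0 to i and p - 1 to j at the same
      time.\<close>
    define j1 where "j1 = Transposition.transpose 0 i j"
    have j1: "j1 < p" "j1 \<noteq> 0" using ij p unfolding j1_def by (auto simp: Transposition.transpose_def)
    define \<pi> where "\<pi> = Transposition.transpose 0 i \<circ> Transposition.transpose (p - 1) j1"
    have perm: "\<pi> permutes {..<p}" unfolding \<pi>_def
      by (rule permutes_compose) (use ij j1 p in \<open>auto intro!: permutes_swap_id\<close>)
    have p0: "\<pi> 0 = i" using j1 p by (auto simp: \<pi>_def Transposition.transpose_def)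
    have p1: "\<pi> (p - 1) = j" by (simp add: \<pi>_def j1_def)
    define P P' :: "'a linop" where "P = permop p \<pi>" and "P' = permop p (Hilbert_Choice.inv \<pi>)"
    have h: "P \<in> Hom p p" "P' \<in> Hom p p" by (auto simp: P_def P'_def permop_in_Hom)
    have PP: "P * P' = trunc p" unfolding P_def P'_def by (rule permop_inverse[OF perm])
    define K where "K = P * G * P'"
    have K: "entry K a b = entry G (\<pi> a) (\<pi> b)" if "a < p" "b < p" for a b
    proof -
      have "entry K a b = entry (P * G) a (\<pi> b)" unfolding K_def P'_def
        by (rule entry_mult_permop[OF perm _ that(2)]) (use G in \<open>simp add: HomD mult.assoc\<close>)
      then show ?thesis unfolding P_def using entry_permop_mult[OF perm that(1)] by simp
    qed
    have bd: "0 < p" "p - 1 < p" using p by auto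
    have 0: "entry K 0 (p - 1) = 0" unfolding K_def by (rule inv[OF h PP])
    \<comment> \<open>Conjugation by this transvection adds the last row of K to its first row and
      subtracts the first column from the last; the corner entry then involves both diagonal
      entries.\<close>
    define T T' :: "'a linop" where "T = trunc p + munit 0 (p - 1)" and "T' = trunc p - munit 0 (p - 1)"
    have u: "munit 0 (p - 1) \<in> Hom p p" using bd by (intro munit_in_Hom) auto
    then have hT: "T \<in> Hom p p" "T' \<in> Hom p p" unfolding T_def T'_def by (auto simp: trunc_in_Hom)
    have "T * T' = trunc p" unfolding T_def T'_def using bd p
      by (simp add: distrib_left distrib_right left_diff_distrib right_diff_distrib trunc_mult_munit munit_mult_trunc munit_mult_munit)
    then have "(T * P) * (P' * T') = trunc p" using PP hT by (metis HomD(2) mult.assoc)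
    then have "entry ((T * P) * G * (P' * T')) 0 (p - 1) = 0"
      by (rule inv[rotated 2]) (use h hT in auto)
    moreover have "(T * P) * G * (P' * T') = T * K * T'" by (simp add: K_def mult.assoc)
    moreover have KE: "trunc p * K = K" "K * trunc p = K" using h G unfolding K_def by (auto simp: HomD HomD_left_commute mult.assoc)
    moreover have "T * K * T' = K + munit 0 (p - 1) * K - K * munit 0 (p - 1) - munit 0 (p - 1) * K * munit 0 (p - 1)"
      unfolding T_def T'_def using KE
      by (simp add: distrib_left distrib_right left_diff_distrib right_diff_distrib mult.assoc)
    ultimately have "entry K 0 (p - 1) + entry K (p - 1) (p - 1) - entry K 0 0 - entry K (p - 1) 0 = 0"
      by (simp add: entry_munit_mult entry_mult_munit mult.assoc)
    then show ?thesis using K bd p0 p1 0 by auto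
  qed
  \<comment> \<open>With i and j exchanged, \<open>entry G j i\<close> vanishes too, and the second
    equation reduces to equality of the diagonal entries.\<close>
  then have *: "entry G i j = 0 \<and> entry G i i = entry G j j" if "i < p" "j < p" "i \<noteq> j" for i j
    using off[of i j] off[of j i] that by auto
  have "G = scale (entry G 0 0) (trunc p)"
  proof (rule Hom_eqI[OF G])
    show "scale (entry G 0 0) (trunc p) \<in> Hom p p" by (auto simp: trunc_in_Hom)
    fix i j assume "i < p" "j < p"
    then show "entry G i j = entry (scale (entry G 0 0) (trunc p)) i j"
      using *[of i j] *[of 0 i] p by (cases "i = 0") (auto simp: entry_trunc)
  qed
  then show ?thesis by blast
qed

lemma op_of_mat_mult:
  assumes "A \<in> carrier_mat p p" "B \<in> carrier_mat p p" shows "op_of_mat (A * B) = op_of_mat A * op_of_mat B"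
proof -
  have "mat_of_op p p (op_of_mat A * op_of_mat B) = A * B"
    using assms by (simp add: mat_of_op_mult[OF op_of_mat_in_Hom[OF assms(1)]] mat_of_op_of_mat)
  then show ?thesis using op_of_mat_of_op[of "op_of_mat A * op_of_mat B" p p] op_of_mat_in_Hom assms by (metis Hom_mult)
qed

lemma op_of_mat_one: "op_of_mat (1\<^sub>m p) = trunc p"
  using op_of_mat_of_op[of "trunc p" p p] by (simp add: mat_of_op_trunc trunc_in_Hom)

lemma op_of_mat_inject: "A \<in> carrier_mat p p \<Longrightarrow> B \<in> carrier_mat p p \<Longrightarrow> op_of_mat A = op_of_mat B \<longleftrightarrow> A = B"
  by (metis mat_of_op_of_mat)

lemma op_of_mat_smult_one: "op_of_mat (c \<cdot>\<^sub>m 1\<^sub>m p) = scale c (trunc p)"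
proof (rule Hom_eqI[of _ p p])
  show "scale c (trunc p) \<in> Hom p p" by (auto simp: trunc_in_Hom)
qed (auto simp: op_of_mat_in_Hom entry_op_of_mat entry_trunc)

subsection \<open>Normal subgroups of the general linear group\<close>

text \<open>Normal subgroups of \<open>GL p\<close> without a group record. Testing
  \<open>G * G' = trunc p\<close> on one side suffices, because for square operators a right inverse
  is two-sided and unique; the same holds for the conjugating pair.\<close>

definition normal_ops :: "nat \<Rightarrow> 'a::field linop set \<Rightarrow> bool" where
  "normal_ops p \<G> \<longleftrightarrow> \<G> \<subseteq> invops p \<and> trunc p \<in> \<G> \<and> (\<forall>G\<in>\<G>. \<forall>K\<in>\<G>. G * K \<in> \<G>) \<and>
    (\<forall>G\<in>\<G>. \<forall>G'\<in>Hom p p. G * G' = trunc p \<longrightarrow> G' \<in> \<G>) \<and>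
    (\<forall>G\<in>\<G>. \<forall>P\<in>Hom p p. \<forall>P'\<in>Hom p p. P * P' = trunc p \<longrightarrow> P * G * P' \<in> \<G>)"

lemma normal_opsD:
  assumes "normal_ops p \<G>"
  shows "\<G> \<subseteq> invops p" "trunc p \<in> \<G>" "G \<in> \<G> \<Longrightarrow> K \<in> \<G> \<Longrightarrow> G * K \<in> \<G>"
    "G \<in> \<G> \<Longrightarrow> G' \<in> Hom p p \<Longrightarrow> G * G' = trunc p \<Longrightarrow> G' \<in> \<G>"
    "G \<in> \<G> \<Longrightarrow> P \<in> Hom p p \<Longrightarrow> P' \<in> Hom p p \<Longrightarrow> P * P' = trunc p \<Longrightarrow> P * G * P' \<in> \<G>"
  using assms unfolding normal_ops_def by simp_all

lemma GL_simps:
  "mult (GL p :: 'a::field mat monoid) = (*)" "one (GL p :: 'a::field mat monoid) = 1\<^sub>m p"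
  "carrier (GL p :: 'a::field mat monoid) = {A \<in> carrier_mat p p. op_of_mat A \<in> invops p}"
proof -
  show "mult (GL p :: 'a::field mat monoid) = (*)" "one (GL p :: 'a::field mat monoid) = 1\<^sub>m p"
    by (auto simp: GL_def units_of_def ring_mat_simps)
  have "A \<in> Units (ring_mat TYPE('a) p ()) \<longleftrightarrow> A \<in> carrier_mat p p \<and> op_of_mat A \<in> invops p" for A :: "'a mat"
  proof
    assume "A \<in> Units (ring_mat TYPE('a) p ())"
    then obtain B where *: "A \<in> carrier_mat p p" "B \<in> carrier_mat p p" "A * B = 1\<^sub>m p"
      by (auto simp: Units_def ring_mat_simps)
    then have "op_of_mat A * op_of_mat B = trunc p" by (metis op_of_mat_mult op_of_mat_one)
    then show "A \<in> carrier_mat p p \<and> op_of_mat A \<in> invops p" using * invopsI op_of_mat_in_Hom by blast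
  next
    assume A: "A \<in> carrier_mat p p \<and> op_of_mat A \<in> invops p"
    then obtain G' where G': "G' \<in> Hom p p" "op_of_mat A * G' = trunc p" "G' * op_of_mat A = trunc p" by (auto elim: invopsE)
    define B where "B = mat_of_op p p G'"
    have B: "B \<in> carrier_mat p p" "op_of_mat B = G'" using G' by (auto simp: B_def op_of_mat_of_op)
    have "A * B = 1\<^sub>m p" "B * A = 1\<^sub>m p"
      using A B G' op_of_mat_inject[of "A * B" p "1\<^sub>m p"] op_of_mat_inject[of "B * A" p "1\<^sub>m p"]
        op_of_mat_mult[of A p B] op_of_mat_mult[of B p A] op_of_mat_one[of p, where 'a='a] by auto
    then show "A \<in> Units (ring_mat TYPE('a) p ())" using A B by (auto simp: Units_def ring_mat_simps)
  qed
  then show "carrier (GL p :: 'a::field mat monoid) = {A \<in> carrier_mat p p. op_of_mat A \<in> invops p}"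
    by (auto simp: GL_def units_of_def)
qed

lemma group_GL: "group (GL p :: 'a::field mat monoid)"
proof -
  interpret M: ring "ring_mat TYPE('a) p ()" by (rule ring_mat)
  show ?thesis unfolding GL_def by (rule M.units_group)
qed

lemma inv_GL:
  assumes "A \<in> carrier (GL p :: 'a::field mat monoid)"
  shows "inv\<^bsub>GL p\<^esub> A \<in> carrier_mat p p" "op_of_mat A * op_of_mat (inv\<^bsub>GL p\<^esub> A) = trunc p"
proof -
  interpret group "GL p :: 'a mat monoid" by (rule group_GL)
  show i: "inv\<^bsub>GL p\<^esub> A \<in> carrier_mat p p" using inv_closed[OF assms] by (simp add: GL_simps)
  have "A * inv\<^bsub>GL p\<^esub> A = 1\<^sub>m p" using r_inv[OF assms] by (simp add: GL_simps)
  then show "op_of_mat A * op_of_mat (inv\<^bsub>GL p\<^esub> A) = trunc p"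
    using i assms op_of_mat_mult[of A p "inv\<^bsub>GL p\<^esub> A"] by (simp add: GL_simps op_of_mat_one)
qed

lemma right_inverse_unique:
  assumes "A \<in> Hom p p" "B \<in> Hom p p" "B' \<in> Hom p p" "A * B = trunc p" "A * B' = trunc p" shows "B = B'"
proof -
  have "B * A = trunc p" using assms Hom_one_sided_inverse by blast
  then have "B * A * B' = B'" using assms by (simp add: HomD)
  then show ?thesis using assms by (simp add: mult.assoc HomD)
qed

lemma normal_GL_iff:
  fixes N :: "'a::field mat set"
  shows "N \<lhd> GL p \<longleftrightarrow> N \<subseteq> carrier_mat p p \<and> normal_ops p (op_of_mat ` N)"
proof -
  interpret group "GL p :: 'a mat monoid" by (rule group_GL)
  show ?thesis
  proof
    assume N: "N \<lhd> GL p"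
    then interpret N: normal N "GL p" .
    have sub: "N \<subseteq> carrier_mat p p" using N.subset by (auto simp: GL_simps)
    have n1: "op_of_mat ` N \<subseteq> invops p" using N.subset by (auto simp: GL_simps)
    have n2: "trunc p \<in> op_of_mat ` N" using N.one_closed by (auto simp: GL_simps op_of_mat_one[symmetric])
    have n3: "G * K \<in> op_of_mat ` N" if ass: "G \<in> op_of_mat ` N" "K \<in> op_of_mat ` N" for G K
    proof -
      obtain A where A: "G = op_of_mat A" "A \<in> N" using ass(1) by (rule imageE)
      obtain B where B: "K = op_of_mat B" "B \<in> N" using ass(2) by (rule imageE)
      note AB = A B
      then have "A * B \<in> N" using N.m_closed by (simp add: GL_simps)
      moreover have "op_of_mat (A * B) = G * K" using AB sub by (auto intro: op_of_mat_mult)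
      ultimately show ?thesis by (metis image_eqI)
    qed
    have n4: "G' \<in> op_of_mat ` N" if ass: "G \<in> op_of_mat ` N" "G' \<in> Hom p p" "G * G' = trunc p" for G G'
    proof -
      obtain A where A: "G = op_of_mat A" "A \<in> N" using ass(1) by (rule imageE)
      then have "inv\<^bsub>GL p\<^esub> A \<in> N" by simp
      moreover have "op_of_mat (inv\<^bsub>GL p\<^esub> A) = G'"
      proof (rule right_inverse_unique[of "op_of_mat A" p])
        have Ac: "A \<in> carrier (GL p)" using A N.subset by blast
        show "op_of_mat A \<in> Hom p p" using A sub by (blast intro: op_of_mat_in_Hom)
        show "op_of_mat (inv\<^bsub>GL p\<^esub> A) \<in> Hom p p" by (rule op_of_mat_in_Hom[OF inv_GL(1)[OF Ac]])
        show "op_of_mat A * op_of_mat (inv\<^bsub>GL p\<^esub> A) = trunc p" by (rule inv_GL(2)[OF Ac])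
      qed (use ass A in auto)
      ultimately show ?thesis by blast
    qed
    have n5: "P * G * P' \<in> op_of_mat ` N" if ass: "G \<in> op_of_mat ` N" "P \<in> Hom p p" "P' \<in> Hom p p" "P * P' = trunc p" for G P P'
    proof -
      obtain A where A: "G = op_of_mat A" "A \<in> N" using ass(1) by (rule imageE)
      define B where "B = mat_of_op p p P"
      have B: "B \<in> carrier (GL p)" "op_of_mat B = P" using ass by (auto simp: B_def GL_simps op_of_mat_of_op intro: invopsI)
      have i: "op_of_mat (inv\<^bsub>GL p\<^esub> B) = P'"
        by (rule right_inverse_unique[of P p])
          (use inv_GL(2)[OF B(1)] B(2) ass in \<open>simp_all add: op_of_mat_in_Hom[OF inv_GL(1)[OF B(1)]]\<close>)
      have "B * A * inv\<^bsub>GL p\<^esub> B \<in> N" using N.inv_op_closed2[OF B(1) A(2)] by (simp add: GL_simps)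
      moreover have "B \<in> carrier_mat p p" "A \<in> carrier_mat p p" using B A sub by (auto simp: GL_simps)
      then have "op_of_mat (B * A * inv\<^bsub>GL p\<^esub> B) = P * G * P'"
        using inv_GL(1)[OF B(1)] B A i by (simp add: op_of_mat_mult[of _ p] mult.assoc)
      ultimately show ?thesis by (metis image_eqI)
    qed
    show "N \<subseteq> carrier_mat p p \<and> normal_ops p (op_of_mat ` N)" unfolding normal_ops_def
    proof (intro conjI ballI impI)
      show "\<And>G K. G \<in> op_of_mat ` N \<Longrightarrow> K \<in> op_of_mat ` N \<Longrightarrow> G * K \<in> op_of_mat ` N" by (rule n3)
      show "\<And>G G'. G \<in> op_of_mat ` N \<Longrightarrow> G' \<in> Hom p p \<Longrightarrow> G * G' = trunc p \<Longrightarrow> G' \<in> op_of_mat ` N" by (rule n4)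
      show "\<And>G P P'. G \<in> op_of_mat ` N \<Longrightarrow> P \<in> Hom p p \<Longrightarrow> P' \<in> Hom p p \<Longrightarrow> P * P' = trunc p \<Longrightarrow>
        P * G * P' \<in> op_of_mat ` N" by (rule n5)
    qed (use sub n1 n2 in auto)
  next
    assume N: "N \<subseteq> carrier_mat p p \<and> normal_ops p (op_of_mat ` N)"
    note n = normal_opsD[OF conjunct2[OF N]]
    have mem: "A \<in> N" if "A \<in> carrier_mat p p" "op_of_mat A \<in> op_of_mat ` N" for A
      using that N op_of_mat_inject by (metis (no_types, lifting) imageE subsetD)
    have sub: "N \<subseteq> carrier (GL p)" using N n(1) by (auto simp: GL_simps)
    have "subgroup N (GL p)"
    proof (rule subgroupI[OF sub])
      show "N \<noteq> {}" using n(2) by auto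
      show "inv\<^bsub>GL p\<^esub> A \<in> N" if "A \<in> N" for A
      proof -
        note i = inv_GL[OF subsetD[OF sub that]]
        show ?thesis by (rule mem[OF i(1) n(4)[OF imageI[OF that] op_of_mat_in_Hom[OF i(1)] i(2)]])
      qed
      show "A \<otimes>\<^bsub>GL p\<^esub> B \<in> N" if "A \<in> N" "B \<in> N" for A B
      proof (rule mem)
        have AB: "A \<in> carrier_mat p p" "B \<in> carrier_mat p p" using that N by auto
        show "A \<otimes>\<^bsub>GL p\<^esub> B \<in> carrier_mat p p" using AB by (simp add: GL_simps)
        have "op_of_mat A * op_of_mat B \<in> op_of_mat ` N" by (rule n(3)) (use that in auto)
        then show "op_of_mat (A \<otimes>\<^bsub>GL p\<^esub> B) \<in> op_of_mat ` N" using AB by (simp add: GL_simps op_of_mat_mult)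
      qed
    qed
    moreover have "B \<otimes>\<^bsub>GL p\<^esub> A \<otimes>\<^bsub>GL p\<^esub> inv\<^bsub>GL p\<^esub> B \<in> N" if "B \<in> carrier (GL p)" "A \<in> N" for A B
    proof (rule mem)
      have AB: "A \<in> carrier_mat p p" "B \<in> carrier_mat p p" using that N by (auto simp: GL_simps)
      note i = inv_GL[OF that(1)]
      show "B \<otimes>\<^bsub>GL p\<^esub> A \<otimes>\<^bsub>GL p\<^esub> inv\<^bsub>GL p\<^esub> B \<in> carrier_mat p p" using AB i by (simp add: GL_simps)
      have "op_of_mat B * op_of_mat A * op_of_mat (inv\<^bsub>GL p\<^esub> B) \<in> op_of_mat ` N"
        by (rule n(5)[OF imageI[OF that(2)] op_of_mat_in_Hom[OF AB(2)] op_of_mat_in_Hom[OF i(1)] i(2)])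
      then show "op_of_mat (B \<otimes>\<^bsub>GL p\<^esub> A \<otimes>\<^bsub>GL p\<^esub> inv\<^bsub>GL p\<^esub> B) \<in> op_of_mat ` N"
        using AB i by (simp add: GL_simps op_of_mat_mult[of _ p] mult.assoc)
    qed
    ultimately show "N \<lhd> GL p" by (auto intro: normal_invI)
  qed
qed

subsection \<open>The linear category in coordinates\<close>

definition chosen_basis :: "('a::field, 'v) module \<Rightarrow> 'v list" where
  "chosen_basis U = (SOME bs. ordered_basis U bs)"

text \<open>One fixed basis for each space turns composition into multiplication of operators. The
  bases \<open>B p\<close> cannot serve here: they are indexed by p, and a member of C may occur as
  \<open>V p\<close> for several p or for none.\<close>

definition mor :: "('a::field, 'v) module \<Rightarrow> 'a linop \<Rightarrow> ('a, 'v) module \<Rightarrow> ('a, 'v) morphism" where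
  "mor U M W = coord_mor U (chosen_basis U) M W (chosen_basis W)"

lemma mor_dom_ran [simp]: "mdom (mor U M W) = U" "mran (mor U M W) = W"
  by (auto simp: mor_def)

locale fin_vs_set =
  fixes C :: "('a::field, 'v) module set"
  assumes C_nonempty: "C \<noteq> {}"
    and C_vs: "\<And>U. U \<in> C \<Longrightarrow> vectorspace class_ring U \<and> vectorspace.fin_dim class_ring U"
begin

lemma based_chosen_basis:
  assumes "U \<in> C" shows "based_space U (chosen_basis U)" "length (chosen_basis U) = vdim U"
proof -
  interpret vectorspace class_ring U using C_vs[OF assms] by blast
  have "fin_dim" using C_vs[OF assms] by blast
  then obtain A where "finite A" "basis A" using finite_basis_exists by blast
  then have "\<exists>bs. ordered_basis U bs"
    unfolding ordered_basis_def using finite_distinct_list by metis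
  then have "ordered_basis U (chosen_basis U)" unfolding chosen_basis_def by (rule someI_ex)
  then show b: "based_space U (chosen_basis U)" by unfold_locales
  show "length (chosen_basis U) = vdim U" using based_space.dim_length[OF b] by simp
qed

lemma two_based: "U \<in> C \<Longrightarrow> W \<in> C \<Longrightarrow> two_spaces U W (chosen_basis U) (chosen_basis W)"
  by (intro two_spaces.intro based_chosen_basis)

lemma mor_in: "U \<in> C \<Longrightarrow> W \<in> C \<Longrightarrow> mor U M W \<in> lin_cat C"
  using two_spaces.coord_mor_linear[OF two_based] unfolding lin_cat_def mor_def coord_mor_def by auto

lemma lin_catE:
  assumes "x \<in> lin_cat C"
  obtains U W M where "U \<in> C" "W \<in> C" "M \<in> Hom (vdim U) (vdim W)" "x = mor U M W"
proof -
  obtain U f W where x: "x = (U, f, W)" "U \<in> C" "W \<in> C" "linear_map class_ring U W f"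
    "f \<in> extensional (carrier U)" using assms unfolding lin_cat_def by blast
  obtain M where "M \<in> Hom (length (chosen_basis U)) (length (chosen_basis W))" "(U, f, W) = coord_mor U (chosen_basis U) M W (chosen_basis W)"
    using two_spaces.coord_mor_exists[OF two_based[OF x(2,3)] x(4,5)] by blast
  then have "M \<in> Hom (vdim U) (vdim W)" "x = mor U M W" using x based_chosen_basis by (auto simp: mor_def)
  then show ?thesis using that x by blast
qed

lemma mor_inject:
  assumes "U \<in> C" "W \<in> C" "M \<in> Hom (vdim U) (vdim W)" "N \<in> Hom (vdim U) (vdim W)"
  shows "mor U M W = mor U N W \<longleftrightarrow> M = N"
  using two_spaces.coord_mor_inject[OF two_based[OF assms(1,2)], of M N] assms(3,4) based_chosen_basis(2) assms(1,2)
  by (simp add: mor_def)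

lemma mor_eqD: "mor U M W = mor U' M' W' \<Longrightarrow> U = U' \<and> W = W'"
  by (metis mor_dom_ran)

lemma mor_comp:
  assumes "U \<in> C" "W \<in> C" "X \<in> C" "M \<in> Hom (vdim U) (vdim W)"
  shows "mor U M W \<cdot>\<^sub>L mor W N X = mor U (M * N) X"
  unfolding mor_def by (rule coord_mor_comp) (use assms based_chosen_basis in simp_all)

lemma mrank_mor:
  assumes "U \<in> C" "W \<in> C" "M \<in> Hom (vdim U) (vdim W)"
  shows "mrank (mor U M W) = rk M"
  unfolding mor_def
  by (rule two_spaces.mrank_coord_mor[OF two_based[OF assms(1,2)]]) (use assms based_chosen_basis(2) in simp)

lemma mor_rank_ideal:
  assumes "U \<in> C" "W \<in> C" "M \<in> Hom (vdim U) (vdim W)"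
  shows "mor U M W \<in> rank_ideal C r \<longleftrightarrow> enat (rk M) \<le> r"
  unfolding rank_ideal_def using mor_in[OF assms(1,2)] mrank_mor[OF assms] by simp

lemma rank_idealE:
  assumes "x \<in> rank_ideal C r"
  obtains U W M where "U \<in> C" "W \<in> C" "M \<in> Hom (vdim U) (vdim W)" "enat (rk M) \<le> r" "x = mor U M W"
proof -
  have "x \<in> lin_cat C" using assms by (simp add: rank_ideal_def)
  then obtain U W M where *: "U \<in> C" "W \<in> C" "M \<in> Hom (vdim U) (vdim W)" "x = mor U M W"
    by (rule lin_catE)
  then have "enat (rk M) \<le> r" using assms mor_rank_ideal by blast
  then show ?thesis using that * by blast
qed

end

lemma rk_trans_le: "m \<le> n \<Longrightarrow> enat n \<le> r \<Longrightarrow> enat m \<le> r"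
  using enat_ord_simps(1) order_trans by blast

subsection \<open>The ideal and the kernels of a congruence\<close>

locale matrix_cong = fin_vs_set C for C :: "('a::field, 'b) module set" +
  fixes r :: enat and \<sigma> :: "('a, 'b) morphism rel"
  assumes cong: "congruence (rank_ideal C r) \<sigma>"
begin

definition rel :: "('a, 'b) module \<Rightarrow> ('a, 'b) module \<Rightarrow> 'a linop \<Rightarrow> 'a linop \<Rightarrow> bool" where
  "rel U W M N \<longleftrightarrow> U \<in> C \<and> W \<in> C \<and> M \<in> Hom (vdim U) (vdim W) \<and> N \<in> Hom (vdim U) (vdim W) \<and>
    (mor U M W, mor U N W) \<in> \<sigma>"

lemma equiv: "equiv (rank_ideal C r) \<sigma>" and sub_nabla: "\<sigma> \<subseteq> nabla (rank_ideal C r)"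
  using cong by (auto simp: congruence_def)

lemma sigmaE:
  assumes "(x, y) \<in> \<sigma>"
  obtains U W M N where "rel U W M N" "x = mor U M W" "y = mor U N W"
proof -
  have n: "x \<in> rank_ideal C r" "y \<in> rank_ideal C r" "mdom x = mdom y" "mran x = mran y"
    using assms sub_nabla by (auto simp: nabla_def)
  obtain U W M where x: "U \<in> C" "W \<in> C" "M \<in> Hom (vdim U) (vdim W)" "x = mor U M W"
    using n(1) by (rule rank_idealE)
  obtain U' W' N where y: "U' \<in> C" "W' \<in> C" "N \<in> Hom (vdim U') (vdim W')" "y = mor U' N W'"
    using n(2) by (rule rank_idealE)
  have "U' = U" "W' = W" using n x y by auto
  then show ?thesis using that[of U W M N] x y assms unfolding rel_def by simp
qed

lemma relD:
  assumes "rel U W M N"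
  shows "U \<in> C" "W \<in> C" "M \<in> Hom (vdim U) (vdim W)" "N \<in> Hom (vdim U) (vdim W)"
  using assms by (auto simp: rel_def)

lemma rel_rank:
  assumes "rel U W M N" shows "enat (rk M) \<le> r" "enat (rk N) \<le> r"
proof -
  have "mor U M W \<in> rank_ideal C r" "mor U N W \<in> rank_ideal C r"
    using assms sub_nabla by (auto simp: rel_def nabla_def)
  then show "enat (rk M) \<le> r" "enat (rk N) \<le> r" using mor_rank_ideal relD[OF assms] by auto
qed

lemma rel_refl:
  assumes "U \<in> C" "W \<in> C" "M \<in> Hom (vdim U) (vdim W)" "enat (rk M) \<le> r"
  shows "rel U W M M"
proof -
  have "mor U M W \<in> rank_ideal C r" using mor_rank_ideal assms by blast
  then have "(mor U M W, mor U M W) \<in> \<sigma>" using equiv by (meson equivE refl_onD)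
  then show ?thesis using assms by (simp add: rel_def)
qed

lemma rel_sym: "rel U W M N \<Longrightarrow> rel U W N M"
  using equiv unfolding rel_def by (meson equivE symD)

lemma rel_trans: "rel U W M N \<Longrightarrow> rel U W N K \<Longrightarrow> rel U W M K"
  using equiv unfolding rel_def by (meson equivE transD)

lemma rel_left:
  assumes "rel U W M N" "X \<in> C" "A \<in> Hom (vdim X) (vdim U)" "enat (rk A) \<le> r"
  shows "rel X W (A * M) (A * N)"
proof -
  note d = relD[OF assms(1)]
  have a: "mor X A U \<in> rank_ideal C r" using mor_rank_ideal[OF assms(2) d(1) assms(3)] assms(4) by simp
  have "(mor U M W, mor U N W) \<in> \<sigma>" using assms(1) by (simp add: rel_def)
  then have "(mor X A U \<cdot>\<^sub>L mor U M W, mor X A U \<cdot>\<^sub>L mor U N W) \<in> \<sigma>"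
    using cong a unfolding congruence_def by fastforce
  then have "(mor X (A * M) W, mor X (A * N) W) \<in> \<sigma>"
    using mor_comp[OF assms(2) d(1,2) assms(3)] by simp
  moreover have "A * M \<in> Hom (vdim X) (vdim W)" "A * N \<in> Hom (vdim X) (vdim W)"
    using Hom_mult[OF assms(3) d(3)] Hom_mult[OF assms(3) d(4)] by simp_all
  ultimately show ?thesis using assms(2) d by (simp add: rel_def)
qed

lemma rel_right:
  assumes "rel U W M N" "X \<in> C" "A \<in> Hom (vdim W) (vdim X)" "enat (rk A) \<le> r"
  shows "rel U X (M * A) (N * A)"
proof -
  note d = relD[OF assms(1)]
  have a: "mor W A X \<in> rank_ideal C r" using mor_rank_ideal[OF d(2) assms(2,3)] assms(4) by simp
  have "(mor U M W, mor U N W) \<in> \<sigma>" using assms(1) by (simp add: rel_def)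
  then have "(mor U M W \<cdot>\<^sub>L mor W A X, mor U N W \<cdot>\<^sub>L mor W A X) \<in> \<sigma>"
    using cong a unfolding congruence_def by fastforce
  then have "(mor U (M * A) X, mor U (N * A) X) \<in> \<sigma>"
    using mor_comp[OF d(1,2) assms(2) d(3)] mor_comp[OF d(1,2) assms(2) d(4)] by simp
  moreover have "M * A \<in> Hom (vdim U) (vdim X)" "N * A \<in> Hom (vdim U) (vdim X)"
    using Hom_mult[OF d(3) assms(3)] Hom_mult[OF d(4) assms(3)] by simp_all
  ultimately show ?thesis using assms(2) d by (simp add: rel_def)
qed

text \<open>Sandwiching gives \<open>N = \<gamma> * (\<alpha>' * M * \<beta>') * \<delta>\<close>.
  The multipliers \<open>\<gamma> * \<alpha>'\<close> and \<open>\<beta>' * \<delta>\<close> factor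
  through a space of dimension \<open>rk N\<close>, so they belong to the ideal.\<close>

lemma rel_zero_mono:
  assumes "rel U W M 0" "X \<in> C" "Y \<in> C" "N \<in> Hom (vdim X) (vdim Y)" "rk N \<le> rk M"
  shows "rel X Y N 0"
proof -
  note d = relD[OF assms(1)]
  define k j where "k = rk M" and "j = rk N"
  obtain \<alpha> \<beta> \<alpha>' \<beta>' where M: "\<alpha> \<in> Hom (vdim U) k" "\<beta> \<in> Hom k (vdim W)"
    "\<alpha>' \<in> Hom k (vdim U)" "\<beta>' \<in> Hom (vdim W) k" "M = \<alpha> * \<beta>" "\<alpha>' * \<alpha> = trunc k" "\<beta> * \<beta>' = trunc k"
    using rk_factorE[OF d(3)] unfolding k_def by metis
  obtain \<gamma> \<delta> where N: "\<gamma> \<in> Hom (vdim X) j" "\<delta> \<in> Hom j (vdim Y)" "N = \<gamma> * \<delta>"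
    using rk_factorE[OF assms(4)] unfolding j_def by metis
  have jk: "j \<le> k" using assms(5) by (simp add: j_def k_def)
  have hA: "\<gamma> * \<alpha>' \<in> Hom (vdim X) (vdim U)" "\<beta>' * \<delta> \<in> Hom (vdim W) (vdim Y)"
    using Hom_mult[OF N(1) M(3)] Hom_mult[OF M(4) N(2)] by simp_all
  have kr: "enat k \<le> r" using rel_rank(1)[OF assms(1)] by (simp add: k_def)
  have rA: "enat (rk (\<gamma> * \<alpha>')) \<le> r" "enat (rk (\<beta>' * \<delta>)) \<le> r"
    using rk_mult_Hom_le(1)[OF N(1), of \<alpha>'] rk_mult_Hom_le(2)[OF N(2), of \<beta>'] jk kr
    by (meson le_trans rk_trans_le)+
  have "rel X Y (\<gamma> * \<alpha>' * M * (\<beta>' * \<delta>)) (\<gamma> * \<alpha>' * 0 * (\<beta>' * \<delta>))"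
    by (rule rel_right[OF rel_left[OF assms(1,2) hA(1) rA(1)] assms(3) hA(2) rA(2)])
  moreover have "\<gamma> * \<alpha>' * M * (\<beta>' * \<delta>) = \<gamma> * (\<alpha>' * \<alpha>) * (\<beta> * \<beta>') * \<delta>"
    using M(5) by (simp add: mult.assoc)
  then have "\<gamma> * \<alpha>' * M * (\<beta>' * \<delta>) = \<gamma> * (trunc k * \<delta>)"
    using M(6,7) by (simp add: mult.assoc trunc_mult_trunc_left)
  then have "\<gamma> * \<alpha>' * M * (\<beta>' * \<delta>) = N"
    using HomD(1)[OF Hom_mono[OF N(2) jk order_refl]] N(3) by simp
  ultimately show ?thesis by simp
qed

text \<open>If everything is related to zero, any two parallel maps are related through zero.
  Otherwise let k be the least rank of a map not related to zero. It is positive since zero is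
  related to itself, and by \<open>rel_zero_mono\<close> no map of rank k or more is related to
  zero; so q = k - 1.\<close>

lemma nabla_or_threshold:
  "\<sigma> = nabla (rank_ideal C r) \<or> (\<exists>q. enat q < r \<and>
    (\<forall>U\<in>C. \<forall>W\<in>C. \<forall>M\<in>Hom (vdim U) (vdim W). enat (rk M) \<le> r \<longrightarrow> rel U W M 0 = (rk M \<le> q)))"
proof (cases "\<forall>U\<in>C. \<forall>W\<in>C. \<forall>M\<in>Hom (vdim U) (vdim W). enat (rk M) \<le> r \<longrightarrow> rel U W M 0")
  case True
  have "nabla (rank_ideal C r) \<subseteq> \<sigma>"
  proof (rule subrelI)
    fix x y assume "(x, y) \<in> nabla (rank_ideal C r)"
    then have n: "x \<in> rank_ideal C r" "y \<in> rank_ideal C r" "mdom x = mdom y" "mran x = mran y"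
      by (auto simp: nabla_def)
    obtain U W M where x: "U \<in> C" "W \<in> C" "M \<in> Hom (vdim U) (vdim W)" "enat (rk M) \<le> r" "x = mor U M W"
      using n(1) by (rule rank_idealE)
    obtain U' W' N where y: "U' \<in> C" "W' \<in> C" "N \<in> Hom (vdim U') (vdim W')" "enat (rk N) \<le> r" "y = mor U' N W'"
      using n(2) by (rule rank_idealE)
    have e: "U' = U" "W' = W" using n x y by auto
    have "rel U W M 0" "rel U W N 0" using True x y e by auto
    then have "rel U W M N" using rel_sym rel_trans by blast
    then show "(x, y) \<in> \<sigma>" using x y e by (simp add: rel_def)
  qed
  then show ?thesis using sub_nabla by blast
next
  case False
  define S where "S = {k. \<exists>U\<in>C. \<exists>W\<in>C. \<exists>M\<in>Hom (vdim U) (vdim W). enat (rk M) \<le> r \<and> rk M = k \<and> \<not> rel U W M 0}"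
  have "\<exists>k. k \<in> S" using False unfolding S_def by blast
  then have L: "(LEAST k. k \<in> S) \<in> S" by (metis LeastI)
  define k where "k = (LEAST k. k \<in> S)"
  obtain U W M where M: "U \<in> C" "W \<in> C" "M \<in> Hom (vdim U) (vdim W)" "enat (rk M) \<le> r" "rk M = k" "\<not> rel U W M 0"
    using L unfolding k_def[symmetric] unfolding S_def by blast
  have "k \<noteq> 0"
  proof
    assume "k = 0"
    then have "M = 0" using rk_0_iff[OF M(3)] M(5) by simp
    then show False using rel_refl[OF M(1-4)] M(6) by simp
  qed
  then obtain q where q: "k = Suc q" by (cases k) auto
  have "enat q < r" using M(4,5) q by (metis Suc_ile_eq)
  moreover have "rel X Y N 0 \<longleftrightarrow> rk N \<le> q"
    if N: "X \<in> C" "Y \<in> C" "N \<in> Hom (vdim X) (vdim Y)" "enat (rk N) \<le> r" for X Y N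
  proof
    assume "rel X Y N 0"
    then have "\<not> rk M \<le> rk N" using rel_zero_mono[OF _ M(1-3)] M(6) by blast
    then show "rk N \<le> q" using M(5) q by simp
  next
    assume "rk N \<le> q"
    then have "rk N \<notin> S" using not_less_Least[of "rk N" "\<lambda>k. k \<in> S"] q unfolding k_def by simp
    then show "rel X Y N 0" using N unfolding S_def by blast
  qed
  ultimately show ?thesis by blast
qed

end

section \<open>Congruences whose zero class consists of the maps of rank at most q\<close>

locale threshold_cong = matrix_cong C r \<sigma>
  for C :: "('a::field, 'b) module set" and r :: enat and \<sigma> :: "('a, 'b) morphism rel" +
  fixes q :: nat
  assumes q_less: "enat q < r"
    and zero_iff: "\<And>U W M. U \<in> C \<Longrightarrow> W \<in> C \<Longrightarrow> M \<in> Hom (vdim U) (vdim W) \<Longrightarrow> enat (rk M) \<le> r \<Longrightarrow>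
      rel U W M 0 = (rk M \<le> q)"
begin

lemma Suc_q_le: "enat (q + 1) \<le> r"
  using q_less by (simp add: Suc_ile_eq)

lemma rel_low: "rel U W M N \<Longrightarrow> rk M \<le> q \<longleftrightarrow> rk N \<le> q"
  using zero_iff rel_rank relD rel_sym rel_trans by meson

text \<open>The difference projects onto the coordinates 1 to q and therefore factors through
  dimension q.\<close>

lemma rk_trunc_diff_le:
  fixes X :: "'a linop"
  shows "rk ((trunc (q + 1) - trunc 1) * X) \<le> q" "rk (X * (trunc (q + 1) - trunc 1)) \<le> q"
proof -
  have "(trunc (q + 1) - trunc 1 :: 'a linop) = shift_down 1 * trunc q * shift_up 1" by (simp add: shift_down_trunc_shift_up)
  then have "(trunc (q + 1) - trunc 1) * X = shift_down 1 * trunc q * (shift_up 1 * X)"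
    "X * (trunc (q + 1) - trunc 1) = (X * shift_down 1) * trunc q * shift_up 1" by (simp_all add: mult.assoc)
  then show "rk ((trunc (q + 1) - trunc 1) * X) \<le> q" "rk (X * (trunc (q + 1) - trunc 1)) \<le> q" using rk_le by blast+
qed

lemma rel_left_kernel:
  assumes rel: "rel U W M N" and N: "q < rk N" and u: "u \<in> Hom 1 (vdim U)" "u * M = 0"
  shows "u * N = 0"
proof (rule ccontr)
  assume nz: "u * N \<noteq> 0"
  note d = relD[OF rel]
  define k where "k = rk N"
  obtain \<gamma> \<delta> \<gamma>' \<delta>' where f: "\<gamma> \<in> Hom (vdim U) k" "\<delta> \<in> Hom k (vdim W)"
    "\<gamma>' \<in> Hom k (vdim U)" "\<delta>' \<in> Hom (vdim W) k" "N = \<gamma> * \<delta>" "\<gamma>' * \<gamma> = trunc k" "\<delta> * \<delta>' = trunc k"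
    using rk_factorE[OF d(4)] unfolding k_def by metis
  have qk: "q + 1 \<le> k" "k \<le> vdim U" using N rk_Hom_le(1)[OF d(4)] by (auto simp: k_def)
  have "u * \<gamma> \<noteq> 0" using nz f(5) by (auto simp flip: mult.assoc)
  then obtain w where w: "w \<in> Hom k 1" "u * \<gamma> * w = trunc 1"
    using row_right_inverse[OF Hom_mult[OF u(1) f(1)]] by blast
  \<comment> \<open>\<open>P'\<close> is an invertible matrix with first row
    \<open>u * \<gamma>\<close>.\<close>
  obtain P P' where P: "P \<in> Hom k k" "P' \<in> Hom k k" "P' * P = trunc k" "trunc 1 * P' = u * \<gamma>"
    using complete_left_inverse[OF w(1) Hom_mult[OF u(1) f(1)] w(2)] by metis
  define D where "D = (trunc (q + 1) - trunc 1 :: 'a linop)"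
  \<comment> \<open>The first row of a is u, the next q rows are those of \<open>P'\<close> pulled
    back along \<gamma>'. Thus \<open>a * \<gamma>\<close> consists of the first q + 1 rows of an
    invertible matrix, while the first row of \<open>a * M\<close> is zero.\<close>
  define a where "a = u + D * (P' * \<gamma>')"
  have DE: "D + trunc 1 = trunc (q + 1)" "trunc (q + 1) * D = D" by (simp_all add: D_def right_diff_distrib)
  have "a \<in> Hom (q + 1) (vdim U)"
  proof -
    have "trunc (q + 1) * (D * X) = D * X" for X using DE(2) by (simp only: mult.assoc[symmetric])
    then have "D * (P' * \<gamma>') \<in> Hom (q + 1) (vdim U)" unfolding Hom_def using f(3)
      by (simp add: HomD mult.assoc)
    moreover have "u \<in> Hom (q + 1) (vdim U)" using u(1) by (rule Hom_mono) auto
    ultimately show ?thesis unfolding a_def by (rule Hom_add[rotated])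
  qed
  \<comment> \<open>Zero rows extend a to an endomorphism of U, for which q + 1 <=
    \<open>vdim U\<close> leaves room; rank at most q + 1 keeps it in the ideal.\<close>
  then have a: "a \<in> Hom (vdim U) (vdim U)" "rk a \<le> q + 1"
    using qk rk_Hom_le(1) by (auto intro: Hom_mono)
  have ar: "enat (rk a) \<le> r" using a(2) Suc_q_le by (rule rk_trans_le)
  have rel': "rel U W (a * M) (a * N)" by (rule rel_left[OF rel d(1) a(1) ar])
  have "a * M = D * (P' * \<gamma>' * M)" using u(2) by (simp add: a_def distrib_right mult.assoc)
  then have "rk (a * M) \<le> q" using rk_trunc_diff_le(1) unfolding D_def by simp
  then have 1: "rk (a * N) \<le> q" using rel_low[OF rel'] by simp
  have "a * \<gamma> = trunc 1 * P' + D * P'" using f(6) P(2,4) by (simp add: a_def distrib_right mult.assoc HomD)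
  also have "\<dots> = trunc (q + 1) * P'" using DE(1) by (metis add.commute distrib_right)
  finally have ag: "a * \<gamma> = trunc (q + 1) * P'" .
  have "a * N * (\<delta>' * P) = a * \<gamma> * (\<delta> * \<delta>') * P" using f(5) by (simp add: mult.assoc)
  also have "\<dots> = trunc (q + 1) * (P' * P)" using f(7) ag P(2) by (simp add: mult.assoc HomD_left_commute)
  also have "\<dots> = trunc (q + 1)" using P(3) qk by (simp add: min_def)
  finally have "q + 1 \<le> rk (a * N)"
    using rk_mult_le(2)[OF relD(4)[OF rel'], of "\<delta>' * P"] rk_trunc[of "q + 1"] by simp
  then show False using 1 by simp
qed

lemma rel_right_kernel:
  assumes rel: "rel U W M N" and N: "q < rk N" and u: "u \<in> Hom (vdim W) 1" "M * u = 0"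
  shows "N * u = 0"
proof (rule ccontr)
  assume nz: "N * u \<noteq> 0"
  note d = relD[OF rel]
  define k where "k = rk N"
  obtain \<gamma> \<delta> \<gamma>' \<delta>' where f: "\<gamma> \<in> Hom (vdim U) k" "\<delta> \<in> Hom k (vdim W)"
    "\<gamma>' \<in> Hom k (vdim U)" "\<delta>' \<in> Hom (vdim W) k" "N = \<gamma> * \<delta>" "\<gamma>' * \<gamma> = trunc k" "\<delta> * \<delta>' = trunc k"
    using rk_factorE[OF d(4)] unfolding k_def by metis
  have qk: "q + 1 \<le> k" "k \<le> vdim W" using N rk_Hom_le(2)[OF d(4)] by (auto simp: k_def)
  have "\<delta> * u \<noteq> 0" using nz f(5) by (auto simp: mult.assoc)
  then obtain w where w: "w \<in> Hom 1 k" "w * (\<delta> * u) = trunc 1"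
    using column_left_inverse[OF Hom_mult[OF f(2) u(1)]] by blast
  obtain P P' where P: "P \<in> Hom k k" "P' \<in> Hom k k" "P' * P = trunc k" "P * trunc 1 = \<delta> * u"
    using complete_left_inverse[OF Hom_mult[OF f(2) u(1)] w] by metis
  define D where "D = (trunc (q + 1) - trunc 1 :: 'a linop)"
  \<comment> \<open>Columns now replace rows: column 0 is u, and columns 1 to q are those of the
    invertible \<open>P\<close> carried over by \<delta>'.\<close>
  define a where "a = u + \<delta>' * P * D"
  have DE: "D + trunc 1 = trunc (q + 1)" "D * trunc (q + 1) = D" by (simp_all add: D_def left_diff_distrib)
  have "a \<in> Hom (vdim W) (q + 1)"
  proof -
    have "\<delta>' * P * D \<in> Hom (vdim W) (q + 1)" unfolding Hom_def using DE(2) f(4)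
      by (simp add: HomD_left_commute mult.assoc)
    moreover have "u \<in> Hom (vdim W) (q + 1)" using u(1) by (rule Hom_mono) auto
    ultimately show ?thesis unfolding a_def by (rule Hom_add[rotated])
  qed
  then have a: "a \<in> Hom (vdim W) (vdim W)" "rk a \<le> q + 1"
    using qk rk_Hom_le(2) by (auto intro: Hom_mono)
  have ar: "enat (rk a) \<le> r" using a(2) Suc_q_le by (rule rk_trans_le)
  have rel': "rel U W (M * a) (N * a)" by (rule rel_right[OF rel d(2) a(1) ar])
  have "M * a = (M * \<delta>' * P) * D" using u(2) by (simp add: a_def distrib_left mult.assoc)
  then have "rk (M * a) \<le> q" using rk_trunc_diff_le(2) unfolding D_def by simp
  then have 1: "rk (N * a) \<le> q" using rel_low[OF rel'] by simp
  have "\<delta> * a = P * trunc 1 + \<delta> * \<delta>' * (P * D)" using P(4) by (simp add: a_def distrib_left mult.assoc)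
  also have "\<dots> = P * trunc 1 + P * D" using f(7) P(1) by (simp add: HomD_left_commute)
  also have "\<dots> = P * trunc (q + 1)" using DE(1) by (metis add.commute distrib_left)
  finally have ag: "\<delta> * a = P * trunc (q + 1)" .
  have "P' * \<gamma>' * (N * a) = P' * (\<gamma>' * \<gamma>) * (\<delta> * a)" using f(5) by (simp add: mult.assoc)
  also have "\<dots> = (P' * P) * trunc (q + 1)" using f(6) ag P(1) by (simp add: mult.assoc HomD_left_commute)
  also have "\<dots> = trunc (q + 1)" using P(3) qk by (simp add: min_def)
  finally have "q + 1 \<le> rk (N * a)"
    using rk_mult_le(1)[OF relD(4)[OF rel'], of "P' * \<gamma>'"] rk_trunc[of "q + 1"] by simp
  then show False using 1 by simp
qed

text \<open>Reduction to vectors: \<open>munit 0 i * X\<close> moves row i of X into row 0, and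
  dually for columns. Only the inner size of X is prescribed.\<close>

lemma rel_annihilate:
  assumes rel: "rel U W M N" and N: "q < rk N"
  shows "X * trunc (vdim U) = X \<Longrightarrow> X * M = 0 \<Longrightarrow> X * N = 0"
    "trunc (vdim W) * X = X \<Longrightarrow> M * X = 0 \<Longrightarrow> N * X = 0"
proof -
  assume X: "X * trunc (vdim U) = X" "X * M = 0"
  have "entry (X * N) i b = 0" for i b
  proof -
    have "munit 0 i * X \<in> Hom 1 (vdim U)" using X(1)
      by (simp add: Hom_def mult.assoc trunc_mult_munit_left)
    moreover have "munit 0 i * X * M = 0" using X(2) by (simp add: mult.assoc)
    ultimately have "munit 0 i * X * N = 0" by (rule rel_left_kernel[OF rel N])
    then have "entry (munit 0 i * (X * N)) 0 b = 0" by (simp add: mult.assoc)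
    then show ?thesis by (simp add: entry_munit_mult)
  qed
  then show "X * N = 0" by (intro linop_eqI) simp
next
  assume X: "trunc (vdim W) * X = X" "M * X = 0"
  have "entry (N * X) b i = 0" for i b
  proof -
    have "X * munit i 0 \<in> Hom (vdim W) 1" using X(1)
      by (simp add: Hom_def munit_mult_trunc mult.assoc) (simp flip: mult.assoc)
    moreover have "M * (X * munit i 0) = 0" using X(2) by (simp flip: mult.assoc)
    ultimately have "N * (X * munit i 0) = 0" by (rule rel_right_kernel[OF rel N])
    then have "entry (N * X * munit i 0) b 0 = 0" by (simp add: mult.assoc)
    then show ?thesis by (simp add: entry_mult_munit)
  qed
  then show "N * X = 0" by (intro linop_eqI) simp
qed

text \<open>The idempotent \<open>trunc (vdim U) - \<alpha> * \<alpha>'\<close> annihilates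
  \<open>\<alpha> * \<beta>\<close> from the left and hence also N; likewise
  \<open>trunc (vdim W) - \<beta>' * \<beta>\<close> from the right. So N is fixed by both
  complementary idempotents.\<close>

lemma rel_sandwich:
  assumes rel: "rel U W (\<alpha> * \<beta>) N" and h: "\<alpha> \<in> Hom (vdim U) p" "\<beta> \<in> Hom p (vdim W)"
    and inv: "\<alpha>' \<in> Hom p (vdim U)" "\<beta>' \<in> Hom (vdim W) p" "\<alpha>' * \<alpha> = trunc p" "\<beta> * \<beta>' = trunc p"
    and p: "q < p"
  shows "N = \<alpha> * (\<alpha>' * N * \<beta>') * \<beta>"
proof -
  note d = relD[OF rel]
  have "rk (\<alpha> * \<beta>) = p" 
  proof (rule rk_eqI[of _ \<alpha> _ \<beta> \<alpha>' \<beta>'])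
    show "\<alpha> * \<beta> = \<alpha> * trunc p * \<beta>" using h by (simp add: HomD)
    have "\<alpha>' * (\<alpha> * \<beta>) * \<beta>' = (\<alpha>' * \<alpha>) * (\<beta> * \<beta>')" by (simp only: mult.assoc)
    then show "trunc p = \<alpha>' * (\<alpha> * \<beta>) * \<beta>'" using inv by simp
  qed
  then have N: "q < rk N" using rel_low[OF rel] p by simp
  have "(trunc (vdim U) - \<alpha> * \<alpha>') * N = 0"
  proof (rule rel_annihilate(1)[OF rel N])
    show "(trunc (vdim U) - \<alpha> * \<alpha>') * trunc (vdim U) = trunc (vdim U) - \<alpha> * \<alpha>'"
      using inv(1) by (simp add: left_diff_distrib mult.assoc HomD)
    have "\<alpha> * \<alpha>' * (\<alpha> * \<beta>) = \<alpha> * (\<alpha>' * \<alpha>) * \<beta>" by (simp only: mult.assoc)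
    then show "(trunc (vdim U) - \<alpha> * \<alpha>') * (\<alpha> * \<beta>) = 0"
      using inv(3) h by (simp add: left_diff_distrib HomD HomD_left_commute)
  qed
  then have 1: "\<alpha> * \<alpha>' * N = N" using d(4) by (simp add: left_diff_distrib HomD)
  have "N * (trunc (vdim W) - \<beta>' * \<beta>) = 0"
  proof (rule rel_annihilate(2)[OF rel N])
    show "trunc (vdim W) * (trunc (vdim W) - \<beta>' * \<beta>) = trunc (vdim W) - \<beta>' * \<beta>"
      using inv(2) by (simp add: right_diff_distrib HomD_left_commute)
    have "\<alpha> * \<beta> * (\<beta>' * \<beta>) = \<alpha> * (\<beta> * \<beta>') * \<beta>" by (simp only: mult.assoc)
    then show "\<alpha> * \<beta> * (trunc (vdim W) - \<beta>' * \<beta>) = 0"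
      using inv(4) h by (simp add: right_diff_distrib HomD HomD_left_commute mult.assoc)
  qed
  then have 2: "N * \<beta>' * \<beta> = N" using d(4) by (simp add: right_diff_distrib HomD mult.assoc)
  have "\<alpha> * (\<alpha>' * N * \<beta>') * \<beta> = \<alpha> * \<alpha>' * (N * \<beta>' * \<beta>)" by (simp only: mult.assoc)
  then show ?thesis using 1 2 by simp
qed

lemma rel_rank_le: assumes "rel U W M N" "q < rk M" shows "rk N \<le> rk M"
proof -
  note d = relD[OF assms(1)]
  define p where "p = rk M"
  obtain \<alpha> \<beta> \<alpha>' \<beta>' where f: "\<alpha> \<in> Hom (vdim U) p" "\<beta> \<in> Hom p (vdim W)"
    "\<alpha>' \<in> Hom p (vdim U)" "\<beta>' \<in> Hom (vdim W) p" "M = \<alpha> * \<beta>" "\<alpha>' * \<alpha> = trunc p" "\<beta> * \<beta>' = trunc p"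
    using rk_factorE[OF d(3)] unfolding p_def by metis
  have "N = \<alpha> * (\<alpha>' * N * \<beta>') * \<beta>"
    by (rule rel_sandwich[OF assms(1)[unfolded f(5)] f(1-4,6,7)]) (use assms(2) in \<open>simp add: p_def\<close>)
  then have "N = \<alpha> * trunc p * ((\<alpha>' * N * \<beta>') * \<beta>)" using f(1) by (simp add: HomD mult.assoc)
  then show ?thesis unfolding p_def by (rule rk_le)
qed

lemma rel_rank_eq: "rel U W M N \<Longrightarrow> q < rk M \<Longrightarrow> rk N = rk M"
  using rel_rank_le rel_sym rel_low by (metis antisym leI not_le)

text \<open>Let a be the first q + 1 rows of an invertible \<open>P\<close> and f the last column of
  its inverse. Since q + 1 < p, \<open>a * f = 0\<close>, and the kernel argument turns this into
  \<open>a * G * f = 0\<close>, whose first entry is the corner entry of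
  \<open>P * G * P'\<close>.\<close>

lemma rel_scalar:
  assumes rel: "rel U W (\<alpha> * \<beta>) (\<alpha> * G * \<beta>)" and h: "\<alpha> \<in> Hom (vdim U) p" "\<beta> \<in> Hom p (vdim W)"
    and inv: "\<alpha>' \<in> Hom p (vdim U)" "\<beta>' \<in> Hom (vdim W) p" "\<alpha>' * \<alpha> = trunc p" "\<beta> * \<beta>' = trunc p"
    and G: "G \<in> invops p" and p: "q + 1 < p"
  shows "\<exists>c. G = scale c (trunc p)"
proof (rule scalar_if_conjugate_entries_0)
  show Gh: "G \<in> Hom p p" using G by (auto simp: invops_def)
  obtain G' where G': "G' \<in> Hom p p" "G * G' = trunc p" using G by (auto elim: invopsE)
  show "2 \<le> p" using p by simp
  fix P P' :: "'a linop" assume P: "P \<in> Hom p p" "P' \<in> Hom p p" "P * P' = trunc p"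
  note d = relD[OF rel]
  have pU: "p \<le> vdim U"
  proof -
    have "trunc p = \<alpha>' * trunc (vdim U) * \<alpha>" using inv(1,3) by (simp add: HomD)
    then show ?thesis by (rule trunc_factor_le)
  qed
  define a where "a = trunc (q + 1) * P"
  have "a \<in> Hom (q + 1) p" unfolding a_def by (rule Hom_mult[OF trunc_in_Hom P(1)]) auto
  then have aa: "a * \<alpha>' \<in> Hom (q + 1) (vdim U)" using inv(1) by (rule Hom_mult)
  then have hA: "a * \<alpha>' \<in> Hom (vdim U) (vdim U)" using pU p by (auto intro: Hom_mono)
  have rA: "enat (rk (a * \<alpha>')) \<le> r" using rk_Hom_le(1)[OF aa] Suc_q_le by (rule rk_trans_le)
  have aE: "a * trunc p = a" "a * (trunc p * X) = a * X" for X using P(1) by (simp_all add: a_def mult.assoc HomD HomD_left_commute)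
  have rel': "rel U W (a * \<alpha>' * (\<alpha> * \<beta>)) (a * \<alpha>' * (\<alpha> * G * \<beta>))"
    by (rule rel_left[OF rel d(1) hA rA])
  have "a * \<alpha>' * (\<alpha> * \<beta>) = a * (\<alpha>' * \<alpha>) * \<beta>" "a * \<alpha>' * (\<alpha> * G * \<beta>) = a * (\<alpha>' * \<alpha>) * G * \<beta>"
    by (simp_all only: mult.assoc)
  then have e: "a * \<alpha>' * (\<alpha> * \<beta>) = a * \<beta>" "a * \<alpha>' * (\<alpha> * G * \<beta>) = a * G * \<beta>"
    using inv(3) aE by simp_all
  note rel'' = rel'[unfolded e]
  \<comment> \<open>This product recovers \<open>trunc (q + 1)\<close>, so
    \<open>a * G * \<beta>\<close> lies outside the zero class, as the kernel lemma
    requires.\<close>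
  have "a * G * \<beta> * (\<beta>' * G' * P') = a * (G * (\<beta> * \<beta>') * G') * P'" by (simp only: mult.assoc)
  also have "\<dots> = a * P'" using inv(4) Gh G' aE by (simp add: HomD mult.assoc)
  also have "\<dots> = trunc (q + 1) * trunc p" using P(3) by (simp add: a_def mult.assoc)
  also have "\<dots> = trunc (q + 1)" using p by (simp add: min_def)
  finally have "q + 1 \<le> rk (a * G * \<beta>)"
    using rk_mult_le(2)[OF relD(4)[OF rel''], of "\<beta>' * G' * P'"] rk_trunc[of "q + 1"] by simp
  then have rN: "q < rk (a * G * \<beta>)" by simp
  define f where "f = P' * munit (p - 1) 0"
  have f: "f \<in> Hom p 1" unfolding f_def by (rule Hom_mult[OF P(2) munit_in_Hom]) (use p in auto)
  have "a * \<beta> * (\<beta>' * f) = a * (\<beta> * \<beta>') * f" by (simp only: mult.assoc)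
  also have "\<dots> = trunc (q + 1) * (P * P' * munit (p - 1) 0)" using inv(4) aE by (simp add: a_def f_def mult.assoc)
  also have "\<dots> = 0" using P(3) p by (auto simp: trunc_mult_munit)
  finally have "a * G * \<beta> * (\<beta>' * f) = 0"
    by (rule rel_right_kernel[OF rel'' rN Hom_mult[OF inv(2) f]])
  moreover have "a * G * \<beta> * (\<beta>' * f) = a * G * (\<beta> * \<beta>') * f" by (simp only: mult.assoc)
  ultimately have "a * G * f = 0" using inv(4) Gh by (simp add: HomD mult.assoc)
  then have "entry (trunc (q + 1) * (P * G * P') * munit (p - 1) 0) 0 0 = 0"
    by (simp add: a_def f_def mult.assoc)
  then show "entry (P * G * P') 0 (p - 1) = 0" by (simp add: entry_mult_munit entry_trunc_mult)
qed

end

subsection \<open>The relations \<open>R\<^sub>I\<^sub>,\<^sub>N\<close> in coordinates\<close>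

lemma rk_sandwich_invops:
  assumes h: "\<alpha> \<in> Hom n p" "\<beta> \<in> Hom p m" "rk (\<alpha> * \<beta>) = p" and G: "G \<in> invops p"
  shows "rk (\<alpha> * G * \<beta>) = p"
proof -
  obtain \<alpha>' \<beta>' where inv: "\<alpha>' \<in> Hom p n" "\<beta>' \<in> Hom m p" "\<alpha>' * \<alpha> = trunc p" "\<beta> * \<beta>' = trunc p"
    using factor_inverses[OF h] by blast
  obtain G' where G': "G \<in> Hom p p" "G' \<in> Hom p p" "G * G' = trunc p" using G by (auto elim: invopsE)
  show ?thesis
  proof (rule rk_eqI[of _ \<alpha> _ "G * \<beta>" \<alpha>' "\<beta>' * G'"])
    show "\<alpha> * G * \<beta> = \<alpha> * trunc p * (G * \<beta>)" using h by (simp add: HomD mult.assoc)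
    have "\<alpha>' * (\<alpha> * G * \<beta>) * (\<beta>' * G') = (\<alpha>' * \<alpha>) * G * (\<beta> * \<beta>') * G'" by (simp only: mult.assoc)
    also have "\<dots> = trunc p" using inv G' by (simp add: HomD)
    finally show "trunc p = \<alpha>' * (\<alpha> * G * \<beta>) * (\<beta>' * G')" by simp
  qed
qed

lemma rk_scale_le: "M \<in> Hom n m \<Longrightarrow> rk (scale c M) \<le> rk M"
  using rk_mult_le(1)[of M n m "scale c 1"] by simp

lemma congruenceI:
  assumes "equiv S \<sigma>" "\<sigma> \<subseteq> nabla S"
    and "\<And>x y a. (x, y) \<in> \<sigma> \<Longrightarrow> a \<in> S \<Longrightarrow> mran a = mdom x \<Longrightarrow> (a \<cdot>\<^sub>L x, a \<cdot>\<^sub>L y) \<in> \<sigma>"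
    and "\<And>x y a. (x, y) \<in> \<sigma> \<Longrightarrow> a \<in> S \<Longrightarrow> mran x = mdom a \<Longrightarrow> (x \<cdot>\<^sub>L a, y \<cdot>\<^sub>L a) \<in> \<sigma>"
  shows "congruence S \<sigma>"
  unfolding congruence_def using assms by (intro conjI) (simp_all add: split_beta)

locale rees_data = fin_vs_set C for C :: "('a::field, 'b) module set" +
  fixes V :: "nat \<Rightarrow> ('a, 'b) module" and B :: "nat \<Rightarrow> 'b list" and r :: enat
  assumes VB: "\<And>q. enat q < xi C \<Longrightarrow> V q \<in> C \<and> q \<le> vdim (V q) \<and> ordered_basis (V q) (B q)"
    and r_xi: "r < xi C \<or> (r = \<infinity> \<and> xi C = \<infinity>)"
begin

text \<open>A finite p <= r lies below \<open>xi C\<close> also when \<open>r = \<infinity>\<close>,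
  so the data \<open>V p\<close> and \<open>B p\<close> are available at every index in use.\<close>

lemma V_C: "enat p \<le> r \<Longrightarrow> V p \<in> C"
  and V_dim: "enat p \<le> r \<Longrightarrow> p \<le> vdim (V p)"
  and V_basis: "enat p \<le> r \<Longrightarrow> ordered_basis (V p) (B p)"
proof -
  assume "enat p \<le> r"
  then have "enat p < xi C" using r_xi by (auto intro: le_less_trans)
  then show "V p \<in> C" "p \<le> vdim (V p)" "ordered_basis (V p) (B p)" using VB by auto
qed

text \<open>\<open>coords p (\<kappa>, \<iota>)\<close> says that \<open>\<iota>\<close> embeds \<open>F\<^sup>p\<close> into \<open>V p\<close> with retraction \<open>\<kappa>\<close>, compatibly with
  \<open>A \<mapsto> A\<^sup>\<natural>\<close>; the chosen basis of \<open>V p\<close> need not be \<open>B p\<close>, and the same space may serve for several \<open>p\<close>.\<close>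

definition coords :: "nat \<Rightarrow> 'a linop \<times> 'a linop \<Rightarrow> bool" where
  "coords p x \<longleftrightarrow> fst x \<in> Hom (vdim (V p)) p \<and> snd x \<in> Hom p (vdim (V p)) \<and> snd x * fst x = trunc p \<and>
    (\<forall>A\<in>carrier_mat p p. natural_map (V p) (B p) A = mor (V p) (fst x * op_of_mat A * snd x) (V p))"

definition proj where "proj p = fst (SOME x. coords p x)"
definition incl where "incl p = snd (SOME x. coords p x)"

lemma coords_exists:
  assumes p: "enat p \<le> r" shows "\<exists>x. coords p x"
proof -
  let ?n = "vdim (V p)"
  note V = V_C[OF p] V_dim[OF p] V_basis[OF p]
  interpret vectorspace class_ring "V p" using C_vs V(1) by blast
  have b: "based_space (V p) (B p)" by unfold_locales (rule V(3))
  have b': "based_space (V p) (chosen_basis (V p))" "length (chosen_basis (V p)) = ?n" using based_chosen_basis V(1) by auto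
  obtain P P' where P: "P \<in> Hom ?n ?n" "P' \<in> Hom ?n ?n" "P * P' = trunc ?n" "length (B p) = ?n"
    "\<And>M. M \<in> Hom ?n ?n \<Longrightarrow> coord_mor (V p) (B p) M (V p) (B p) = coord_mor (V p) (chosen_basis (V p)) (P * M * P') (V p) (chosen_basis (V p))"
    using change_of_basis[OF b b'(1)] unfolding b'(2) by metis
  have P'P: "P' * P = trunc ?n" using P Hom_one_sided_inverse by blast
  \<comment> \<open>Projection to and inclusion of the first p coordinates with respect to
    \<open>B p\<close>, rewritten in the chosen basis. The truncations are absorbed by the p by p
    matrix A.\<close>
  have "coords p (P * trunc p, trunc p * P')" unfolding coords_def fst_conv snd_conv
  proof (intro conjI ballI)
    show "P * trunc p \<in> Hom ?n p" "trunc p * P' \<in> Hom p ?n"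
      by (rule Hom_mult[OF P(1) trunc_in_Hom[OF order_refl order_refl]],
          rule Hom_mult[OF trunc_in_Hom[OF order_refl order_refl] P(2)])
    have "trunc p * P' * (P * trunc p) = trunc p * (P' * P) * trunc p" by (simp only: mult.assoc)
    then show "trunc p * P' * (P * trunc p) = trunc p" using P'P V(2) by (simp add: min_def)
    fix A :: "'a mat" assume A: "A \<in> carrier_mat p p"
    have t: "op_of_mat A \<in> Hom ?n ?n" by (rule Hom_mono[OF op_of_mat_in_Hom[OF A]]) (rule V(2))+
    have "natural_map (V p) (B p) A = coord_mor (V p) (B p) (op_of_mat A) (V p) (B p)"
      by (rule natural_map_coord_mor[OF b A]) (use V P in simp)
    also have "\<dots> = mor (V p) (P * op_of_mat A * P') (V p)" unfolding mor_def by (rule P(5)[OF t])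
    also have "P * op_of_mat A * P' = P * trunc p * op_of_mat A * (trunc p * P')"
      using op_of_mat_in_Hom[OF A] by (simp add: mult.assoc HomD_left_commute)
    finally show "natural_map (V p) (B p) A = mor (V p) (P * trunc p * op_of_mat A * (trunc p * P')) (V p)" .
  qed
  then show ?thesis by blast
qed

lemma proj_incl:
  assumes "enat p \<le> r"
  shows "proj p \<in> Hom (vdim (V p)) p" "incl p \<in> Hom p (vdim (V p))" "incl p * proj p = trunc p"
    "A \<in> carrier_mat p p \<Longrightarrow> natural_map (V p) (B p) A = mor (V p) (proj p * op_of_mat A * incl p) (V p)"
proof -
  have "coords p (proj p, incl p)"
    unfolding proj_def incl_def prod.collapse by (rule someI_ex[OF coords_exists[OF assms]])
  then show "proj p \<in> Hom (vdim (V p)) p" "incl p \<in> Hom p (vdim (V p))" "incl p * proj p = trunc p"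
    "A \<in> carrier_mat p p \<Longrightarrow> natural_map (V p) (B p) A = mor (V p) (proj p * op_of_mat A * incl p) (V p)"
    unfolding coords_def by simp_all
qed

lemma incl_proj: "enat p \<le> r \<Longrightarrow> incl p * (proj p * X) = trunc p * X"
  using proj_incl(3)[of p] by (simp flip: mult.assoc)

text \<open>The coordinate form of \<open>nu\<close>: x and y with their multipliers are replaced by
  one factorization through \<open>F^p\<close> and one group element. Only the rank of M is
  required; that of M' follows as G is invertible.\<close>

definition nurel :: "nat \<Rightarrow> 'a linop set \<Rightarrow> ('a, 'b) module \<Rightarrow> ('a, 'b) module \<Rightarrow> 'a linop \<Rightarrow> 'a linop \<Rightarrow> bool"
  where
  "nurel p \<G> U W M M' \<longleftrightarrow> (\<exists>\<alpha>\<in>Hom (vdim U) p. \<exists>\<beta>\<in>Hom p (vdim W). \<exists>G\<in>\<G>.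
    rk M = p \<and> M = \<alpha> * \<beta> \<and> M' = \<alpha> * G * \<beta>)"

lemma nurelE:
  assumes "nurel p \<G> U W M M'"
  obtains \<alpha> \<beta> G where "\<alpha> \<in> Hom (vdim U) p" "\<beta> \<in> Hom p (vdim W)" "G \<in> \<G>" "rk M = p" "M = \<alpha> * \<beta>" "M' = \<alpha> * G * \<beta>"
  using assms unfolding nurel_def by blast

lemma nurelI:
  "\<alpha> \<in> Hom (vdim U) p \<Longrightarrow> \<beta> \<in> Hom p (vdim W) \<Longrightarrow> G \<in> \<G> \<Longrightarrow> rk M = p \<Longrightarrow> M = \<alpha> * \<beta> \<Longrightarrow>
    M' = \<alpha> * G * \<beta> \<Longrightarrow> nurel p \<G> U W M M'"
  unfolding nurel_def by blast

lemma
  assumes "normal_ops p \<G>" "nurel p \<G> U W M M'"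
  shows nurel_rk: "rk M = p" "rk M' = p"
    and nurel_Hom: "M \<in> Hom (vdim U) (vdim W)" "M' \<in> Hom (vdim U) (vdim W)"
proof -
  obtain \<alpha> \<beta> G where *: "\<alpha> \<in> Hom (vdim U) p" "\<beta> \<in> Hom p (vdim W)" "G \<in> \<G>" "rk M = p" "M = \<alpha> * \<beta>" "M' = \<alpha> * G * \<beta>"
    using assms(2) by (rule nurelE)
  have G: "G \<in> invops p" using normal_opsD(1)[OF assms(1)] *(3) by blast
  then have Gh: "G \<in> Hom p p" by (simp add: invops_def)
  show "rk M = p" by (rule *(4))
  show "rk M' = p" using rk_sandwich_invops[OF *(1,2) _ G] *(4-6) by simp
  show "M \<in> Hom (vdim U) (vdim W)" unfolding *(5) by (rule Hom_mult[OF *(1,2)])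
  show "M' \<in> Hom (vdim U) (vdim W)" unfolding *(6) by (rule Hom_mult[OF Hom_mult[OF *(1) Gh] *(2)])
qed

lemma nurel_refl:
  assumes "normal_ops p \<G>" "M \<in> Hom (vdim U) (vdim W)" "rk M = p" shows "nurel p \<G> U W M M"
proof -
  obtain \<alpha> \<beta> where "\<alpha> \<in> Hom (vdim U) p" "\<beta> \<in> Hom p (vdim W)" "M = \<alpha> * \<beta>"
    using rk_factorE[OF assms(2)] assms(3) by metis
  then show ?thesis using normal_opsD(2)[OF assms(1)] assms(3) by (intro nurelI[of \<alpha> _ _ \<beta> _ "trunc p"]) (auto simp: HomD)
qed

lemma nurel_sym:
  assumes \<G>: "normal_ops p \<G>" and n: "nurel p \<G> U W M M'" shows "nurel p \<G> U W M' M"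
proof -
  obtain \<alpha> \<beta> G where *: "\<alpha> \<in> Hom (vdim U) p" "\<beta> \<in> Hom p (vdim W)" "G \<in> \<G>" "rk M = p" "M = \<alpha> * \<beta>" "M' = \<alpha> * G * \<beta>"
    using n by (rule nurelE)
  have "G \<in> invops p" using normal_opsD(1)[OF \<G>] *(3) by blast
  then obtain G' where G': "G \<in> Hom p p" "G' \<in> Hom p p" "G * G' = trunc p" "G' * G = trunc p" by (auto elim: invopsE)
  have G'\<G>: "G' \<in> \<G>" by (rule normal_opsD(4)[OF \<G> *(3) G'(2,3)])
  show ?thesis
  proof (rule nurelI[OF Hom_mult[OF *(1) G'(1)] *(2) G'\<G> nurel_rk(2)[OF \<G> n] *(6)])
    have "\<alpha> * G * G' * \<beta> = \<alpha> * (G * G') * \<beta>" by (simp only: mult.assoc)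
    then show "M = \<alpha> * G * G' * \<beta>" using G' * by (simp add: HomD)
  qed
qed

text \<open>Normality enters here. The two factorizations of \<open>M'\<close> differ by an
  invertible \<open>P\<close>, so the second group element K has to be conjugated to
  \<open>P * K * P'\<close> before it can be multiplied with G.\<close>

lemma nurel_trans:
  assumes \<G>: "normal_ops p \<G>" and n: "nurel p \<G> U W M M'" "nurel p \<G> U W M' M''" shows "nurel p \<G> U W M M''"
proof -
  obtain \<alpha> \<beta> G where *: "\<alpha> \<in> Hom (vdim U) p" "\<beta> \<in> Hom p (vdim W)" "G \<in> \<G>" "rk M = p" "M = \<alpha> * \<beta>" "M' = \<alpha> * G * \<beta>"
    using n(1) by (rule nurelE)
  obtain \<gamma> \<delta> K where k: "\<gamma> \<in> Hom (vdim U) p" "\<delta> \<in> Hom p (vdim W)" "K \<in> \<G>" "rk M' = p" "M' = \<gamma> * \<delta>" "M'' = \<gamma> * K * \<delta>"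
    using n(2) by (rule nurelE)
  have G: "G \<in> Hom p p" using normal_opsD(1)[OF \<G>] *(3) by (auto simp: invops_def)
  obtain P P' where P: "P \<in> Hom p p" "P' \<in> Hom p p" "P * P' = trunc p" "\<gamma> = \<alpha> * G * P" "\<delta> = P' * \<beta>"
    using factor_unique[OF Hom_mult[OF *(1) G] *(2) k(1,2)] *(6) k(4,5) by metis
  have "G * (P * K * P') \<in> \<G>" by (rule normal_opsD(3)[OF \<G> *(3) normal_opsD(5)[OF \<G> k(3) P(1,2,3)]])
  then show ?thesis
    by (rule nurelI[OF *(1,2) _ *(4,5)]) (simp only: k(6) P(4,5) mult.assoc)
qed

text \<open>In one direction the multipliers and the first group element are merged into \<alpha>
  and \<beta>; in the other, \<alpha> and \<beta> are turned into multipliers around the image of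
  the identity matrix.\<close>

lemma nu_iff:
  assumes p: "enat p \<le> r" and N: "N \<subseteq> carrier_mat p p" "normal_ops p (op_of_mat ` N)"
  shows "(x, y) \<in> nu C p (natural_map (V p) (B p) ` N) \<longleftrightarrow>
    (\<exists>U\<in>C. \<exists>W\<in>C. \<exists>M M'. nurel p (op_of_mat ` N) U W M M' \<and> x = mor U M W \<and> y = mor U M' W)"
proof
  note ki = proj_incl[OF p] and V = V_C[OF p]
  assume "(x, y) \<in> nu C p (natural_map (V p) (B p) ` N)"
  then obtain x0 y0 a b where *: "x = a \<cdot>\<^sub>L x0 \<cdot>\<^sub>L b" "y = a \<cdot>\<^sub>L y0 \<cdot>\<^sub>L b"
    "x0 \<in> natural_map (V p) (B p) ` N" "y0 \<in> natural_map (V p) (B p) ` N" "a \<in> lin_cat C" "b \<in> lin_cat C"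
    "mran a = mdom x0" "mran x0 = mdom b" "x \<in> Dclass C p"
    unfolding nu_def mem_Collect_eq prod.inject by metis
  obtain A where A: "x0 = natural_map (V p) (B p) A" "A \<in> N" using *(3) by (rule imageE)
  obtain A' where A': "y0 = natural_map (V p) (B p) A'" "A' \<in> N" using *(4) by (rule imageE)
  have Ac: "A \<in> carrier_mat p p" "A' \<in> carrier_mat p p" using A A' N by auto
  have x0: "x0 = mor (V p) (proj p * op_of_mat A * incl p) (V p)" using A ki(4) Ac by simp
  have y0: "y0 = mor (V p) (proj p * op_of_mat A' * incl p) (V p)" using A' ki(4) Ac by simp
  obtain U W1 Ma where a: "U \<in> C" "W1 \<in> C" "Ma \<in> Hom (vdim U) (vdim W1)" "a = mor U Ma W1"
    using *(5) by (rule lin_catE)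
  obtain U1 W Mb where b: "U1 \<in> C" "W \<in> C" "Mb \<in> Hom (vdim U1) (vdim W)" "b = mor U1 Mb W"
    using *(6) by (rule lin_catE)
  have e: "W1 = V p" "U1 = V p" using *(7,8) x0 a b by auto
  \<comment> \<open>A is absorbed into \<alpha>, so that x is \<open>\<alpha> * \<beta>\<close> and
    y arises by inserting the inverse of A times A'.\<close>
  define \<alpha> \<beta> where "\<alpha> = Ma * proj p * op_of_mat A" and "\<beta> = incl p * Mb"
  have kh: "proj p * op_of_mat Z * incl p \<in> Hom (vdim (V p)) (vdim (V p))" if "Z \<in> carrier_mat p p" for Z
    by (rule Hom_mult[OF Hom_mult[OF ki(1) op_of_mat_in_Hom[OF that]] ki(2)])
  have Mah: "Ma \<in> Hom (vdim U) (vdim (V p))" using a e by simp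
  have comp: "a \<cdot>\<^sub>L mor (V p) (proj p * op_of_mat Z * incl p) (V p) \<cdot>\<^sub>L b = mor U (Ma * proj p * op_of_mat Z * \<beta>) W"
    if "Z \<in> carrier_mat p p" for Z
    unfolding a(4) b(4) e \<beta>_def
    using mor_comp[OF a(1) V V Mah] mor_comp[OF a(1) V b(2) Hom_mult[OF Mah kh[OF that]]]
    by (simp add: mult.assoc)
  have xm: "x = mor U (\<alpha> * \<beta>) W" using comp[OF Ac(1)] *(1) x0 by (simp add: \<alpha>_def)
  have h: "\<alpha> \<in> Hom (vdim U) p" "\<beta> \<in> Hom p (vdim W)"
    unfolding \<alpha>_def \<beta>_def using Hom_mult[OF Hom_mult[OF Mah ki(1)] op_of_mat_in_Hom[OF Ac(1)]] Hom_mult[OF ki(2)] b(3) e by auto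
  have rk: "rk (\<alpha> * \<beta>) = p"
    using *(9) mrank_mor[OF a(1) b(2) Hom_mult[OF h]] xm by (simp add: Dclass_def)
  have "op_of_mat A \<in> invops p" using normal_opsD(1)[OF N(2)] A by blast
  then obtain G' where G': "G' \<in> Hom p p" "op_of_mat A * G' = trunc p" by (auto elim: invopsE)
  have G'N: "G' \<in> op_of_mat ` N" by (rule normal_opsD(4)[OF N(2) imageI[OF A(2)] G'])
  have GN: "G' * op_of_mat A' \<in> op_of_mat ` N" by (rule normal_opsD(3)[OF N(2) G'N imageI[OF A'(2)]])
  have "\<alpha> * (G' * op_of_mat A') * \<beta> = Ma * proj p * (op_of_mat A * G') * op_of_mat A' * \<beta>" by (simp only: \<alpha>_def mult.assoc)
  also have "\<dots> = Ma * proj p * op_of_mat A' * \<beta>" using G'(2) op_of_mat_in_Hom[OF Ac(2)] by (simp add: HomD mult.assoc)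
  finally have "y = mor U (\<alpha> * (G' * op_of_mat A') * \<beta>) W" using comp[OF Ac(2)] *(2) y0 by simp
  moreover have "nurel p (op_of_mat ` N) U W (\<alpha> * \<beta>) (\<alpha> * (G' * op_of_mat A') * \<beta>)"
    by (rule nurelI[OF h GN rk refl refl])
  ultimately show "\<exists>U\<in>C. \<exists>W\<in>C. \<exists>M M'. nurel p (op_of_mat ` N) U W M M' \<and> x = mor U M W \<and> y = mor U M' W"
    using xm a(1) b(2) by blast
next
  note ki = proj_incl[OF p] and V = V_C[OF p]
  assume "\<exists>U\<in>C. \<exists>W\<in>C. \<exists>M M'. nurel p (op_of_mat ` N) U W M M' \<and> x = mor U M W \<and> y = mor U M' W"
  then obtain U W M M' where UW: "U \<in> C" "W \<in> C" "nurel p (op_of_mat ` N) U W M M'" "x = mor U M W" "y = mor U M' W"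
    by blast
  obtain \<alpha> \<beta> G where *: "\<alpha> \<in> Hom (vdim U) p" "\<beta> \<in> Hom p (vdim W)" "G \<in> op_of_mat ` N" "rk M = p" "M = \<alpha> * \<beta>" "M' = \<alpha> * G * \<beta>"
    using UW(3) by (rule nurelE)
  obtain A where A: "G = op_of_mat A" "A \<in> N" using *(3) by (rule imageE)
  obtain I where I: "trunc p = op_of_mat I" "I \<in> N" using normal_opsD(2)[OF N(2)] by (rule imageE)
  have c: "A \<in> carrier_mat p p" "I \<in> carrier_mat p p" using A I N by auto
  \<comment> \<open>Both multipliers pass through \<open>V p\<close>; in the composites
    \<open>incl p * proj p\<close> cancels on either side of the group element.\<close>
  define a b where "a = mor U (\<alpha> * incl p) (V p)" and "b = mor (V p) (proj p * \<beta>) W"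
  have ah: "\<alpha> * incl p \<in> Hom (vdim U) (vdim (V p))" by (rule Hom_mult[OF *(1) ki(2)])
  have kh: "proj p * op_of_mat Z * incl p \<in> Hom (vdim (V p)) (vdim (V p))" if "Z \<in> carrier_mat p p" for Z
    by (rule Hom_mult[OF Hom_mult[OF ki(1) op_of_mat_in_Hom[OF that]] ki(2)])
  have comp: "a \<cdot>\<^sub>L natural_map (V p) (B p) Z \<cdot>\<^sub>L b = mor U (\<alpha> * op_of_mat Z * \<beta>) W" if Z: "Z \<in> carrier_mat p p" for Z
  proof -
    have "a \<cdot>\<^sub>L natural_map (V p) (B p) Z \<cdot>\<^sub>L b =
        mor U (\<alpha> * incl p * (proj p * op_of_mat Z * incl p) * (proj p * \<beta>)) W"
      unfolding a_def b_def ki(4)[OF Z]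
      using mor_comp[OF UW(1) V V ah] mor_comp[OF UW(1) V UW(2) Hom_mult[OF ah kh[OF Z]]] by simp
    also have "\<alpha> * incl p * (proj p * op_of_mat Z * incl p) * (proj p * \<beta>) = \<alpha> * op_of_mat Z * \<beta>"
      using *(1) op_of_mat_in_Hom[OF Z] by (simp add: mult.assoc incl_proj[OF p] HomD_left_commute)
    finally show ?thesis .
  qed
  have x: "a \<cdot>\<^sub>L natural_map (V p) (B p) I \<cdot>\<^sub>L b = x"
    using comp[OF c(2)] UW(4) *(1,5) I(1) by (metis HomD(2))
  have y: "a \<cdot>\<^sub>L natural_map (V p) (B p) A \<cdot>\<^sub>L b = y"
    using comp[OF c(1)] UW(5) *(6) A(1) by simp
  have "x \<in> Dclass C p" "y \<in> Dclass C p"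
    using UW nurel_rk[OF N(2) UW(3)] nurel_Hom[OF N(2) UW(3)] mor_in mrank_mor by (auto simp: Dclass_def)
  moreover have "a \<in> lin_cat C" "b \<in> lin_cat C" unfolding a_def b_def using mor_in UW V by auto
  moreover have "mran a = V p" "mdom b = V p" by (simp_all add: a_def b_def)
  moreover have "mdom (natural_map (V p) (B p) Z) = V p" "mran (natural_map (V p) (B p) Z) = V p" for Z
    by (simp_all add: natural_map_def)
  ultimately show "(x, y) \<in> nu C p (natural_map (V p) (B p) ` N)"
    unfolding nu_def using x y A(2) I(2)
    by (intro CollectI exI[of _ "natural_map (V p) (B p) I"] exI[of _ "natural_map (V p) (B p) A"]
        exI[of _ a] exI[of _ b] conjI imageI) simp_all
qed

definition rees_rel :: "nat \<Rightarrow> (nat \<Rightarrow> 'a linop set) \<Rightarrow> ('a, 'b) module \<Rightarrow> ('a, 'b) module \<Rightarrow>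
    'a linop \<Rightarrow> 'a linop \<Rightarrow> bool" where
  "rees_rel q \<G> U W M M' \<longleftrightarrow> U \<in> C \<and> W \<in> C \<and> M \<in> Hom (vdim U) (vdim W) \<and> M' \<in> Hom (vdim U) (vdim W) \<and>
    enat (rk M) \<le> r \<and> enat (rk M') \<le> r \<and>
    (rk M \<le> q \<and> rk M' \<le> q \<or> (\<exists>p. q < p \<and> enat p \<le> r \<and> nurel p (\<G> p) U W M M'))"

text \<open>The diagonal part of \<open>rees\<close> needs no clause of its own: at rank at most q
  it lies in \<open>nabla\<close>, and above q it is reflexivity of \<open>nurel\<close> at the rank
  of the map.\<close>

lemma rees_N_eq:
  assumes q: "enat q \<le> r"
    and N: "\<And>p. q < p \<Longrightarrow> enat p \<le> r \<Longrightarrow> N p \<subseteq> carrier_mat p p \<and> normal_ops p (op_of_mat ` N p)"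
  shows "rees_N C V B r q N = {(mor U M W, mor U M' W) | U W M M'. rees_rel q (\<lambda>p. op_of_mat ` N p) U W M M'}"
    (is "_ = ?S")
proof (intro equalityI subsetI)
  fix z assume z: "z \<in> rees_N C V B r q N"
  obtain x y where xy: "z = (x, y)" by (cases z)
  consider (low) "x \<in> rank_ideal C (enat q)" "y \<in> rank_ideal C (enat q)" "mdom x = mdom y" "mran x = mran y"
    | (id) "x = y" "x \<in> rank_ideal C r"
    | (nu) p where "q < p" "enat p \<le> r" "(x, y) \<in> nu C p (natural_map (V p) (B p) ` N p)"
    using z unfolding xy rees_N_def rees_def nabla_def by (auto simp: Suc_le_eq)
  then show "z \<in> ?S"
  proof cases
    case low
    obtain U W M where x: "U \<in> C" "W \<in> C" "M \<in> Hom (vdim U) (vdim W)" "enat (rk M) \<le> enat q" "x = mor U M W"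
      using low(1) by (rule rank_idealE)
    obtain U' W' M' where y: "U' \<in> C" "W' \<in> C" "M' \<in> Hom (vdim U') (vdim W')" "enat (rk M') \<le> enat q" "y = mor U' M' W'"
      using low(2) by (rule rank_idealE)
    have e: "U' = U" "W' = W" using low x y by auto
    have "rees_rel q (\<lambda>p. op_of_mat ` N p) U W M M'" unfolding rees_rel_def using x y e q by (auto intro: rk_trans_le)
    then show ?thesis using x(5) y(5) e xy by blast
  next
    case id
    obtain U W M where x: "U \<in> C" "W \<in> C" "M \<in> Hom (vdim U) (vdim W)" "enat (rk M) \<le> r" "x = mor U M W"
      using id(2) by (rule rank_idealE)
    have "rk M \<le> q \<or> (\<exists>p. q < p \<and> enat p \<le> r \<and> nurel p (op_of_mat ` N p) U W M M)"
    proof (cases "rk M \<le> q")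
      case False
      then have "nurel (rk M) (op_of_mat ` N (rk M)) U W M M"
        using nurel_refl[OF _ x(3) refl] N[of "rk M"] x(4) by auto
      then show ?thesis using False x(4) by (auto intro!: exI[of _ "rk M"])
    qed simp
    then have "rees_rel q (\<lambda>p. op_of_mat ` N p) U W M M" unfolding rees_rel_def using x by auto
    then show ?thesis using x(5) id(1) xy by blast
  next
    case nu
    note n = N[OF nu(1,2)]
    obtain U W M M' where *: "U \<in> C" "W \<in> C" "nurel p (op_of_mat ` N p) U W M M'" "x = mor U M W" "y = mor U M' W"
      using nu(3) nu_iff[OF nu(2), of "N p" x y] n by blast
    have "rees_rel q (\<lambda>p. op_of_mat ` N p) U W M M'" unfolding rees_rel_def
      using * nurel_rk[OF conjunct2[OF n] *(3)] nurel_Hom[OF conjunct2[OF n] *(3)] nu by auto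
    then show ?thesis using *(4,5) xy by blast
  qed
next
  fix z assume "z \<in> ?S"
  then obtain U W M M' where z: "z = (mor U M W, mor U M' W)" and rees_rel: "rees_rel q (\<lambda>p. op_of_mat ` N p) U W M M'" by blast
  have h: "U \<in> C" "W \<in> C" "M \<in> Hom (vdim U) (vdim W)" "M' \<in> Hom (vdim U) (vdim W)"
    using rees_rel by (auto simp: rees_rel_def)
  have "rk M \<le> q \<and> rk M' \<le> q \<or> (\<exists>p. q < p \<and> enat p \<le> r \<and> nurel p (op_of_mat ` N p) U W M M')"
    using rees_rel by (auto simp: rees_rel_def)
  then show "z \<in> rees_N C V B r q N"
  proof
    assume "rk M \<le> q \<and> rk M' \<le> q"
    then have "z \<in> nabla (rank_ideal C (enat q))"
      using mor_rank_ideal[OF h(1,2,3)] mor_rank_ideal[OF h(1,2,4)] z by (simp add: nabla_def)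
    then show ?thesis by (simp add: rees_N_def rees_def)
  next
    assume "\<exists>p. q < p \<and> enat p \<le> r \<and> nurel p (op_of_mat ` N p) U W M M'"
    then obtain p where p: "q < p" "enat p \<le> r" "nurel p (op_of_mat ` N p) U W M M'" by blast
    have "z \<in> nu C p (natural_map (V p) (B p) ` N p)"
      unfolding z using nu_iff[OF p(2), of "N p"] N[OF p(1,2)] p(3) h(1,2) by blast
    then show ?thesis unfolding rees_N_def using p by (auto simp: Suc_le_eq)
  qed
qed

text \<open>\<open>scalar\<close> and \<open>chain\<close> answer the case in which a multiplication
  lowers the rank from some p > q + 1. In \<open>chain\<close> the value k = q + 1 is included,
  where the group need not consist of scalars.\<close>

lemma congruence_rees_rel:
  assumes q: "enat q < r"
    and \<G>: "\<And>p. q < p \<Longrightarrow> enat p \<le> r \<Longrightarrow> normal_ops p (\<G> p)"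
    and scalar: "\<And>p G. q + 1 < p \<Longrightarrow> enat p \<le> r \<Longrightarrow> G \<in> \<G> p \<Longrightarrow> \<exists>c. G = scale c (trunc p)"
    and chain: "\<And>p k c. q < k \<Longrightarrow> k < p \<Longrightarrow> enat p \<le> r \<Longrightarrow> scale c (trunc p) \<in> \<G> p \<Longrightarrow> scale c (trunc k) \<in> \<G> k"
  shows "congruence (rank_ideal C r) {(mor U M W, mor U M' W) | U W M M'. rees_rel q \<G> U W M M'}"
    (is "congruence _ ?S")
proof -
  have RI: "rees_rel q \<G> U W M M'" if "U \<in> C" "W \<in> C" "q < p" "enat p \<le> r" "nurel p (\<G> p) U W M M'" for U W M M' p
    unfolding rees_rel_def using that nurel_rk[OF \<G>[OF that(3,4)] that(5)] nurel_Hom[OF \<G>[OF that(3,4)] that(5)] by auto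
  have RD: "U \<in> C" "W \<in> C" "M \<in> Hom (vdim U) (vdim W)" "M' \<in> Hom (vdim U) (vdim W)"
    "enat (rk M) \<le> r" "enat (rk M') \<le> r" if "rees_rel q \<G> U W M M'" for U W M M'
    using that by (auto simp: rees_rel_def)
  have RE: thesis if "rees_rel q \<G> U W M M'" "rk M \<le> q \<Longrightarrow> rk M' \<le> q \<Longrightarrow> thesis"
    "\<And>p. q < p \<Longrightarrow> enat p \<le> r \<Longrightarrow> nurel p (\<G> p) U W M M' \<Longrightarrow> rk M = p \<Longrightarrow> rk M' = p \<Longrightarrow> thesis" for U W M M' thesis
    using that nurel_rk \<G> unfolding rees_rel_def by metis
  have mem: "rees_rel q \<G> U W M M'"
    if S: "(mor U M W, mor U M' W) \<in> ?S" and h: "U \<in> C" "W \<in> C" "M \<in> Hom (vdim U) (vdim W)" "M' \<in> Hom (vdim U) (vdim W)" for U W M M'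
  proof -
    obtain U1 W1 M1 M1' where *: "mor U M W = mor U1 M1 W1" "mor U M' W = mor U1 M1' W1" "rees_rel q \<G> U1 W1 M1 M1'"
      using S by blast
    have "U1 = U" "W1 = W" using mor_eqD[OF *(1)] by auto
    then show ?thesis using * RD[OF *(3)] mor_inject h by auto
  qed
  have Rrefl: "rees_rel q \<G> U W M M" if "U \<in> C" "W \<in> C" "M \<in> Hom (vdim U) (vdim W)" "enat (rk M) \<le> r" for U W M
    using that nurel_refl[OF \<G> that(3) refl] unfolding rees_rel_def by (metis not_le)
  have Rsym: "rees_rel q \<G> U W M' M" if "rees_rel q \<G> U W M M'" for U W M M'
    using that
  proof (rule RE)
    show "rk M \<le> q \<Longrightarrow> rk M' \<le> q \<Longrightarrow> rees_rel q \<G> U W M' M" using RD[OF that] by (auto simp: rees_rel_def)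
    show "q < p \<Longrightarrow> enat p \<le> r \<Longrightarrow> nurel p (\<G> p) U W M M' \<Longrightarrow> rees_rel q \<G> U W M' M" for p
      using RI[OF RD(1,2)[OF that], of p M' M] nurel_sym[OF \<G>, of p U W M M'] by blast
  qed
  have Rtrans: "rees_rel q \<G> U W M M''" if R1: "rees_rel q \<G> U W M M'" and R2: "rees_rel q \<G> U W M' M''" for U W M M' M''
    using R1
  proof (rule RE)
    assume l: "rk M \<le> q" "rk M' \<le> q"
    show ?thesis using R2
      by (rule RE) (use l RD[OF R1] RD[OF R2] in \<open>auto simp: rees_rel_def\<close>)
  next
    fix p assume p: "q < p" "enat p \<le> r" "nurel p (\<G> p) U W M M'" "rk M = p" "rk M' = p"
    show ?thesis using R2
    proof (rule RE)
      assume "rk M' \<le> q" then show ?thesis using p by simp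
    next
      fix p' assume p': "nurel p' (\<G> p') U W M' M''" "rk M' = p'"
      then have "nurel p (\<G> p) U W M M''" using nurel_trans[OF \<G>[OF p(1,2)] p(3)] p(5) by simp
      then show ?thesis using RI[OF RD(1,2)[OF R1] p(1,2)] by simp
    qed
  qed
  \<comment> \<open>Applied to a product whose rank has dropped below p: the scalar coming from rank
    p must be admissible at the lower rank.\<close>
  have Rscal: "rees_rel q \<G> U W M (scale c M)" if h: "U \<in> C" "W \<in> C" "M \<in> Hom (vdim U) (vdim W)"
    "enat p \<le> r" "rk M < p" "scale c (trunc p) \<in> \<G> p" for U W M c p
  proof (cases "rk M \<le> q")
    case True
    then show ?thesis unfolding rees_rel_def
      using h rk_scale_le[OF h(3), of c] Hom_scale[OF h(3)] rk_trans_le[OF _ less_imp_le[OF q]] by simp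
  next
    case False
    define k where "k = rk M"
    obtain \<gamma> \<delta> where f: "\<gamma> \<in> Hom (vdim U) k" "\<delta> \<in> Hom k (vdim W)" "M = \<gamma> * \<delta>"
      using rk_factorE[OF h(3)] unfolding k_def by metis
    have c: "scale c (trunc k) \<in> \<G> k" using chain[of k p c] False h by (simp add: k_def)
    have kr: "enat k \<le> r" using rk_trans_le[OF less_imp_le h(4)] h(5) by (simp add: k_def)
    have "nurel k (\<G> k) U W M (scale c M)"
      by (rule nurelI[OF f(1,2) c]) (use f in \<open>simp_all add: k_def HomD\<close>)
    then show ?thesis using RI[OF h(1,2) _ kr] False by (simp add: k_def)
  qed
  have Rleft: "rees_rel q \<G> X W (A * M) (A * M')"
    if rees_rel: "rees_rel q \<G> U W M M'" and A: "X \<in> C" "A \<in> Hom (vdim X) (vdim U)" for U W M M' X A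
    using rees_rel
  proof (rule RE)
    note d = RD[OF rees_rel]
    assume "rk M \<le> q" "rk M' \<le> q"
    then show ?thesis unfolding rees_rel_def
      using rk_mult_le(1)[OF d(3), of A] rk_mult_le(1)[OF d(4), of A] Hom_mult[OF A(2) d(3)] Hom_mult[OF A(2) d(4)]
        A d rk_trans_le by (meson order_trans)
  next
    note d = RD[OF rees_rel]
    fix p assume p: "q < p" "enat p \<le> r" "nurel p (\<G> p) U W M M'" "rk M = p" "rk M' = p"
    obtain \<alpha> \<beta> G where *: "\<alpha> \<in> Hom (vdim U) p" "\<beta> \<in> Hom p (vdim W)" "G \<in> \<G> p" "rk M = p" "M = \<alpha> * \<beta>" "M' = \<alpha> * G * \<beta>"
      using p(3) by (rule nurelE)
    have AM: "A * M \<in> Hom (vdim X) (vdim W)" "A * M' \<in> Hom (vdim X) (vdim W)"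
      using Hom_mult[OF A(2) d(3)] Hom_mult[OF A(2) d(4)] by auto
    have le: "rk (A * M) \<le> p" using rk_mult_le(1)[OF d(3), of A] p by simp
    consider "rk (A * M) = p" | "rk (A * M) < p" "q + 1 < p" | "rk (A * M) < p" "p = q + 1"
      using le p(1) by linarith
    then show ?thesis
    proof cases
      case 1
      have "nurel p (\<G> p) X W (A * M) (A * M')"
        by (rule nurelI[OF Hom_mult[OF A(2) *(1)] *(2,3) 1]) (use * in \<open>simp_all add: mult.assoc\<close>)
      then show ?thesis using RI[OF A(1) d(2) p(1,2)] by simp
    next
      case 2
      obtain c where c: "G = scale c (trunc p)" using scalar[OF 2(2) p(2) *(3)] by blast
      have "A * M' = scale c (A * M)" using * c by (simp add: HomD mult.assoc)
      then show ?thesis using Rscal[OF A(1) d(2) AM(1) p(2) 2(1)] *(3) c by simp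
    next
      case 3
      obtain \<alpha>' \<beta>' where b: "\<beta>' \<in> Hom (vdim W) p" "\<beta> * \<beta>' = trunc p"
        using factor_inverses[OF *(1,2)] *(4,5) by metis
      \<comment> \<open>Cancelling \<beta> expresses \<open>A * M'\<close> as a right multiple of
        \<open>A * M\<close>, so its rank also falls to at most q.\<close>
      have "A * M * \<beta>' = A * \<alpha> * (\<beta> * \<beta>')" using *(5) by (simp add: mult.assoc)
      then have "A * \<alpha> = A * M * \<beta>'" using b *(1) by (simp add: HomD mult.assoc)
      then have "A * M' = A * M * (\<beta>' * (G * \<beta>))" using *(6) by (simp flip: mult.assoc)
      then have "rk (A * M') \<le> rk (A * M)" using rk_mult_le(2)[OF AM(1)] by simp
      then have l: "rk (A * M) \<le> q" "rk (A * M') \<le> q" using 3 by simp_all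
      then show ?thesis unfolding rees_rel_def using A d AM rk_trans_le[OF _ less_imp_le[OF q]] by simp
    qed
  qed
  have Rright: "rees_rel q \<G> U X (M * A) (M' * A)"
    if rees_rel: "rees_rel q \<G> U W M M'" and A: "X \<in> C" "A \<in> Hom (vdim W) (vdim X)" for U W M M' X A
    using rees_rel
  proof (rule RE)
    note d = RD[OF rees_rel]
    assume "rk M \<le> q" "rk M' \<le> q"
    then show ?thesis unfolding rees_rel_def
      using rk_mult_le(2)[OF d(3), of A] rk_mult_le(2)[OF d(4), of A] Hom_mult[OF d(3) A(2)] Hom_mult[OF d(4) A(2)]
        A d rk_trans_le by (meson order_trans)
  next
    note d = RD[OF rees_rel]
    fix p assume p: "q < p" "enat p \<le> r" "nurel p (\<G> p) U W M M'" "rk M = p" "rk M' = p"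
    obtain \<alpha> \<beta> G where *: "\<alpha> \<in> Hom (vdim U) p" "\<beta> \<in> Hom p (vdim W)" "G \<in> \<G> p" "rk M = p" "M = \<alpha> * \<beta>" "M' = \<alpha> * G * \<beta>"
      using p(3) by (rule nurelE)
    have AM: "M * A \<in> Hom (vdim U) (vdim X)" "M' * A \<in> Hom (vdim U) (vdim X)"
      using Hom_mult[OF d(3) A(2)] Hom_mult[OF d(4) A(2)] by auto
    have le: "rk (M * A) \<le> p" using rk_mult_le(2)[OF d(3), of A] p by simp
    consider "rk (M * A) = p" | "rk (M * A) < p" "q + 1 < p" | "rk (M * A) < p" "p = q + 1"
      using le p(1) by linarith
    then show ?thesis
    proof cases
      case 1
      have "nurel p (\<G> p) U X (M * A) (M' * A)"
        by (rule nurelI[OF *(1) Hom_mult[OF *(2) A(2)] *(3) 1]) (use * in \<open>simp_all add: mult.assoc\<close>)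
      then show ?thesis using RI[OF d(1) A(1) p(1,2)] by simp
    next
      case 2
      obtain c where c: "G = scale c (trunc p)" using scalar[OF 2(2) p(2) *(3)] by blast
      have "M' * A = scale c (M * A)" using * c by (simp add: HomD mult.assoc)
      then show ?thesis using Rscal[OF d(1) A(1) AM(1) p(2) 2(1)] *(3) c by simp
    next
      case 3
      obtain \<alpha>' \<beta>' where b: "\<alpha>' \<in> Hom p (vdim U)" "\<alpha>' * \<alpha> = trunc p"
        using factor_inverses[OF *(1,2)] *(4,5) by metis
      have "\<alpha>' * (M * A) = (\<alpha>' * \<alpha>) * (\<beta> * A)" using *(5) by (simp only: mult.assoc)
      then have "\<beta> * A = \<alpha>' * (M * A)" using b *(2) by (simp add: HomD_left_commute)
      then have "M' * A = \<alpha> * G * \<alpha>' * (M * A)" using *(6) by (simp add: mult.assoc)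
      then have "rk (M' * A) \<le> rk (M * A)" using rk_mult_le(1)[OF AM(1)] by simp
      then have l: "rk (M * A) \<le> q" "rk (M' * A) \<le> q" using 3 by simp_all
      then show ?thesis unfolding rees_rel_def using A d AM rk_trans_le[OF _ less_imp_le[OF q]] by simp
    qed
  qed
  have sub: "?S \<subseteq> nabla (rank_ideal C r)"
  proof
    fix z assume "z \<in> ?S"
    then obtain U W M M' where z: "z = (mor U M W, mor U M' W)" "rees_rel q \<G> U W M M'" by blast
    note d = RD[OF z(2)]
    show "z \<in> nabla (rank_ideal C r)"
      unfolding nabla_def z using mor_rank_ideal[OF d(1,2,3)] mor_rank_ideal[OF d(1,2,4)] d(5,6) by simp
  qed
  have equiv: "equiv (rank_ideal C r) ?S"
  proof (rule equivI)
    show "?S \<subseteq> rank_ideal C r \<times> rank_ideal C r" using sub unfolding nabla_def by blast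
    show "refl_on (rank_ideal C r) ?S"
    proof (rule refl_onI)
      fix x assume "x \<in> rank_ideal C r"
      then obtain U W M where "U \<in> C" "W \<in> C" "M \<in> Hom (vdim U) (vdim W)" "enat (rk M) \<le> r" "x = mor U M W"
        by (rule rank_idealE)
      then show "(x, x) \<in> ?S" using Rrefl by blast
    qed
    show "sym ?S" using Rsym by (intro symI) blast
    show "trans ?S"
    proof (rule transI)
      fix x y z assume xy: "(x, y) \<in> ?S" and yz: "(y, z) \<in> ?S"
      obtain U W M M' where 1: "x = mor U M W" "y = mor U M' W" "rees_rel q \<G> U W M M'" using xy by blast
      obtain U1 W1 K K' where 2: "y = mor U1 K W1" "z = mor U1 K' W1" "rees_rel q \<G> U1 W1 K K'" using yz by blast
      have e: "U1 = U" "W1 = W" using mor_eqD[of U M' W U1 K W1] 1(2) 2(1) by auto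
      have "K = M'" using mor_inject[OF RD(1,2)[OF 1(3)], of M' K] RD[OF 1(3)] RD[OF 2(3)] 1(2) 2(1) e by simp
      then show "(x, z) \<in> ?S" using Rtrans[OF 1(3)] 1 2 e by blast
    qed
  qed
  have left: "(a \<cdot>\<^sub>L x, a \<cdot>\<^sub>L y) \<in> ?S"
    if xy: "(x, y) \<in> ?S" and a: "a \<in> rank_ideal C r" "mran a = mdom x" for x y a
  proof -
    obtain U W M M' where 1: "x = mor U M W" "y = mor U M' W" "rees_rel q \<G> U W M M'" using xy by blast
    obtain X U' A where A: "X \<in> C" "U' \<in> C" "A \<in> Hom (vdim X) (vdim U')" "enat (rk A) \<le> r" "a = mor X A U'"
      using a(1) by (rule rank_idealE)
    have e: "U' = U" using a(2) A(5) 1(1) by simp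
    note A' = A(3)[unfolded e]
    have "a \<cdot>\<^sub>L x = mor X (A * M) W" "a \<cdot>\<^sub>L y = mor X (A * M') W"
      unfolding 1 A(5) e using mor_comp[OF A(1) RD(1,2)[OF 1(3)] A'] by auto
    then show ?thesis using Rleft[OF 1(3) A(1) A'] by blast
  qed
  have right: "(x \<cdot>\<^sub>L a, y \<cdot>\<^sub>L a) \<in> ?S"
    if xy: "(x, y) \<in> ?S" and a: "a \<in> rank_ideal C r" "mran x = mdom a" for x y a
  proof -
    obtain U W M M' where 1: "x = mor U M W" "y = mor U M' W" "rees_rel q \<G> U W M M'" using xy by blast
    obtain W' X A where A: "W' \<in> C" "X \<in> C" "A \<in> Hom (vdim W') (vdim X)" "enat (rk A) \<le> r" "a = mor W' A X"
      using a(1) by (rule rank_idealE)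
    have e: "W' = W" using a(2) A(5) 1(1) by simp
    note A' = A(3)[unfolded e]
    note d = RD[OF 1(3)]
    have "x \<cdot>\<^sub>L a = mor U (M * A) X" "y \<cdot>\<^sub>L a = mor U (M' * A) X"
      unfolding 1 A(5) e using mor_comp[OF d(1,2) A(2) d(3)] mor_comp[OF d(1,2) A(2) d(4)] by auto
    then show ?thesis using Rright[OF 1(3) A(2) A'] by blast
  qed
  show ?thesis by (rule congruenceI[OF equiv sub left right])
qed

end

subsection \<open>Classification\<close>

lemma scale_trunc_inject: "0 < p \<Longrightarrow> scale c (trunc p) = scale d (trunc p) \<Longrightarrow> c = (d :: 'a::field)"
  by (drule arg_cong[of _ _ "\<lambda>M. entry M 0 0"]) (simp add: entry_trunc)

lemma subgroup_field_units_iff: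
  fixes H :: "'a::field set"
  shows "subgroup H field_units \<longleftrightarrow>
    0 \<notin> H \<and> 1 \<in> H \<and> (\<forall>a\<in>H. \<forall>b\<in>H. a * b \<in> H) \<and> (\<forall>a\<in>H. inverse a \<in> H)"
proof -
  interpret G: group "field_units :: 'a monoid" by (rule field.field_mult_group[OF class_field])
  have inv: "inv\<^bsub>field_units\<^esub> a = inverse a" if "a \<noteq> 0" for a :: 'a
    by (rule G.inv_equality) (use that in auto)
  show ?thesis
  proof
    assume "subgroup H field_units"
    then interpret H: subgroup H field_units .
    have nz: "0 \<notin> H" using H.subset by auto
    moreover have "inverse a \<in> H" if "a \<in> H" for a
      using H.m_inv_closed[OF that] inv[of a] nz that by (cases "a = 0") auto
    ultimately show "0 \<notin> H \<and> 1 \<in> H \<and> (\<forall>a\<in>H. \<forall>b\<in>H. a * b \<in> H) \<and> (\<forall>a\<in>H. inverse a \<in> H)"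
      using H.one_closed H.m_closed by auto
  next
    assume H: "0 \<notin> H \<and> 1 \<in> H \<and> (\<forall>a\<in>H. \<forall>b\<in>H. a * b \<in> H) \<and> (\<forall>a\<in>H. inverse a \<in> H)"
    show "subgroup H field_units"
    proof (rule G.subgroupI)
      show "inv\<^bsub>field_units\<^esub> a \<in> H" if "a \<in> H" for a using H that inv[of a] by (cases "a = 0") auto
    qed (use H in auto)
  qed
qed

lemma op_of_scalar_mats: "op_of_mat ` scalar_mats p H = {scale c (trunc p) | c. c \<in> H}"
  by (simp add: scalar_mats_def Setcompr_eq_image image_image op_of_mat_smult_one)

lemma scalar_mats_carrier: "scalar_mats p H \<subseteq> carrier_mat p p"
  unfolding scalar_mats_def by auto

lemma normal_ops_scalar:
  fixes H :: "'a::field set"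
  assumes "subgroup H field_units" shows "normal_ops p {scale c (trunc p) | c. c \<in> H}"
proof -
  have H: "0 \<notin> H" "1 \<in> H" "\<And>a b. a \<in> H \<Longrightarrow> b \<in> H \<Longrightarrow> a * b \<in> H" "\<And>a. a \<in> H \<Longrightarrow> inverse a \<in> H"
    using assms unfolding subgroup_field_units_iff by auto
  have nz: "c \<noteq> 0" if "c \<in> H" for c using H(1) that by auto
  have Ehom: "scale c (trunc p) \<in> Hom p p" for c :: 'a by (rule Hom_scale[OF trunc_in_Hom]) auto
  show ?thesis unfolding normal_ops_def
  proof (intro conjI ballI impI subsetI)
    fix G assume "G \<in> {scale c (trunc p) | c. c \<in> H}"
    then obtain c where c: "G = scale c (trunc p)" "c \<in> H" by blast
    show "G \<in> invops p" unfolding c(1)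
      by (rule invopsI[OF Ehom Ehom[of "inverse c"]]) (use nz[OF c(2)] in simp)
  next
    show "trunc p \<in> {scale c (trunc p) | c. c \<in> H}" using H(2) by (auto intro!: exI[of _ 1])
  next
    fix G K assume GK: "G \<in> {scale c (trunc p) | c. c \<in> H}" "K \<in> {scale c (trunc p) | c. c \<in> H}"
    obtain c where c: "G = scale c (trunc p)" "c \<in> H" using GK(1) by blast
    obtain d where d: "K = scale d (trunc p)" "d \<in> H" using GK(2) by blast
    have "G * K = scale (d * c) (trunc p)" using c d by simp
    then show "G * K \<in> {scale c (trunc p) | c. c \<in> H}" using H(3)[OF d(2) c(2)] by blast
  next
    fix G G' assume G: "G \<in> {scale c (trunc p) | c. c \<in> H}" "G' \<in> Hom p p" "G * G' = trunc p"
    obtain c where c: "G = scale c (trunc p)" "c \<in> H" using G(1) by blast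
    have "scale (inverse c) (scale c G') = scale (inverse c) (trunc p)" using G c by (simp add: HomD)
    then have "G' = scale (inverse c) (trunc p)" using nz[OF c(2)] by simp
    then show "G' \<in> {scale c (trunc p) | c. c \<in> H}" using H(4)[OF c(2)] by blast
  next
    fix G P P' :: "'a linop"
    assume G: "G \<in> {scale c (trunc p) | c. c \<in> H}" "P \<in> Hom p p" "P' \<in> Hom p p" "P * P' = trunc p"
    obtain c where c: "G = scale c (trunc p)" "c \<in> H" using G(1) by blast
    have "P * G * P' = scale c (trunc p)" using c G by (simp add: HomD)
    then show "P * G * P' \<in> {scale c (trunc p) | c. c \<in> H}" using c(2) by blast
  qed
qed

lemma (in fin_vs_set) congruence_nabla: "congruence (rank_ideal C r) (nabla (rank_ideal C r))"
proof -
  have comp: "x \<cdot>\<^sub>L y \<in> rank_ideal C r" if xy: "x \<in> rank_ideal C r" "y \<in> rank_ideal C r" "mran x = mdom y" for x y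
  proof -
    obtain U W M where x: "U \<in> C" "W \<in> C" "M \<in> Hom (vdim U) (vdim W)" "enat (rk M) \<le> r" "x = mor U M W"
      using xy(1) by (rule rank_idealE)
    obtain W' X N where y: "W' \<in> C" "X \<in> C" "N \<in> Hom (vdim W') (vdim X)" "enat (rk N) \<le> r" "y = mor W' N X"
      using xy(2) by (rule rank_idealE)
    have e: "W' = W" using xy(3) x(5) y(5) by simp
    have "x \<cdot>\<^sub>L y = mor U (M * N) X" unfolding x(5) y(5) e by (rule mor_comp[OF x(1,2) y(2) x(3)])
    moreover have "M * N \<in> Hom (vdim U) (vdim X)" by (rule Hom_mult[OF x(3) y(3)])
    moreover have "enat (rk (M * N)) \<le> r" by (rule rk_trans_le[OF rk_mult_le(2)[OF x(3)] x(4)])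
    ultimately show ?thesis using mor_rank_ideal x(1) y(2) by simp
  qed
  have "equiv (rank_ideal C r) (nabla (rank_ideal C r))"
    by (rule equivI) (auto simp: nabla_def refl_on_def sym_def trans_def)
  then show ?thesis
    by (rule congruenceI) (auto simp: nabla_def intro: comp)
qed

section \<open>The normal subgroups attached to a congruence\<close>

locale threshold_rees = threshold_cong C r \<sigma> q + rees_data C V B r
  for C :: "('a::field, 'b) module set" and r \<sigma> q V B
begin

text \<open>\<open>proj p * incl p\<close> represents the natural image of the identity matrix, an
  idempotent of rank p, so this is its congruence class read inside the p by p matrices.
  Invertibility is not imposed; for q < p it is proved in \<open>unit_class_invops\<close>.\<close>

definition unit_class :: "nat \<Rightarrow> 'a linop set" where
  "unit_class p = {G \<in> Hom p p. rel (V p) (V p) (proj p * incl p) (proj p * G * incl p)}"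

text \<open>The same group governs all maps of rank p. Pairs are moved between \<open>V p\<close>
  and U, W by multipliers such as \<open>proj p * \<alpha>'\<close> and
  \<open>\<alpha> * incl p\<close>, which factor through \<open>F^p\<close> and so remain in the
  ideal.\<close>

lemma rel_iff_unit_class:
  assumes p: "enat p \<le> r" and UW: "U \<in> C" "W \<in> C"
    and h: "\<alpha> \<in> Hom (vdim U) p" "\<beta> \<in> Hom p (vdim W)" "rk (\<alpha> * \<beta>) = p" and G: "G \<in> Hom p p"
  shows "rel U W (\<alpha> * \<beta>) (\<alpha> * G * \<beta>) \<longleftrightarrow> G \<in> unit_class p"
proof
  note ki = proj_incl[OF p] and V = V_C[OF p]
  obtain \<alpha>' \<beta>' where inv: "\<alpha>' \<in> Hom p (vdim U)" "\<beta>' \<in> Hom (vdim W) p" "\<alpha>' * \<alpha> = trunc p" "\<beta> * \<beta>' = trunc p"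
    using factor_inverses[OF h] by blast
  assume rel: "rel U W (\<alpha> * \<beta>) (\<alpha> * G * \<beta>)"
  have "rel (V p) (V p) (proj p * \<alpha>' * (\<alpha> * \<beta>) * (\<beta>' * incl p)) (proj p * \<alpha>' * (\<alpha> * G * \<beta>) * (\<beta>' * incl p))"
    by (rule rel_right[OF rel_left[OF rel V Hom_mult[OF ki(1) inv(1)] rk_trans_le[OF _ p]] V
          Hom_mult[OF inv(2) ki(2)] rk_trans_le[OF _ p]])
      (rule rk_mult_Hom_le(2)[OF inv(1)], rule rk_mult_Hom_le(1)[OF inv(2)])
  moreover have "proj p * \<alpha>' * (\<alpha> * \<beta>) * (\<beta>' * incl p) = proj p * (\<alpha>' * \<alpha>) * (\<beta> * \<beta>') * incl p"
    "proj p * \<alpha>' * (\<alpha> * G * \<beta>) * (\<beta>' * incl p) = proj p * (\<alpha>' * \<alpha>) * G * (\<beta> * \<beta>') * incl p"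
    by (simp_all only: mult.assoc)
  ultimately show "G \<in> unit_class p" using inv ki(1,2) G by (simp add: unit_class_def HomD mult.assoc HomD_left_commute)
next
  note ki = proj_incl[OF p] and V = V_C[OF p]
  assume "G \<in> unit_class p"
  then have rel: "rel (V p) (V p) (proj p * incl p) (proj p * G * incl p)" by (simp add: unit_class_def)
  have "rel U W (\<alpha> * incl p * (proj p * incl p) * (proj p * \<beta>)) (\<alpha> * incl p * (proj p * G * incl p) * (proj p * \<beta>))"
    by (rule rel_right[OF rel_left[OF rel UW(1) Hom_mult[OF h(1) ki(2)] rk_trans_le[OF _ p]] UW(2)
          Hom_mult[OF ki(1) h(2)] rk_trans_le[OF _ p]])
      (rule rk_mult_Hom_le(1)[OF h(1)], rule rk_mult_Hom_le(2)[OF h(2)])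
  moreover have "\<alpha> * incl p * (proj p * incl p) * (proj p * \<beta>) = \<alpha> * \<beta>"
    "\<alpha> * incl p * (proj p * G * incl p) * (proj p * \<beta>) = \<alpha> * G * \<beta>"
    using h G by (simp_all add: mult.assoc incl_proj[OF p] HomD HomD_left_commute)
  ultimately show "rel U W (\<alpha> * \<beta>) (\<alpha> * G * \<beta>)" by simp
qed

lemma rk_proj_incl: assumes "enat p \<le> r" shows "rk (proj p * incl p) = p"
proof (rule rk_eqI[of _ "proj p" _ "incl p" "incl p" "proj p"])
  show "proj p * incl p = proj p * trunc p * incl p" using proj_incl(1)[OF assms] by (simp add: HomD)
  show "trunc p = incl p * (proj p * incl p) * proj p"
    using proj_incl(3)[OF assms] incl_proj[OF assms] by (simp add: mult.assoc)
qed

lemma unit_class_Hom: "G \<in> unit_class p \<Longrightarrow> G \<in> Hom p p"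
  and unit_class_rel: "G \<in> unit_class p \<Longrightarrow> rel (V p) (V p) (proj p * incl p) (proj p * G * incl p)"
  by (auto simp: unit_class_def)

text \<open>Above rank q related maps have equal rank, so \<open>proj p * G * incl p\<close> has
  rank p, which forces full rank on G.\<close>

lemma unit_class_invops: assumes p: "q < p" "enat p \<le> r" and G: "G \<in> unit_class p" shows "G \<in> invops p"
proof -
  note h = unit_class_Hom[OF G]
  have "rk (proj p * G * incl p) = p"
    using rel_rank_eq[OF unit_class_rel[OF G]] rk_proj_incl[OF p(2)] p(1) by simp
  moreover have "rk (proj p * G * incl p) \<le> rk (proj p * G)"
    by (rule rk_mult_le(2)[OF Hom_mult[OF proj_incl(1)[OF p(2)] h]])
  moreover have "rk (proj p * G) \<le> rk G" by (rule rk_mult_le(1)[OF h])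
  moreover have "rk G \<le> p" by (rule rk_Hom_le[OF h])
  ultimately show ?thesis using invops_iff_rk[OF h] by simp
qed

text \<open>The multipliers \<open>proj p * Z * incl p\<close> and
  \<open>proj p * Z' * incl p\<close> have rank at most p and hence belong to the ideal.\<close>

lemma rel_mult_left_right:
  assumes p: "enat p \<le> r" and h: "X \<in> Hom p p" "Y \<in> Hom p p" "Z \<in> Hom p p" "Z' \<in> Hom p p"
    and rel: "rel (V p) (V p) (proj p * X * incl p) (proj p * Y * incl p)"
  shows "rel (V p) (V p) (proj p * (Z * X * Z') * incl p) (proj p * (Z * Y * Z') * incl p)"
proof -
  note ki = proj_incl[OF p] and V = V_C[OF p]
  have "rel (V p) (V p) (proj p * Z * incl p * (proj p * X * incl p) * (proj p * Z' * incl p))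
      (proj p * Z * incl p * (proj p * Y * incl p) * (proj p * Z' * incl p))"
    by (rule rel_right[OF rel_left[OF rel V Hom_mult[OF Hom_mult[OF ki(1) h(3)] ki(2)] rk_trans_le[OF _ p]] V
          Hom_mult[OF Hom_mult[OF ki(1) h(4)] ki(2)] rk_trans_le[OF _ p]])
      (rule rk_mult_Hom_le(2)[OF ki(2)], rule rk_mult_Hom_le(2)[OF ki(2)])
  then show ?thesis using h by (simp add: mult.assoc incl_proj[OF p] HomD HomD_left_commute)
qed

lemma unit_class_iff: "G \<in> unit_class p \<longleftrightarrow> G \<in> Hom p p \<and> rel (V p) (V p) (proj p * trunc p * incl p) (proj p * G * incl p)"
  if "enat p \<le> r"
  unfolding unit_class_def using proj_incl(1)[OF that] by (simp add: HomD)

text \<open>With 1 related to G and to K: multiplying the second relation by G relates G to G K, and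
  transitivity gives the product. Multiplying 1 ~ G by the inverse of G gives inverses, and
  conjugation fixes 1.\<close>

lemma normal_ops_unit_class: assumes p: "q < p" "enat p \<le> r" shows "normal_ops p (unit_class p)"
  unfolding normal_ops_def
proof (intro conjI ballI impI subsetI)
  have Eh: "trunc p \<in> Hom p p" by (rule trunc_in_Hom) auto
  note iff = unit_class_iff[OF p(2)] and lr = rel_mult_left_right[OF p(2)]
  show "G \<in> invops p" if "G \<in> unit_class p" for G using unit_class_invops p that by blast
  show "trunc p \<in> unit_class p" unfolding iff
  proof
    note ki = proj_incl[OF p(2)] and V = V_C[OF p(2)]
    have h: "proj p * trunc p * incl p \<in> Hom (vdim (V p)) (vdim (V p))"
      by (rule Hom_mult[OF Hom_mult[OF ki(1) Eh] ki(2)])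
    show "rel (V p) (V p) (proj p * trunc p * incl p) (proj p * trunc p * incl p)"
      by (rule rel_refl[OF V V h rk_trans_le[OF rk_mult_Hom_le(2)[OF ki(2)] p(2)]])
  qed (rule Eh)
  fix G assume G: "G \<in> unit_class p"
  note Gh = unit_class_Hom[OF G] and Gr = conjunct2[OF G[unfolded iff]]
  show "G * K \<in> unit_class p" if K: "K \<in> unit_class p" for K
  proof -
    note Kh = unit_class_Hom[OF K] and Kr = conjunct2[OF K[unfolded iff]]
    have "rel (V p) (V p) (proj p * (G * trunc p * trunc p) * incl p) (proj p * (G * K * trunc p) * incl p)"
      by (rule lr[OF Eh Kh Gh Eh Kr])
    then have "rel (V p) (V p) (proj p * G * incl p) (proj p * (G * K) * incl p)"
      using Gh Kh by (simp add: HomD mult.assoc)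
    then show ?thesis unfolding iff using rel_trans[OF Gr] Hom_mult[OF Gh Kh] by blast
  qed
  show "G' \<in> unit_class p" if G': "G' \<in> Hom p p" "G * G' = trunc p" for G'
  proof -
    have "rel (V p) (V p) (proj p * (trunc p * trunc p * G') * incl p) (proj p * (trunc p * G * G') * incl p)"
      by (rule lr[OF Eh Gh Eh G'(1) Gr])
    then have "rel (V p) (V p) (proj p * G' * incl p) (proj p * trunc p * incl p)"
      using Gh G' by (simp add: HomD HomD_left_commute mult.assoc)
    then show ?thesis unfolding iff using rel_sym G'(1) by blast
  qed
  show "P * G * P' \<in> unit_class p" if P: "P \<in> Hom p p" "P' \<in> Hom p p" "P * P' = trunc p" for P P'
  proof -
    have "rel (V p) (V p) (proj p * (P * trunc p * P') * incl p) (proj p * (P * G * P') * incl p)"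
      by (rule lr[OF Eh Gh P(1,2) Gr])
    then show ?thesis unfolding iff using P Hom_mult[OF Hom_mult[OF P(1) Gh] P(2)] by (simp add: HomD)
  qed
qed

lemma unit_class_scalar: assumes p: "q + 1 < p" "enat p \<le> r" and G: "G \<in> unit_class p" shows "\<exists>c. G = scale c (trunc p)"
proof -
  note ki = proj_incl[OF p(2)]
  have "q < p" using p(1) by simp
  note g = unit_class_invops[OF this p(2) G]
  show ?thesis by (rule rel_scalar[OF unit_class_rel[OF G] ki(1,2) ki(2,1,3,3) g p(1)])
qed

text \<open>Restriction to the first k coordinates of \<open>F^p\<close> turns a scalar of size p
  into the same scalar of size k. The multipliers lead from \<open>V k\<close> to \<open>V p\<close>
  and back through \<open>F^k\<close>.\<close>

lemma unit_class_chain: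
  assumes p: "k \<le> p" "enat p \<le> r" and c: "scale c (trunc p) \<in> unit_class p" shows "scale c (trunc k) \<in> unit_class k"
proof -
  have kr: "enat k \<le> r" using p by (rule rk_trans_le)
  note kip = proj_incl[OF p(2)] and kik = proj_incl[OF kr] and Vp = V_C[OF p(2)] and Vk = V_C[OF kr]
  have iE: "incl p \<in> Hom p (vdim (V p))" "trunc k * incl p \<in> Hom k (vdim (V p))" "proj p * trunc k \<in> Hom (vdim (V p)) k"
    using kip Hom_mult[OF trunc_in_Hom[OF order_refl order_refl] kip(2)]
      Hom_mult[OF kip(1) trunc_in_Hom[OF order_refl order_refl]] by auto
  have "rel (V k) (V k) (proj k * (trunc k * incl p) * (proj p * incl p) * (proj p * trunc k * incl k))
     (proj k * (trunc k * incl p) * (proj p * scale c (trunc p) * incl p) * (proj p * trunc k * incl k))"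
    by (rule rel_right[OF rel_left[OF unit_class_rel[OF c] Vk Hom_mult[OF kik(1) iE(2)] rk_trans_le[OF _ kr]] Vk
          Hom_mult[OF iE(3) kik(2)] rk_trans_le[OF _ kr]])
      (rule rk_mult_Hom_le(1)[OF kik(1)], rule rk_mult_Hom_le(2)[OF kik(2)])
  moreover have "proj k * (trunc k * incl p) * (proj p * incl p) * (proj p * trunc k * incl k) = proj k * incl k"
    "proj k * (trunc k * incl p) * (proj p * scale c (trunc p) * incl p) * (proj p * trunc k * incl k) = proj k * scale c (trunc k) * incl k"
    using kik(1,2) p(1) HomD(1)[OF Hom_mono[OF kik(2) p(1) order_refl]]
    by (simp_all add: mult.assoc incl_proj[OF p(2)] trunc_mult_trunc_left HomD HomD_left_commute min_def)
  moreover have "scale c (trunc k) \<in> Hom k k" by (rule Hom_scale[OF trunc_in_Hom]) auto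
  ultimately show ?thesis by (simp add: unit_class_def)
qed

text \<open>Below the threshold both sides are relatedness to zero; above it,
  \<open>rel_sandwich\<close> supplies the group element
  \<open>\<alpha>' * M' * \<beta>'\<close>.\<close>

lemma rel_iff_rees_rel: "rel U W M M' \<longleftrightarrow> rees_rel q unit_class U W M M'"
proof
  assume rel: "rel U W M M'"
  note d = relD[OF rel] and rr = rel_rank[OF rel]
  show "rees_rel q unit_class U W M M'"
  proof (cases "rk M \<le> q")
    case True
    then show ?thesis using rel_low[OF rel] d rr by (simp add: rees_rel_def)
  next
    case False
    define p where "p = rk M"
    have p: "q < p" "enat p \<le> r" using False rr by (auto simp: p_def)
    obtain \<alpha> \<beta> \<alpha>' \<beta>' where f: "\<alpha> \<in> Hom (vdim U) p" "\<beta> \<in> Hom p (vdim W)"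
      "\<alpha>' \<in> Hom p (vdim U)" "\<beta>' \<in> Hom (vdim W) p" "M = \<alpha> * \<beta>" "\<alpha>' * \<alpha> = trunc p" "\<beta> * \<beta>' = trunc p"
      using rk_factorE[OF d(3)] unfolding p_def by metis
    define G where "G = \<alpha>' * M' * \<beta>'"
    have Gh: "G \<in> Hom p p" unfolding G_def by (rule Hom_mult[OF Hom_mult[OF f(3) d(4)] f(4)])
    have M': "M' = \<alpha> * G * \<beta>" unfolding G_def
      by (rule rel_sandwich[OF rel[unfolded f(5)] f(1-4,6,7) p(1)])
    have rkab: "rk (\<alpha> * \<beta>) = p" using f(5) by (simp add: p_def)
    have "rel U W (\<alpha> * \<beta>) (\<alpha> * G * \<beta>)" using rel f(5) M' by simp
    then have "G \<in> unit_class p" using rel_iff_unit_class[OF p(2) d(1,2) f(1,2) rkab Gh] by blast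
    then have "nurel p (unit_class p) U W M M'" by (rule nurelI[OF f(1,2) _ _ f(5) M']) (simp add: p_def)
    then show ?thesis unfolding rees_rel_def using d rr p by blast
  qed
next
  assume rees_rel: "rees_rel q unit_class U W M M'"
  then have d: "U \<in> C" "W \<in> C" "M \<in> Hom (vdim U) (vdim W)" "M' \<in> Hom (vdim U) (vdim W)"
    "enat (rk M) \<le> r" "enat (rk M') \<le> r" by (auto simp: rees_rel_def)
  have "rk M \<le> q \<and> rk M' \<le> q \<or> (\<exists>p. q < p \<and> enat p \<le> r \<and> nurel p (unit_class p) U W M M')"
    using rees_rel by (auto simp: rees_rel_def)
  then show "rel U W M M'"
  proof
    assume "rk M \<le> q \<and> rk M' \<le> q"
    then have "rel U W M 0" "rel U W M' 0" using zero_iff d by auto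
    then show ?thesis using rel_trans rel_sym by blast
  next
    assume "\<exists>p. q < p \<and> enat p \<le> r \<and> nurel p (unit_class p) U W M M'"
    then obtain p where p: "q < p" "enat p \<le> r" "nurel p (unit_class p) U W M M'" by blast
    obtain \<alpha> \<beta> G where *: "\<alpha> \<in> Hom (vdim U) p" "\<beta> \<in> Hom p (vdim W)" "G \<in> unit_class p" "rk M = p" "M = \<alpha> * \<beta>" "M' = \<alpha> * G * \<beta>"
      using p(3) by (rule nurelE)
    have "rk (\<alpha> * \<beta>) = p" using *(4,5) by simp
    then show ?thesis using rel_iff_unit_class[OF p(2) d(1,2) *(1,2) _ unit_class_Hom[OF *(3)]] *(3,5,6) by simp
  qed
qed

lemma sigma_eq: "\<sigma> = {(mor U M W, mor U M' W) | U W M M'. rees_rel q unit_class U W M M'}"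
proof (intro equalityI subsetI)
  fix z assume "z \<in> \<sigma>"
  moreover obtain x y where xy: "z = (x, y)" by (cases z)
  ultimately have "(x, y) \<in> \<sigma>" by simp
  then obtain U W M N where "rel U W M N" "x = mor U M W" "y = mor U N W" by (rule sigmaE)
  then show "z \<in> {(mor U M W, mor U M' W) | U W M M'. rees_rel q unit_class U W M M'}"
    unfolding xy using rel_iff_rees_rel by blast
next
  fix z assume "z \<in> {(mor U M W, mor U M' W) | U W M M'. rees_rel q unit_class U W M M'}"
  then obtain U W M M' where "z = (mor U M W, mor U M' W)" "rel U W M M'" using rel_iff_rees_rel by blast
  then show "z \<in> \<sigma>" by (simp add: rel_def)
qed

lemma sigma_rees_N:
  "\<exists>N H. \<sigma> = rees_N C V B r q (\<lambda>p. if p = q + 1 then N else scalar_mats p (H p)) \<and>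
    N \<lhd> GL (q + 1) \<and>
    (\<forall>p. q + 2 \<le> p \<and> enat p \<le> r \<longrightarrow> subgroup (H p) field_units) \<and>
    (\<forall>p. q + 2 \<le> p \<and> enat (p + 1) \<le> r \<longrightarrow> H (p + 1) \<subseteq> H p) \<and>
    (enat (q + 2) \<le> r \<longrightarrow> scalar_mats (q + 1) (H (q + 2)) \<subseteq> N)"
proof (intro exI conjI)
  define N where "N = mat_of_op (q + 1) (q + 1) ` unit_class (q + 1)"
  \<comment> \<open>For q + 2 <= p <= r the whole class is scalar, so \<open>H p\<close> records it
    completely. Values of H at other p are harmless, as \<open>rees_N\<close> does not look at
    them.\<close>
  define H where "H p = {c. scale c (trunc p) \<in> unit_class p}" for p
  let ?N = "\<lambda>p. if p = q + 1 then N else scalar_mats p (H p)"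
  have tmN: "op_of_mat ` N = unit_class (q + 1)"
    unfolding N_def image_image using op_of_mat_of_op[OF unit_class_Hom] by simp
  have tmH: "op_of_mat ` scalar_mats p (H p) = unit_class p" if "q + 1 < p" "enat p \<le> r" for p
    unfolding op_of_scalar_mats H_def using unit_class_scalar[OF that] by blast
  have img: "op_of_mat ` ?N p = unit_class p" if "q < p" "enat p \<le> r" for p
    using tmN tmH[of p] that by auto
  have Nc: "?N p \<subseteq> carrier_mat p p" for p
    using scalar_mats_carrier by (auto simp: N_def)
  have "rees_rel q unit_class U W M M' = rees_rel q (\<lambda>p. op_of_mat ` ?N p) U W M M'" for U W M M'
    unfolding rees_rel_def using img by metis
  then have "\<sigma> = {(mor U M W, mor U M' W) | U W M M'. rees_rel q (\<lambda>p. op_of_mat ` ?N p) U W M M'}"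
    using sigma_eq by simp
  also have "\<dots> = rees_N C V B r q ?N"
    by (rule rees_N_eq[symmetric, OF less_imp_le[OF q_less]]) (use Nc img normal_ops_unit_class in simp)
  finally show "\<sigma> = rees_N C V B r q ?N" .
  have q1: "normal_ops (q + 1) (unit_class (q + 1))" using normal_ops_unit_class[of "q + 1"] Suc_q_le by simp
  show "N \<lhd> GL (q + 1)" unfolding normal_GL_iff tmN using q1 Nc[of "q + 1"] by simp
  show "\<forall>p. q + 2 \<le> p \<and> enat p \<le> r \<longrightarrow> subgroup (H p) field_units"
  proof (intro allI impI)
    fix p assume p: "q + 2 \<le> p \<and> enat p \<le> r"
    have n: "normal_ops p (unit_class p)" using normal_ops_unit_class[of p] p by simp
    note n = normal_opsD[OF n]
    \<comment> \<open>Otherwise the zero operator would be invertible of size p, although p is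
      positive.\<close>
    have nz: "0 \<notin> H p"
    proof
      assume "0 \<in> H p"
      then have "(0 :: 'a linop) \<in> invops p" using n(1) by (auto simp: H_def)
      then have "rk (0 :: 'a linop) = p" using invops_iff_rk[OF Hom_0] by blast
      then show False using rk_0_iff[OF Hom_0, where 'a='a] p by simp
    qed
    have "a * b \<in> H p" if "a \<in> H p" "b \<in> H p" for a b
      using n(3)[of "scale b (trunc p)" "scale a (trunc p)"] that by (simp add: H_def)
    moreover have "inverse a \<in> H p" if a: "a \<in> H p" for a
    proof -
      have "a \<noteq> 0" using nz a by auto
      moreover have "scale (inverse a) (trunc p) \<in> Hom p p" by (rule Hom_scale[OF trunc_in_Hom]) auto
      ultimately show ?thesis using n(4)[of "scale a (trunc p)" "scale (inverse a) (trunc p)"] a by (simp add: H_def)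
    qed
    ultimately show "subgroup (H p) field_units"
      unfolding subgroup_field_units_iff using nz n(2) by (simp add: H_def)
  qed
  show "\<forall>p. q + 2 \<le> p \<and> enat (p + 1) \<le> r \<longrightarrow> H (p + 1) \<subseteq> H p"
  proof (intro allI impI subsetI)
    fix p c assume "q + 2 \<le> p \<and> enat (p + 1) \<le> r" "c \<in> H (p + 1)"
    then show "c \<in> H p" unfolding H_def mem_Collect_eq by (intro unit_class_chain[of p "p + 1"]) simp_all
  qed
  show "enat (q + 2) \<le> r \<longrightarrow> scalar_mats (q + 1) (H (q + 2)) \<subseteq> N"
  proof (intro impI subsetI)
    fix A assume r: "enat (q + 2) \<le> r" and "A \<in> scalar_mats (q + 1) (H (q + 2))"
    then obtain c where c: "A = c \<cdot>\<^sub>m 1\<^sub>m (q + 1)" "scale c (trunc (q + 2)) \<in> unit_class (q + 2)"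
      unfolding scalar_mats_def H_def by blast
    have "op_of_mat A \<in> unit_class (q + 1)" unfolding c(1) op_of_mat_smult_one by (rule unit_class_chain[OF _ r c(2)]) simp
    moreover have "A = mat_of_op (q + 1) (q + 1) (op_of_mat A)" using c(1) by (simp add: mat_of_op_of_mat)
    ultimately show "A \<in> N" unfolding N_def by blast
  qed
qed

end

text \<open>The inclusions between consecutive ranks, iterated down to q + 2 and then continued by
  \<open>HN\<close> into rank q + 1, are the \<open>chain\<close> condition of
  \<open>congruence_rees_rel\<close>.\<close>

lemma (in rees_data) congruence_rees_N:
  assumes q: "enat q < r" and N: "N \<lhd> GL (q + 1)"
    and H: "\<And>p. q + 2 \<le> p \<Longrightarrow> enat p \<le> r \<Longrightarrow> subgroup (H p) field_units"
    and dec: "\<And>p. q + 2 \<le> p \<Longrightarrow> enat (p + 1) \<le> r \<Longrightarrow> H (p + 1) \<subseteq> H p"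
    and HN: "enat (q + 2) \<le> r \<Longrightarrow> scalar_mats (q + 1) (H (q + 2)) \<subseteq> N"
  shows "congruence (rank_ideal C r) (rees_N C V B r q (\<lambda>p. if p = q + 1 then N else scalar_mats p (H p)))"
proof -
  let ?N = "\<lambda>p. if p = q + 1 then N else scalar_mats p (H p)"
  have N': "N \<subseteq> carrier_mat (q + 1) (q + 1)" "normal_ops (q + 1) (op_of_mat ` N)"
    using N unfolding normal_GL_iff by auto
  have n: "?N p \<subseteq> carrier_mat p p \<and> normal_ops p (op_of_mat ` ?N p)" if p: "q < p" "enat p \<le> r" for p
  proof (cases "p = q + 1")
    case False
    then have "subgroup (H p) field_units" using H[of p] p by simp
    then show ?thesis using False by (simp add: op_of_scalar_mats scalar_mats_carrier normal_ops_scalar)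
  qed (use N' in simp)
  have mono: "H p \<subseteq> H k" if "q + 2 \<le> k" "k \<le> p" "enat p \<le> r" for k p
    using that(2,3)
  proof (induction p rule: dec_induct)
    case (step j)
    then show ?case using dec[of j] that(1) rk_trans_le[of j "Suc j" r] by force
  qed simp
  have "congruence (rank_ideal C r) {(mor U M W, mor U M' W) | U W M M'. rees_rel q (\<lambda>p. op_of_mat ` ?N p) U W M M'}"
  proof (rule congruence_rees_rel[OF q])
    show "normal_ops p (op_of_mat ` ?N p)" if "q < p" "enat p \<le> r" for p using n[OF that] by blast
    show "\<exists>c. G = scale c (trunc p)" if "q + 1 < p" "enat p \<le> r" "G \<in> op_of_mat ` ?N p" for p G
      using that by (auto simp: op_of_scalar_mats)
    fix p k c assume k: "q < k" "k < p" "enat p \<le> r" "scale c (trunc p) \<in> op_of_mat ` ?N p"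
    \<comment> \<open>As p is positive, a scalar matrix of size p determines its scalar, so c itself
      lies in \<open>H p\<close>.\<close>
    then obtain c' where c': "scale c (trunc p) = scale c' (trunc p)" "c' \<in> H p" by (auto simp: op_of_scalar_mats)
    then have c: "c \<in> H p" using scale_trunc_inject[of p c c'] k by simp
    show "scale c (trunc k) \<in> op_of_mat ` ?N k"
    proof (cases "k = q + 1")
      case True
      \<comment> \<open>The last step of the descent is from \<open>H (q + 2)\<close> into N, the
        only place where the two kinds of groups meet.\<close>
      have q2: "enat (q + 2) \<le> r" by (rule rk_trans_le[OF _ k(3)]) (use k in simp)
      have "c \<in> H (q + 2)" using mono[of "q + 2" p] k c True by auto
      then have "c \<cdot>\<^sub>m 1\<^sub>m (q + 1) \<in> N" using HN[OF q2] unfolding scalar_mats_def by blast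
      then have "op_of_mat (c \<cdot>\<^sub>m 1\<^sub>m (q + 1)) \<in> op_of_mat ` N" by (rule imageI)
      then show ?thesis using True by (simp add: op_of_mat_smult_one)
    next
      case False
      then have "c \<in> H k" using mono[of k p] k c by auto
      then show ?thesis using False by (auto simp: op_of_scalar_mats)
    qed
  qed
  then show ?thesis using rees_N_eq[OF less_imp_le[OF q] n] by simp
qed

theorem theorem11p8:
  fixes C :: "('a::field, 'v) module set"
    and V :: "nat \<Rightarrow> ('a, 'v) module"
    and B :: "nat \<Rightarrow> 'v list"
    and r :: enat
  assumes "C \<noteq> {}"
    and "\<And>U. U \<in> C \<Longrightarrow> vectorspace class_ring U \<and> vectorspace.fin_dim class_ring U"
    and "\<And>q. enat q < xi C \<Longrightarrow> V q \<in> C \<and> q \<le> vdim (V q) \<and> ordered_basis (V q) (B q)"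
    and "r < xi C \<or> (r = \<infinity> \<and> xi C = \<infinity>)"
  shows "{\<sigma>. congruence (rank_ideal C r) \<sigma>} =
    {nabla (rank_ideal C r)} \<union>
    {rees_N C V B r q (\<lambda>p. if p = q + 1 then N else scalar_mats p (H p)) | q N H.
       enat q < r \<and>
       N \<lhd> GL (q + 1) \<and>
       (\<forall>p. q + 2 \<le> p \<and> enat p \<le> r \<longrightarrow> subgroup (H p) field_units) \<and>
       (\<forall>p. q + 2 \<le> p \<and> enat (p + 1) \<le> r \<longrightarrow> H (p + 1) \<subseteq> H p) \<and>
       (enat (q + 2) \<le> r \<longrightarrow> scalar_mats (q + 1) (H (q + 2)) \<subseteq> N)}"
    (is "_ = {_} \<union> ?S")
proof -
  interpret rees_data C V B r by unfold_locales (use assms in blast)+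
  show ?thesis
  proof (intro equalityI subsetI)
    fix \<sigma> assume "\<sigma> \<in> {\<sigma>. congruence (rank_ideal C r) \<sigma>}"
    then interpret matrix_cong C r \<sigma> by unfold_locales simp
    show "\<sigma> \<in> {nabla (rank_ideal C r)} \<union> ?S"
    proof (cases "\<sigma> = nabla (rank_ideal C r)")
      case False
      then obtain q where q: "enat q < r" "\<forall>U\<in>C. \<forall>W\<in>C. \<forall>M\<in>Hom (vdim U) (vdim W).
          enat (rk M) \<le> r \<longrightarrow> rel U W M 0 = (rk M \<le> q)"
        using nabla_or_threshold by blast
      interpret threshold_rees C r \<sigma> q V B by unfold_locales (use q in simp_all)
      show ?thesis using sigma_rees_N q(1) by blast
    qed simp
  next
    fix \<sigma> assume "\<sigma> \<in> {nabla (rank_ideal C r)} \<union> ?S"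
    then consider "\<sigma> = nabla (rank_ideal C r)" | "\<sigma> \<in> ?S" by blast
    then show "\<sigma> \<in> {\<sigma>. congruence (rank_ideal C r) \<sigma>}"
    proof cases
      case 1
      then show ?thesis using congruence_nabla by simp
    next
      case 2
      then show ?thesis using congruence_rees_N by blast
    qed
  qed
qed

end
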